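(* Suppose that $N_R<N$. Then for all sufficiently large $\beta$ the following hold. (a) $\sigma(A(\beta))=\sigma_0(A(\beta))\cup\sigma_1(A(\beta))$ with $\sigma_0(A(\beta))\cap\sigma_1(A(\beta))=\emptyset$, and there exist unique invariant subspaces $H_{\ell\ell}(\beta)$, $H_{h\ell}(\beta)$ of $A(\beta)$ with $H=H_{h\ell}(\beta)\oplus H_{\ell\ell}(\beta)$, $\sigma(A(\beta)|_{H_{\ell\ell}(\beta)})=\sigma_0(A(\beta))$, $\sigma(A(\beta)|_{H_{h\ell}(\beta)})=\sigma_1(A(\beta))$; moreover $\dim H_{h\ell}(\beta)=N_R$, $\dim H_{\ell\ell}(\beta)=2N-N_R$. (b) One has $$\sigma(A(\beta)|_{H_{\ell\ell}(\beta)})=\{\zeta\in\sigma(A(\beta)):0\le-\operatorname{Im}\zeta\le\omega_{\max}\},$$ $$\sigma(A(\beta)|_{H_{h\ell}(\beta)})=\{\zeta\in\sigma(A(\beta)):-\operatorname{Im}\zeta\ge\beta b_{\min}-\omega_{\max}>\omega_{\max}\},$$ $$\max_{\zeta\in\sigma(A(\beta)|_{H_{h\ell}(\beta)})}Q_\zeta\le\frac12\,\frac{\omega_{\max}}{\beta b_{\min}-\omega_{\max}}<\frac12.$$ (c) $\beta>2\omega_{\max}/b_{\min}$, $c(\beta)<\rho_{\min}/2\le\omega_{\max}/2$, and $$\max_{\zeta\in\sigma(A(\beta)|_{H_{\ell\ell}(\beta)})}\ \min_{\rho\in\sigma(P_B^\perp\Omega P_B^\perp)}|\zeta-\rho|\le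 c(\beta),$$ so that for every $\zeta\in\sigma(A(\beta)|_{H_{\ell\ell}(\beta)})$ both $\min_{\rho\in\sigma(P_B^\perp\Omega P_B^\perp)}|\operatorname{Re}\zeta-\rho|$ and $-\operatorname{Im}\zeta$ lie in $[0,c(\beta)]$. There exist unique invariant subspaces $H_{\ell\ell,0}(\beta)$, $H_{\ell\ell,1}(\beta)$ of $A(\beta)$ such that $H_{\ell\ell}(\beta)=H_{\ell\ell,0}(\beta)\oplus H_{\ell\ell,1}(\beta)$, $$\sigma(A(\beta)|_{H_{\ell\ell,0}(\beta)})=\sigma(A(\beta))\cap D(0;c(\beta)),\qquad \sigma(A(\beta)|_{H_{\ell\ell,1}(\beta)})=\sigma(A(\beta))\cap\bigcup_{0\ne\rho\in\sigma(P_B^\perp\Omega P_B^\perp)}D(\rho;c(\beta)).$$ Furthermore, $$\sigma(A(\beta)|_{H_{\ell\ell,1}(\beta)})=\sigma(A(\beta))\cap\{\rho_{\min}/2<|\zeta|\le\omega_{\max}\},\qquad \sigma(A(\beta)|_{H_{\ell\ell,0}(\beta)})=\sigma(A(\beta))\cap\{|\zeta|<\rho_{\min}/2\}.$$ Moreover $\dim H_{\ell\ell,1}(\beta)=\dim\operatorname{Ran}(P_B^\perp\Omega P_B^\perp)$ and $\dim H_{\ell\ell,0}(\beta)=2N-N_R-\dim H_{\ell\ell,1}(\beta)$; in particular, if $\operatorname{Ker}R\cap\operatorname{Ker}\eta=\{0\}$ then $\dim H_{\ell\ell,1}(\beta)=2(N-N_R)$. (d) One has $$\sigma(A(\beta)|_{H_{\ell\ell,0}(\beta)})=\{\zeta\in\sigma(A(\beta)):0\le-\operatorname{Im}\zeta\le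 c(\beta)\text{ and }|\operatorname{Re}\zeta|\le c(\beta)\},$$ $$\sigma(A(\beta)|_{H_{\ell\ell,1}(\beta)})=\{\zeta\in\sigma(A(\beta)):0\le-\operatorname{Im}\zeta\le c(\beta)\text{ and }|\operatorname{Re}\zeta|\ge\rho_{\min}-c(\beta)\},$$ where $\rho_{\min}-c(\beta)>\max\{c(\beta),\rho_{\min}/2\}$, $\rho_{\min}/2\le\omega_{\max}/2$, and $c(\beta)\searrow0$ as $\beta\to\infty$. Moreover $$\min_{\zeta\in\sigma(A(\beta)|_{H_{\ell\ell,1}(\beta)})}Q_\zeta\ge\frac12\,\frac{\rho_{\min}-c(\beta)}{c(\beta)}>\frac14\,\frac{\rho_{\min}}{c(\beta)}\ge\frac12,$$ and in particular $\operatorname{Re}\zeta\ne0$ for every $\zeta\in\sigma(A(\beta)|_{H_{\ell\ell,1}(\beta)})$. (e) Furthermore, $$H_{h\ell}(\beta)=\operatorname{span}\Big\{w_j(\beta):\lim_{\beta\to\infty}|\zeta_j(\beta)|=\infty\Big\},$$ $$H_{\ell\ell,0}(\beta)=\operatorname{span}\Big\{w_j(\beta):\lim_{\beta\to\infty}\zeta_j(\beta)=\rho_j\text{ and }\rho_j=0\Big\},$$ $$H_{\ell\ell,1}(\beta)=\operatorname{span}\Big\{w_j(\beta)\in H_{\ell\ell}(\beta):\lim_{\beta\to\infty}\zeta_j(\beta)=\rho_j\text{ and }\rho_j\ne0\Big\}.$$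
   Context: Setting. $N\ge 1$; $\alpha,\eta,\theta,R$ are real $N\times N$ matrices with $\alpha^{\mathrm T}=\alpha>0$, $\eta^{\mathrm T}=\eta\ge0$, $\theta^{\mathrm T}=-\theta$, $R^{\mathrm T}=R\ge0$, and $N_R=\operatorname{rank}R>0$; $\beta\ge0$. $\sqrt{\cdot}$ denotes the positive semidefinite square root. On $H=\mathbb C^{2N}=\mathbb C^N\oplus\mathbb C^N$ set $$\Omega=\begin{bmatrix}-2\mathrm i\sqrt\alpha^{-1}\theta\sqrt\alpha^{-1} & -\mathrm i\Phi^{\mathrm T}\\ \mathrm i\Phi&0\end{bmatrix},\quad \Phi=\sqrt\eta\sqrt\alpha^{-1},\quad B=\begin{bmatrix}\sqrt\alpha^{-1}R\sqrt\alpha^{-1}&0\\0&0\end{bmatrix},\quad A(\beta)=\Omega-\mathrm i\beta B .$$ $\Omega$ is Hermitian, $B\ge0$, $\operatorname{rank}B=N_R$. $P_B^\perp$ is the orthogonal projection onto $\operatorname{Ker}B$, and $\Omega_1=P_B^\perp\Omega P_B^\perp|_{\operatorname{Ker}B}$. $\rho_{\min}$ denotes the smallest positive eigenvalue of the Hermitian matrix $P_B^\perp\Omega P_B^\perp$; it is defined whenever $P_B^\perp\Omega P_B^\perp\ne0$, which the source asserts to be equivalent to $N_R<N$. $\omega_{\max}=\|\Omega\|$ is the largest eigenvalue of $\Omega$; $b_{\min}$ is the smallest nonzero eigenvalue of $B$; $0=b_0<b_1\le\dots\le b_{N_R}$ are the eigenvalue $0$ and the nonzero eigenvalues of $B$ (with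 multiplicity). $D(\rho;r)=\{\lambda\in\mathbb C:|\lambda-\rho|\le r\}$, $D_j(\beta)=D(-\mathrm i\beta b_j;\omega_{\max})$, $\sigma_0(A(\beta))=\sigma(A(\beta))\cap D_0(\beta)$, $\sigma_1(A(\beta))=\sigma(A(\beta))\cap\bigcup_{j=1}^{N_R}D_j(\beta)$. The quality factor is $Q_\zeta=\frac12\frac{|\operatorname{Re}\zeta|}{-\operatorname{Im}\zeta}$, with $Q_\zeta=+\infty$ if $\operatorname{Im}\zeta=0\ne\operatorname{Re}\zeta$ and $Q_0=0$. Set $$c(\beta)=\frac{2\omega_{\max}^2}{b_{\min}}\Big[\beta-\frac{2\omega_{\max}}{b_{\min}}\Big]^{-1}\qquad\Big(\beta>\frac{2\omega_{\max}}{b_{\min}}\Big).$$ Eigenpairs for large $\beta$ (known facts). There is an orthonormal basis $\{\mathring w_j\}_{j=1}^{2N}$ of $H$ with $B\mathring w_j=b_j\mathring w_j$ for $1\le j\le N_R$ and $\mathring w_j\in\operatorname{Ker}B$, $\Omega_1\mathring w_j=\rho_j\mathring w_j$ for $N_R+1\le j\le 2N$, such that for all sufficiently large $\beta$ the operator $A(\beta)$ has a basis of eigenvectors $w_j(\beta)$, $A(\beta)w_j(\beta)=\zeta_j(\beta)w_j(\beta)$, where $w_j(\beta)=\mathring w_j+O(\beta^{-1})$ is analytic in $\beta^{-1}$ at $\beta=\infty$, $\zeta_j(\beta)=-\mathrm i b_j\beta+\rho_j+O(\beta^{-1})$ for $1\le j\le N_R$ with $\rho_j=(\mathring w_j,\Omega\mathring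 w_j)$ (a pole at $\beta=\infty$), and $\zeta_j(\beta)=\rho_j-\mathrm i d_j\beta^{-1}+O(\beta^{-2})$ for $N_R+1\le j\le 2N$ with $d_j\ge0$ (analytic at $\beta=\infty$).
   Formalization: The claims in (c) and (d) that mention ρ_min, the minimum of Q over σ(A|H_{ll,1}), and strictness of the decrease of c(β) are stated only when P_B^⊥ΩP_B^⊥ ≠ 0, since N_R<N does not ensure that ρ_min exists (e.g. η=θ=0). *)

theory Defs
  imports "HOL-Analysis.Analysis" "HOL-Library.Landau_Symbols"
begin

section \<open>Matrices\<close>

text \<open>\<open>\<complex>\<^sup>2\<^sup>N = \<complex>\<^sup>N \<oplus> \<complex>\<^sup>N\<close> is the type \<open>complex ^ ('n + 'n)\<close> with \<open>N = CARD('n)\<close>.  Dimension, span and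
  independence over the complex numbers are the constants \<open>vec.dim\<close>, \<open>vec.span\<close>,
  \<open>vec.independent\<close>; the unqualified ones are over the reals.\<close>

definition pos_semidef :: "real ^ 'n ^ 'n \<Rightarrow> bool" where
  "pos_semidef M \<longleftrightarrow> transpose M = M \<and> (\<forall>x. 0 \<le> x \<bullet> (M *v x))"

definition pos_def :: "real ^ 'n ^ 'n \<Rightarrow> bool" where
  "pos_def M \<longleftrightarrow> transpose M = M \<and> (\<forall>x. x \<noteq> 0 \<longrightarrow> 0 < x \<bullet> (M *v x))"

definition mat_sqrt :: "real ^ 'n ^ 'n \<Rightarrow> real ^ 'n ^ 'n" where
  "mat_sqrt M = (THE S. pos_semidef S \<and> S ** S = M)"

definition cscale :: "complex \<Rightarrow> complex ^ 'n ^ 'm \<Rightarrow> complex ^ 'n ^ 'm" where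
  "cscale c M = (\<chi> i j. c * M $ i $ j)"

definition complexify :: "real ^ 'n ^ 'm \<Rightarrow> complex ^ 'n ^ 'm" where
  "complexify M = (\<chi> i j. complex_of_real (M $ i $ j))"

definition block :: "'a ^ 'n ^ 'n \<Rightarrow> 'a ^ 'n ^ 'n \<Rightarrow> 'a ^ 'n ^ 'n \<Rightarrow> 'a ^ 'n ^ 'n
    \<Rightarrow> 'a ^ ('n + 'n) ^ ('n + 'n)" where
  "block M11 M12 M21 M22 = (\<chi> i j.
     case i of
       Inl k \<Rightarrow> (case j of Inl l \<Rightarrow> M11 $ k $ l | Inr l \<Rightarrow> M12 $ k $ l)
     | Inr k \<Rightarrow> (case j of Inl l \<Rightarrow> M21 $ k $ l | Inr l \<Rightarrow> M22 $ k $ l))"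

definition cinner :: "complex ^ 'n \<Rightarrow> complex ^ 'n \<Rightarrow> complex" where
  "cinner u v = (\<Sum>i\<in>UNIV. cnj (u $ i) * v $ i)"

definition ker :: "'a::semiring_1 ^ 'n ^ 'm \<Rightarrow> ('a ^ 'n) set" where
  "ker M = {x. M *v x = 0}"

definition orth_proj :: "(complex ^ 'n) set \<Rightarrow> complex ^ 'n ^ 'n" where
  "orth_proj S = (THE P. \<forall>x. P *v x \<in> S \<and> (\<forall>y\<in>S. cinner y (x - P *v x) = 0))"


section \<open>Spectra and invariant subspaces\<close>

text \<open>The spectrum of the restriction of \<open>M\<close> to an \<open>M\<close>-invariant subspace \<open>S\<close>; it is empty for
  \<open>S = {0}\<close>.\<close>

definition spectrum_on :: "complex ^ 'n ^ 'n \<Rightarrow> (complex ^ 'n) set \<Rightarrow> complex set" where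
  "spectrum_on M S = {z. \<not> bij_betw (\<lambda>x. M *v x - z *s x) S S}"

abbreviation spectrum :: "complex ^ 'n ^ 'n \<Rightarrow> complex set" where
  "spectrum M \<equiv> spectrum_on M UNIV"

definition invariant_subspace :: "complex ^ 'n ^ 'n \<Rightarrow> (complex ^ 'n) set \<Rightarrow> bool" where
  "invariant_subspace M S \<longleftrightarrow> vec.subspace S \<and> (\<forall>x\<in>S. M *v x \<in> S)"

definition direct_sum :: "(complex ^ 'n) set \<Rightarrow> (complex ^ 'n) set \<Rightarrow> (complex ^ 'n) set \<Rightarrow> bool" where
  "direct_sum S U V \<longleftrightarrow> S = {u + v | u v. u \<in> U \<and> v \<in> V} \<and> U \<inter> V = {0}"

definition spectral_splitting :: "complex ^ 'n ^ 'n \<Rightarrow> (complex ^ 'n) set \<Rightarrow>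
    complex set \<Rightarrow> complex set \<Rightarrow> (complex ^ 'n) set \<Rightarrow> (complex ^ 'n) set \<Rightarrow> bool" where
  "spectral_splitting M S Z0 Z1 U V \<longleftrightarrow>
     invariant_subspace M U \<and> invariant_subspace M V \<and> direct_sum S U V \<and>
     spectrum_on M U = Z0 \<and> spectrum_on M V = Z1"

definition unique_spectral_splitting :: "complex ^ 'n ^ 'n \<Rightarrow> (complex ^ 'n) set \<Rightarrow>
    complex set \<Rightarrow> complex set \<Rightarrow> (complex ^ 'n) set \<Rightarrow> (complex ^ 'n) set \<Rightarrow> bool" where
  "unique_spectral_splitting M S Z0 Z1 U V \<longleftrightarrow>
     spectral_splitting M S Z0 Z1 U V \<and>
     (\<forall>U' V'. spectral_splitting M S Z0 Z1 U' V' \<longrightarrow> U' = U \<and> V' = V)"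


section \<open>The system operator\<close>

definition Omega_mat :: "real ^ 'n ^ 'n \<Rightarrow> real ^ 'n ^ 'n \<Rightarrow> real ^ 'n ^ 'n
    \<Rightarrow> complex ^ ('n + 'n) ^ ('n + 'n)" where
  "Omega_mat \<alpha> \<eta> \<theta> =
     (let K = matrix_inv (mat_sqrt \<alpha>); \<Phi> = mat_sqrt \<eta> ** K in
      block (cscale (- 2 * \<i>) (complexify (K ** \<theta> ** K)))
            (cscale (- \<i>) (complexify (transpose \<Phi>)))
            (cscale \<i> (complexify \<Phi>))
            0)"

definition B_mat :: "real ^ 'n ^ 'n \<Rightarrow> real ^ 'n ^ 'n \<Rightarrow> complex ^ ('n + 'n) ^ ('n + 'n)" where
  "B_mat \<alpha> R = (let K = matrix_inv (mat_sqrt \<alpha>) in block (complexify (K ** R ** K)) 0 0 0)"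

definition A_mat :: "complex ^ 'm ^ 'm \<Rightarrow> complex ^ 'm ^ 'm \<Rightarrow> real \<Rightarrow> complex ^ 'm ^ 'm" where
  "A_mat \<Omega> B \<beta> = \<Omega> - cscale (\<i> * complex_of_real \<beta>) B"

definition compression :: "complex ^ 'm ^ 'm \<Rightarrow> complex ^ 'm ^ 'm \<Rightarrow> complex ^ 'm ^ 'm" where
  "compression \<Omega> B = orth_proj (ker B) ** \<Omega> ** orth_proj (ker B)"

text \<open>\<open>rho_min\<close> is meaningful only if \<open>compression \<Omega> B \<noteq> 0\<close>, since otherwise the set is empty.  This can
  happen for singular \<open>R\<close>, for instance if \<open>\<eta> = \<theta> = 0\<close>.\<close>

definition rho_min :: "complex ^ 'm ^ 'm \<Rightarrow> complex ^ 'm ^ 'm \<Rightarrow> real" where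
  "rho_min \<Omega> B = Min {x. 0 < x \<and> complex_of_real x \<in> spectrum (compression \<Omega> B)}"

definition omega_max :: "complex ^ 'm ^ 'm \<Rightarrow> real" where
  "omega_max \<Omega> = onorm (\<lambda>x. \<Omega> *v x)"

definition nonzero_eigvals :: "complex ^ 'm ^ 'm \<Rightarrow> real set" where
  "nonzero_eigvals B = {x. x \<noteq> 0 \<and> complex_of_real x \<in> spectrum B}"

definition b_min :: "complex ^ 'm ^ 'm \<Rightarrow> real" where
  "b_min B = Min (nonzero_eigvals B)"

text \<open>\<open>b_eig B 0 = 0\<close>, and \<open>b_eig B 1 \<le> b_eig B 2 \<le> \<dots>\<close> are the nonzero eigenvalues of the Hermitian
  matrix \<open>B\<close>, each repeated according to its multiplicity.\<close>

definition b_eig :: "complex ^ 'm ^ 'm \<Rightarrow> nat \<Rightarrow> real" where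
  "b_eig B j =
     (if j = 0 then 0
      else concat (map (\<lambda>x. replicate (vec.dim {v. B *v v = complex_of_real x *s v}) x)
                       (sorted_list_of_set (nonzero_eigvals B))) ! (j - 1))"

definition disc :: "complex ^ 'm ^ 'm \<Rightarrow> complex ^ 'm ^ 'm \<Rightarrow> real \<Rightarrow> nat \<Rightarrow> complex set" where
  "disc \<Omega> B \<beta> j = cball (- \<i> * complex_of_real (\<beta> * b_eig B j)) (omega_max \<Omega>)"

definition sigma0 :: "complex ^ 'm ^ 'm \<Rightarrow> complex ^ 'm ^ 'm \<Rightarrow> real \<Rightarrow> complex set" where
  "sigma0 \<Omega> B \<beta> = spectrum (A_mat \<Omega> B \<beta>) \<inter> disc \<Omega> B \<beta> 0"

definition sigma1 :: "nat \<Rightarrow> complex ^ 'm ^ 'm \<Rightarrow> complex ^ 'm ^ 'm \<Rightarrow> real \<Rightarrow> complex set" where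
  "sigma1 NR \<Omega> B \<beta> = spectrum (A_mat \<Omega> B \<beta>) \<inter> (\<Union>j\<in>{1..NR}. disc \<Omega> B \<beta> j)"

definition quality :: "complex \<Rightarrow> ereal" where
  "quality z =
     (if Im z = 0 then (if Re z = 0 then 0 else \<infinity>)
      else ereal (1 / 2 * (\<bar>Re z\<bar> / (- Im z))))"

definition c_bound :: "complex ^ 'm ^ 'm \<Rightarrow> complex ^ 'm ^ 'm \<Rightarrow> real \<Rightarrow> real" where
  "c_bound \<Omega> B \<beta> = 2 * (omega_max \<Omega>)\<^sup>2 / b_min B * inverse (\<beta> - 2 * omega_max \<Omega> / b_min B)"


section \<open>Eigenpairs near infinity\<close>

definition analytic_at_inf :: "(real \<Rightarrow> complex) \<Rightarrow> bool" where
  "analytic_at_inf f \<longleftrightarrow>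
     (\<exists>F. F analytic_on {0} \<and> (\<forall>\<^sub>F \<beta> in at_top. f \<beta> = F (complex_of_real (1 / \<beta>))))"

text \<open>An orthonormal basis \<open>w0\<close> together with eigenpairs \<open>(\<zeta> j \<beta>, w j \<beta>)\<close> of \<open>A_mat \<Omega> B \<beta>\<close>,
  \<open>j = 1, \<dots>, dim\<close>, and their expansions in powers of \<open>1 / \<beta>\<close>; for \<open>j \<le> NR\<close> the eigenvalue has a
  simple pole at \<open>\<beta> = \<infinity>\<close>.\<close>

definition eigenpair_expansion :: "nat \<Rightarrow> complex ^ 'm ^ 'm \<Rightarrow> complex ^ 'm ^ 'm \<Rightarrow>
    (nat \<Rightarrow> complex ^ 'm) \<Rightarrow> (nat \<Rightarrow> real \<Rightarrow> complex ^ 'm) \<Rightarrow> (nat \<Rightarrow> real \<Rightarrow> complex) \<Rightarrow>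
    (nat \<Rightarrow> real) \<Rightarrow> (nat \<Rightarrow> real) \<Rightarrow> bool" where
  "eigenpair_expansion NR \<Omega> B w0 w \<zeta> \<rho> d \<longleftrightarrow>
     (\<forall>j\<in>{1..CARD('m)}. \<forall>k\<in>{1..CARD('m)}. cinner (w0 j) (w0 k) = (if j = k then 1 else 0)) \<and>
     (\<forall>j\<in>{1..NR}. B *v w0 j = complex_of_real (b_eig B j) *s w0 j \<and>
        complex_of_real (\<rho> j) = cinner (w0 j) (\<Omega> *v w0 j)) \<and>
     (\<forall>j\<in>{NR + 1..CARD('m)}. w0 j \<in> ker B \<and>
        compression \<Omega> B *v w0 j = complex_of_real (\<rho> j) *s w0 j) \<and>
     (\<forall>\<^sub>F \<beta> in at_top.
        inj_on (\<lambda>j. w j \<beta>) {1..CARD('m)} \<and>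
        vec.independent ((\<lambda>j. w j \<beta>) ` {1..CARD('m)}) \<and>
        vec.span ((\<lambda>j. w j \<beta>) ` {1..CARD('m)}) = UNIV \<and>
        (\<forall>j\<in>{1..CARD('m)}. A_mat \<Omega> B \<beta> *v w j \<beta> = \<zeta> j \<beta> *s w j \<beta>)) \<and>
     (\<forall>j\<in>{1..CARD('m)}. (\<forall>i. analytic_at_inf (\<lambda>\<beta>. w j \<beta> $ i)) \<and>
        (\<lambda>\<beta>. norm (w j \<beta> - w0 j)) \<in> O[at_top](\<lambda>\<beta>. 1 / \<beta>)) \<and>
     (\<forall>j\<in>{1..NR}.
        analytic_at_inf (\<lambda>\<beta>. \<zeta> j \<beta> + \<i> * complex_of_real (b_eig B j * \<beta>)) \<and>
        (\<lambda>\<beta>. cmod (\<zeta> j \<beta> - (- \<i> * complex_of_real (b_eig B j * \<beta>) + complex_of_real (\<rho> j))))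
          \<in> O[at_top](\<lambda>\<beta>. 1 / \<beta>)) \<and>
     (\<forall>j\<in>{NR + 1..CARD('m)}. 0 \<le> d j \<and> analytic_at_inf (\<zeta> j) \<and>
        (\<lambda>\<beta>. cmod (\<zeta> j \<beta> - (complex_of_real (\<rho> j) - \<i> * complex_of_real (d j / \<beta>))))
          \<in> O[at_top](\<lambda>\<beta>. 1 / \<beta>\<^sup>2))"

end

theory Submission
  imports Defs "HOL-Computational_Algebra.Fundamental_Theorem_Algebra"
begin

text \<open>
  The splittings are given by sums of root spaces.  Their dimensions are found without perturbation
  theory, from Lyapunov's theorem: if \<open>Re \<langle>x, J N x\<rangle> > 0\<close> for all nonzero \<open>x\<close> in an \<open>N\<close>-invariant subspace
  on which the spectrum of \<open>N\<close> lies in the right (left) half plane, then the Hermitian form \<open>J\<close> is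
  positive (negative) there.  Let \<open>P\<close> be the projection onto \<open>ker B\<close> and \<open>R\<close> the one onto the range of
  \<open>C = P \<Omega> P\<close>.  With \<open>J = \<epsilon>\<^sup>2 P - (1 - P)\<close> and \<open>N = - \<i> A + \<beta> b\<^sub>m\<^sub>i\<^sub>n / 2\<close> this shows that \<open>P\<close> is injective on the
  low-loss space, where even \<open>\<bar>x - P x\<bar> \<le> \<epsilon> \<bar>P x\<bar>\<close>, and \<open>1 - P\<close> on the high-loss space; with
  \<open>J = 2 R - P\<close> and \<open>N = A\<^sup>2 - \<rho>\<^sub>m\<^sub>i\<^sub>n\<^sup>2 / 4\<close> it shows the same for \<open>R\<close> and \<open>P - R\<close> on the two parts of the
  low-loss space.  All these bounds for dimensions add up to \<open>2 N\<close>, so they are equalities.  The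
  bound \<open>c(\<beta>)\<close> comes from eliminating \<open>x - P x\<close> from the eigenvalue equation.  In (e) each
  eigenvector lies in one of the three subspaces by the location of its eigenvalue, and together
  they span everything.
\<close>

section \<open>Root spaces\<close>

text \<open>\<open>A \<beta>\<close> is not normal: its eigenvectors need not be orthogonal, it may
  have Jordan blocks, and the discs that localise the eigenvalues do not reveal the sizes of the
  spectral subspaces. A strict Lyapunov inequality ignores Jordan blocks and holds for one fixed
  \<open>\<beta>\<close>. The form \<open>J\<close> is indefinite; a subspace on which it has one
  sign meets the part of the opposite sign trivially, so the projection onto the other part is
  injective on it. For the second pair \<open>A\<close> has to be squared, because eigenvalues near
  \<open>\<rho>\<close> and near \<open>- \<rho>\<close> lie on both sides of those near 0; squaring
  moves them to the same side of the line \<open>Re = r\<^sup>2 / 4\<close>, provided that the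
  imaginary parts are small, which is what the bound \<open>c\<close> supplies. All forms are
  computed with the real inner product on \<open>complex ^ 'm\<close>, the real part of
  \<open>cinner\<close>. For complex subspaces real and complex orthogonality agree, so facts about
  Euclidean spaces apply. If \<open>C = 0\<close>, there is no smallest positive eigenvalue,
  \<open>Z1\<close> is empty, and this case is treated apart.\<close>

lemma invariant_subspaceD:
  assumes "invariant_subspace M S"
  shows "vec.subspace S" "x \<in> S \<Longrightarrow> M *v x \<in> S"
  using assms by (auto simp: invariant_subspace_def)

text \<open>Rank-nullity inside a subspace. It turns the definition of \<open>spectrum_on\<close>,
  which asks for bijectivity, into a question about eigenvectors only.\<close>

lemma inj_on_subspace_imp_surj:
  fixes f :: "'a::field ^ 'n \<Rightarrow> 'a ^ 'n"
  assumes "Vector_Spaces.linear (*s) (*s) f" "vec.subspace S" "f ` S \<subseteq> S"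
    and "\<And>x. x \<in> S \<Longrightarrow> f x = 0 \<Longrightarrow> x = 0"
  shows "f ` S = S" "inj_on f S"
proof -
  interpret f: Vector_Spaces.linear "(*s)" "(*s)" f by fact
  show inj: "inj_on f S"
  proof (rule inj_onI)
    fix x y assume xy: "x \<in> S" "y \<in> S" "f x = f y"
    then have "f (x - y) = 0" by (simp add: f.diff)
    with assms(4)[of "x - y"] xy assms(2) show "x = y" by (simp add: vec.subspace_diff)
  qed
  have "vec.dim (f ` S) = vec.dim S"
    using vec.dim_image_eq[OF assms(1)] inj assms(2) by (simp add: vec.span_eq_iff[THEN iffD2])
  moreover have "vec.subspace (f ` S)"
    using f.subspace_image assms(2) by blast
  ultimately show "f ` S = S"
    using vec.subspace_dim_equal[of "f ` S" S] assms by simp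
qed

lemma matrix_uminus_vector_mult: "(- M) *v x = - (M *v x)" for M :: "'a::ring_1 ^ 'n ^ 'm"
  by (simp add: matrix_vector_mult_def vec_eq_iff sum_negf)

lemma matrix_vector_mult_uminus: "M *v (- x) = - (M *v x)" for M :: "'a::ring_1 ^ 'n ^ 'm"
  by (simp add: matrix_vector_mult_def vec_eq_iff sum_negf)

lemma linear_shift: "Vector_Spaces.linear (*s) (*s) (\<lambda>x. M *v x - z *s x)"
  for M :: "complex ^ 'n ^ 'n"
  by unfold_locales (auto simp: matrix_vector_right_distrib vec.scale_right_distrib
      vector_smult_assoc vec.scale_right_diff_distrib vector_scalar_commute mult.commute)

lemma spectrum_on_iff:
  assumes "invariant_subspace M S"
  shows "z \<in> spectrum_on M S \<longleftrightarrow> (\<exists>x\<in>S. x \<noteq> 0 \<and> M *v x = z *s x)"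
proof -
  have S: "vec.subspace S" "(\<lambda>x. M *v x - z *s x) ` S \<subseteq> S"
    using invariant_subspaceD[OF assms] by (auto intro!: vec.subspace_diff vec.subspace_scale)
  show ?thesis
  proof
    assume z: "z \<in> spectrum_on M S"
    show "\<exists>x\<in>S. x \<noteq> 0 \<and> M *v x = z *s x"
    proof (rule ccontr)
      assume "\<not> ?thesis"
      then have "\<And>x. x \<in> S \<Longrightarrow> M *v x - z *s x = 0 \<Longrightarrow> x = 0" by auto
      from inj_on_subspace_imp_surj[OF linear_shift S this] z show False
        by (auto simp: spectrum_on_def bij_betw_def)
    qed
  next
    assume "\<exists>x\<in>S. x \<noteq> 0 \<and> M *v x = z *s x"
    then obtain x where x: "x \<in> S" "x \<noteq> 0" "M *v x - z *s x = M *v 0 - z *s 0" by auto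
    have "0 \<in> S" using S vec.subspace_0 by blast
    with x have "\<not> inj_on (\<lambda>x. M *v x - z *s x) S" unfolding inj_on_def by blast
    then show "z \<in> spectrum_on M S" by (auto simp: spectrum_on_def bij_betw_def)
  qed
qed

lemma invariant_subspace_UNIV [simp]: "invariant_subspace M UNIV"
  by (simp add: invariant_subspace_def)

lemma spectrum_iff: "z \<in> spectrum M \<longleftrightarrow> (\<exists>x. x \<noteq> 0 \<and> M *v x = z *s x)"
  by (simp add: spectrum_on_iff)

lemma invariant_subspace_zero [simp]: "invariant_subspace M {0}"
  by (simp add: invariant_subspace_def)

lemma invariant_subspace_Int:
  "invariant_subspace M S \<Longrightarrow> invariant_subspace M T \<Longrightarrow> invariant_subspace M (S \<inter> T)"
  by (simp add: invariant_subspace_def vec.subspace_inter)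

lemma shift_surj_on:
  assumes "invariant_subspace M S" "z \<notin> spectrum_on M S" "u \<in> S"
  obtains w where "w \<in> S" "M *v w - z *s w = u"
proof -
  have "u \<in> (\<lambda>x. M *v x - z *s x) ` S"
    using assms(2,3) by (auto simp: spectrum_on_def bij_betw_def)
  then show thesis using that by blast
qed

text \<open>\<open>pev p M x\<close> is \<open>p(M) x\<close>, evaluated by Horner's scheme.\<close>

definition pev :: "complex poly \<Rightarrow> complex ^ 'm ^ 'm \<Rightarrow> complex ^ 'm \<Rightarrow> complex ^ 'm" where
  "pev p M x = fold_coeffs (\<lambda>a y. a *s x + M *v y) p 0"

lemma pev_0 [simp]: "pev 0 M x = 0"
  by (simp add: pev_def)

lemma pev_pCons [simp]: "pev (pCons a p) M x = a *s x + M *v pev p M x"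
  by (cases "p = 0 \<and> a = 0") (auto simp: pev_def fold_coeffs_pCons_coeff_not_0_eq fold_coeffs_pCons_not_0_0_eq)

lemma pev_add: "pev (p + q) M x = pev p M x + pev q M x"
  by (induction p q rule: poly_induct2) (auto simp: matrix_vector_right_distrib vec.scale_left_distrib)

lemma pev_smult: "pev (smult c p) M x = c *s pev p M x"
  by (induction p) (auto simp: vec.scale_right_distrib vector_scalar_commute)

lemma pev_mult: "pev (p * q) M x = pev p M (pev q M x)"
  by (induction p) (auto simp: pev_add pev_smult)

lemma pev_eigen: "M *v x = z *s x \<Longrightarrow> pev p M x = poly p z *s x"
  by (induction p) (auto simp: vec.scale_left_distrib vector_scalar_commute vec.scale_scale mult.commute)

lemma pev_right_add: "pev p M (x + y) = pev p M x + pev p M y"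
  by (induction p) (auto simp: vec.scale_right_distrib matrix_vector_right_distrib)

lemma pev_right_scale: "pev p M (c *s x) = c *s pev p M x"
  by (induction p) (auto simp: vec.scale_right_distrib vector_scalar_commute vec.scale_scale mult.commute)

lemma pev_right_zero [simp]: "pev p M 0 = 0"
  using pev_right_scale[of p M 0 0] by simp

lemma pev_in:
  assumes "invariant_subspace M S" "x \<in> S"
  shows "pev p M x \<in> S"
  using invariant_subspaceD[OF assms(1)] assms(2)
  by (induction p) (auto intro!: vec.subspace_add vec.subspace_scale simp: vec.subspace_0)

lemma pev_sum: "finite I \<Longrightarrow> pev (sum f I) M x = (\<Sum>i\<in>I. pev (f i) M x)"
  by (induction I rule: finite_induct) (auto simp: pev_add)

lemma pev_monom: "pev (monom c k) M x = c *s pev (monom 1 k) M x"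
  by (metis mult.right_neutral pev_smult smult_monom)

section \<open>Annihilating polynomials and eigenvectors modulo an invariant subspace\<close>

text \<open>The \<open>CARD('m) + 1\<close> vectors \<open>x\<close>, \<open>M x\<close>,
  \<open>M (M x)\<close>, ... cannot be independent, and a linear relation between them is a
  polynomial.\<close>

lemma exists_annihilating_poly:
  fixes M :: "complex ^ 'm ^ 'm"
  shows "\<exists>p. p \<noteq> 0 \<and> pev p M x = 0"
proof -
  define v where "v k = pev (monom 1 k) M x" for k
  show ?thesis
  \<comment> \<open>Dependence is a property of sets, so a repetition among the powers would go
    unnoticed; it yields a difference of two monomials directly.\<close>
  proof (cases "inj_on v {..CARD('m)}")
    case False
    then obtain j k where "j \<noteq> k" "v j = v k" by (auto simp: inj_on_def)
    then have "pev (monom 1 j + smult (-1) (monom 1 k)) M x = 0"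
      by (simp add: pev_add v_def pev_monom[of "-1"] smult_monom)
    moreover have "monom 1 j + smult (-1) (monom 1 k) \<noteq> (0::complex poly)"
    proof
      assume "monom 1 j + smult (-1) (monom 1 k) = (0::complex poly)"
      then have "coeff (monom 1 j + smult (-1) (monom 1 k) :: complex poly) j = 0" by simp
      with \<open>j \<noteq> k\<close> show False by simp
    qed
    ultimately show ?thesis by blast
  next
    case True
    have "vec.dim (v ` {..CARD('m)}) \<le> CARD('m)" by (rule dim_subset_UNIV_cart_gen)
    then have "vec.dependent (v ` {..CARD('m)})"
      by (intro vec.dependent_biggerset_general) (simp add: card_image[OF True])
    then obtain u w where u: "w \<in> v ` {..CARD('m)}" "u w \<noteq> 0" "(\<Sum>y\<in>v ` {..CARD('m)}. u y *s y) = 0"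
      by (subst (asm) vec.dependent_finite) auto
    obtain k where k: "k \<le> CARD('m)" "w = v k" using u(1) by auto
    define p where "p = (\<Sum>i\<le>CARD('m). monom (u (v i)) i)"
    have "pev p M x = (\<Sum>i\<le>CARD('m). u (v i) *s v i)"
      unfolding p_def by (subst pev_sum) (auto simp: v_def intro!: sum.cong pev_monom)
    also have "\<dots> = 0"
      using u(3) by (simp add: sum.reindex[OF True])
    finally have "pev p M x = 0" .
    moreover have "coeff p k = u (v k)"
      using k by (simp add: p_def coeff_sum if_distrib cong: if_cong)
    then have "p \<noteq> 0" using k u by auto
    ultimately show ?thesis by blast
  qed
qed

text \<open>An eigenvector of the map induced modulo \<open>W\<close>, without forming a quotient
  space. It replaces triangular and Jordan forms below: an invariant subspace that is still too
  small can be extended by such a vector.\<close>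

lemma quotient_eigenvector:
  assumes W: "invariant_subspace M W" and S: "invariant_subspace M S" and "\<not> S \<subseteq> W"
  obtains y z where "y \<in> S" "y \<notin> W" "M *v y - z *s y \<in> W"
proof -
  obtain x where x: "x \<in> S" "x \<notin> W" using assms(3) by blast
  \<comment> \<open>A polynomial of least degree that sends \<open>x\<close> into \<open>W\<close>.
    Split off a linear factor \<open>X - z\<close>: by minimality the cofactor still leads outside
    \<open>W\<close>, and \<open>M - z\<close> then leads into it.\<close>
  define P where "P p \<longleftrightarrow> p \<noteq> 0 \<and> pev p M x \<in> W" for p
  obtain p0 where "p0 \<noteq> 0" "pev p0 M x = 0" using exists_annihilating_poly by blast
  then have "P p0" using W by (simp add: P_def invariant_subspace_def vec.subspace_0)
  then obtain p where p: "P p" and min: "\<And>q. P q \<Longrightarrow> degree p \<le> degree q"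
    using ex_has_least_nat[of P p0 degree] by blast
  have "degree p \<noteq> 0"
  proof
    assume "degree p = 0"
    then obtain a where a: "p = [:a:]" by (rule degree_eq_zeroE)
    with p have "a \<noteq> 0" "a *s x \<in> W" by (auto simp: P_def)
    then have "(1 / a) *s (a *s x) \<in> W" using invariant_subspaceD(1)[OF W] vec.subspace_scale by blast
    with x \<open>a \<noteq> 0\<close> show False by (simp add: vec.scale_scale)
  qed
  then have "\<not> constant (poly p)" by (simp add: constant_degree)
  then obtain z where "poly p z = 0" using fundamental_theorem_of_algebra by blast
  then obtain q where q: "p = [:- z, 1:] * q" by (metis dvdE poly_eq_0_iff_dvd)
  have "q \<noteq> 0" using p q by (auto simp: P_def)
  then have "degree p = Suc (degree q)" unfolding q by (subst degree_mult_eq) auto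
  then have "\<not> P q" using min by fastforce
  then have "pev q M x \<notin> W" using \<open>q \<noteq> 0\<close> by (simp add: P_def)
  moreover have "pev q M x \<in> S" using pev_in[OF S] x by blast
  moreover have "pev p M x = M *v pev q M x - z *s pev q M x"
    by (simp only: q pev_mult) simp
  then have "M *v pev q M x - z *s pev q M x \<in> W" using p by (simp add: P_def)
  ultimately show thesis using that by blast
qed

text \<open>If \<open>z\<close> is not an eigenvalue on \<open>W\<close>, then \<open>M - z\<close>
  is onto there, and subtracting a solution \<open>w\<close> from \<open>W\<close> turns the
  eigenvector modulo \<open>W\<close> into a genuine one in \<open>S\<close>.\<close>

lemma quotient_eigenvalue_in_spectrum:
  assumes W: "invariant_subspace M W" and S: "invariant_subspace M S"
    and y: "y \<in> S" "y \<notin> W" "M *v y - z *s y \<in> W" and "W \<subseteq> S"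
  shows "z \<in> spectrum_on M S"
proof (cases "z \<in> spectrum_on M W")
  case True
  then show ?thesis using spectrum_on_iff[OF W] spectrum_on_iff[OF S] \<open>W \<subseteq> S\<close> by blast
next
  case False
  then obtain w where w: "w \<in> W" "M *v w - z *s w = M *v y - z *s y"
    using shift_surj_on[OF W _ y(3)] by blast
  have "M *v (y - w) = z *s (y - w)"
    using w by (simp add: matrix_vector_mult_diff_distrib vec.scale_right_diff_distrib algebra_simps)
  moreover have "y - w \<noteq> 0" using w y by auto
  moreover have "y - w \<in> S" using w y \<open>W \<subseteq> S\<close> S by (auto simp: invariant_subspace_def intro: vec.subspace_diff)
  ultimately show ?thesis using spectrum_on_iff[OF S] by blast
qed

lemma spectrum_on_empty:
  assumes "invariant_subspace M S" "spectrum_on M S = {}"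
  shows "S = {0}"
proof (rule ccontr)
  assume "S \<noteq> {0}"
  moreover have "0 \<in> S" using assms(1) by (simp add: invariant_subspace_def vec.subspace_0)
  ultimately have "\<not> S \<subseteq> {0}" by blast
  then obtain y z where "y \<in> S" "y \<notin> {0}" "M *v y - z *s y \<in> {0}"
    using quotient_eigenvector[OF invariant_subspace_zero assms(1)] by blast
  with assms show False using spectrum_on_iff[OF assms(1), of z] by auto
qed

text \<open>One polynomial kills every vector: the product of annihilating polynomials of the unit
  vectors. The eigenvalues are among its roots.\<close>

lemma finite_spectrum_on:
  fixes M :: "complex ^ 'm ^ 'm"
  assumes S: "invariant_subspace M S"
  shows "finite (spectrum_on M S)"
proof -
  obtain p where p: "\<And>x. p x \<noteq> 0" "\<And>x. pev (p x) M x = 0"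
    using exists_annihilating_poly[of M] by metis
  define q where "q = (\<Prod>i\<in>UNIV. p (axis i 1))"
  have axis: "pev q M (axis i 1) = 0" for i
  proof -
    have "q = (\<Prod>j\<in>UNIV - {i}. p (axis j 1)) * p (axis i 1)"
      unfolding q_def by (subst prod.remove[of UNIV i]) (auto simp: mult.commute)
    then show ?thesis by (simp add: pev_mult p(2))
  qed
  have "Vector_Spaces.linear (*s) (*s) (pev q M)"
    by unfold_locales (auto simp: pev_right_add pev_right_scale)
  then interpret Vector_Spaces.linear "(*s)" "(*s)" "pev q M" .
  have "pev q M (\<Sum>i\<in>UNIV. x $ i *s axis i 1) = 0" for x
    by (simp add: sum scale axis)
  then have ann: "pev q M x = 0" for x by (simp add: basis_expansion)
  have "poly q z = 0" if "z \<in> spectrum_on M S" for z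
    using that pev_eigen[of M _ z q] by (auto simp: spectrum_on_iff[OF S] ann)
  then have "spectrum_on M S \<subseteq> {z. poly q z = 0}" by blast
  moreover have "finite {z. poly q z = 0}" by (rule poly_roots_finite) (simp add: q_def p(1))
  ultimately show ?thesis by (rule finite_subset)
qed

section \<open>Root spaces and the uniqueness of spectral splittings\<close>

text \<open>The sum of the generalised eigenspaces for the points of \<open>Z\<close>; the arbitrary
  power \<open>k\<close> makes room for Jordan blocks of any size. Meant for finite
  \<open>Z\<close>: over an infinite set the product is 1 and the space is
  \<open>{0}\<close>.\<close>

definition root_space :: "complex ^ 'm ^ 'm \<Rightarrow> complex set \<Rightarrow> (complex ^ 'm) set" where
  "root_space M Z = {x. \<exists>k. pev ((\<Prod>z\<in>Z. [:- z, 1:]) ^ k) M x = 0}"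

lemma invariant_root_space: "invariant_subspace M (root_space M Z)"
proof -
  define p where "p = (\<Prod>z\<in>Z. [:- z, 1:])"
  have mono: "pev (p ^ (k + l)) M x = 0" if "pev (p ^ k) M x = 0" for k l x
    using that by (metis add.commute pev_mult pev_right_zero power_add)
  have "vec.subspace (root_space M Z)"
  proof (rule vec.subspaceI)
    fix x y assume "x \<in> root_space M Z" "y \<in> root_space M Z"
    then obtain k l where "pev (p ^ k) M x = 0" "pev (p ^ l) M y = 0" by (auto simp: root_space_def p_def)
    then have "pev (p ^ (k + l)) M (x + y) = 0"
      using mono[of k x l] mono[of l y k] by (simp add: pev_right_add add.commute)
    then show "x + y \<in> root_space M Z" by (auto simp: root_space_def p_def)
  qed (auto simp: root_space_def pev_right_scale)
  moreover have "M *v x \<in> root_space M Z" if x: "x \<in> root_space M Z" for x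
  proof -
    obtain k where k: "pev (p ^ k) M x = 0" using x by (auto simp: root_space_def p_def)
    have "pev (p ^ k) M (M *v x) = pev (p ^ k) M (pev [:0, 1:] M x)" by simp
    also have "\<dots> = pev [:0, 1:] M (pev (p ^ k) M x)" by (metis mult.commute pev_mult)
    finally have "pev (p ^ k) M (M *v x) = 0" using k by simp
    then show ?thesis by (auto simp: root_space_def p_def)
  qed
  ultimately show ?thesis by (simp add: invariant_subspace_def)
qed

text \<open>One more power of the defining product contributes the factor \<open>X - z\<close>, so
  preimages under \<open>M - z\<close> stay inside. This closure property is what combines with
  \<open>quotient_eigenvector\<close>.\<close>

lemma root_space_step:
  assumes "finite Z" "z \<in> Z" "M *v y - z *s y \<in> root_space M Z"
  shows "y \<in> root_space M Z"
proof -
  define p where "p = (\<Prod>z\<in>Z. [:- z, 1:])"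
  obtain k where k: "pev (p ^ k) M (M *v y - z *s y) = 0" using assms(3) by (auto simp: root_space_def p_def)
  obtain q where q: "p = q * [:- z, 1:]"
    using prod.remove[OF assms(1,2), of "\<lambda>z. [:- z, 1:]"] by (auto simp: p_def mult.commute)
  have "pev (p ^ Suc k) M y = pev (p ^ k * q * [:- z, 1:]) M y" by (simp only: q power_Suc mult_ac)
  also have "\<dots> = pev (q * p ^ k) M (M *v y - z *s y)" by (simp only: pev_mult[of _ "[:- z, 1:]"] mult.commute) simp
  also have "\<dots> = 0" by (simp add: pev_mult k)
  finally show ?thesis by (auto simp: root_space_def p_def intro!: exI[of _ "Suc k"])
qed

lemma eigenvector_in_root_space:
  assumes "finite Z" "z \<in> Z" "M *v x = z *s x"
  shows "x \<in> root_space M Z"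
  by (rule root_space_step[OF assms(1,2)]) (use invariant_root_space[of M Z] assms in \<open>simp add: invariant_subspace_def vec.subspace_0\<close>)

text \<open>On an eigenvector a polynomial in \<open>M\<close> acts as its value at the eigenvalue,
  so membership in the root space forces a root of the product, that is, a point of
  \<open>Z\<close>.\<close>

lemma spectrum_on_root_space:
  assumes Z: "finite Z" and S: "invariant_subspace M S"
  shows "spectrum_on M (S \<inter> root_space M Z) = spectrum_on M S \<inter> Z"
proof -
  have I: "invariant_subspace M (S \<inter> root_space M Z)" by (simp add: S invariant_root_space invariant_subspace_Int)
  have *: "z \<in> Z" if x: "x \<noteq> 0" "M *v x = z *s x" "x \<in> root_space M Z" for x z
  proof -
    obtain k where "pev ((\<Prod>z\<in>Z. [:- z, 1:]) ^ k) M x = 0" using x by (auto simp: root_space_def)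
    then have "poly (\<Prod>z\<in>Z. [:- z, 1:]) z = 0" using x by (simp add: pev_eigen poly_power)
    then show ?thesis using Z by (auto simp: poly_prod)
  qed
  show ?thesis
  proof (intro set_eqI iffI)
    fix z assume "z \<in> spectrum_on M (S \<inter> root_space M Z)"
    then show "z \<in> spectrum_on M S \<inter> Z" using * by (auto simp: spectrum_on_iff[OF S] spectrum_on_iff[OF I])
  next
    fix z assume "z \<in> spectrum_on M S \<inter> Z"
    then obtain x where "x \<in> S" "x \<noteq> 0" "M *v x = z *s x" "z \<in> Z" by (auto simp: spectrum_on_iff[OF S])
    then show "z \<in> spectrum_on M (S \<inter> root_space M Z)"
      using eigenvector_in_root_space[OF Z] by (auto simp: spectrum_on_iff[OF I])
  qed
qed

text \<open>Maximality of the root space, the source of uniqueness. Otherwise there is an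
  eigenvector of \<open>U\<close> modulo the part already inside; its eigenvalue lies in
  \<open>Z\<close>, so \<open>root_space_step\<close> pulls it in.\<close>

lemma invariant_subset_root_space:
  assumes Z: "finite Z" and U: "invariant_subspace M U" and "spectrum_on M U \<subseteq> Z"
  shows "U \<subseteq> root_space M Z"
proof (rule ccontr)
  assume "\<not> U \<subseteq> root_space M Z"
  then have "\<not> U \<subseteq> U \<inter> root_space M Z" by blast
  moreover have I: "invariant_subspace M (U \<inter> root_space M Z)" by (simp add: U invariant_root_space invariant_subspace_Int)
  ultimately obtain y z where y: "y \<in> U" "y \<notin> U \<inter> root_space M Z" "M *v y - z *s y \<in> U \<inter> root_space M Z"
    using quotient_eigenvector[OF _ U] by blast
  then have "z \<in> Z" using quotient_eigenvalue_in_spectrum[OF I U y] assms(3) by blast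
  then show False using root_space_step[OF Z] y by blast
qed

lemma root_space_Int:
  assumes "finite Z0" "finite Z1" "Z0 \<inter> Z1 = {}"
  shows "root_space M Z0 \<inter> root_space M Z1 = {0}"
proof (rule spectrum_on_empty[of M])
  show "invariant_subspace M (root_space M Z0 \<inter> root_space M Z1)" by (simp add: invariant_root_space invariant_subspace_Int)
  have "spectrum_on M (root_space M Z0 \<inter> root_space M Z1) \<subseteq> Z0 \<inter> Z1"
    using spectrum_on_root_space[OF assms(2) invariant_root_space, of M Z0] spectrum_on_root_space[OF assms(1) invariant_subspace_UNIV, of M] by auto
  then show "spectrum_on M (root_space M Z0 \<inter> root_space M Z1) = {}" using assms by blast
qed

text \<open>Suppose that the sum misses a part of \<open>S\<close> and take an eigenvector
  \<open>y\<close> modulo the sum. Its eigenvalue \<open>z\<close> lies in one of \<open>Z0\<close>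
  and \<open>Z1\<close>, and \<open>M - z\<close> is invertible on the part that belongs to the
  other set.\<close>

lemma direct_sum_root_space:
  assumes Z0: "finite Z0" and Z1: "finite Z1" and disj: "Z0 \<inter> Z1 = {}"
    and S: "invariant_subspace M S" and spec: "spectrum_on M S \<subseteq> Z0 \<union> Z1"
  shows "direct_sum S (S \<inter> root_space M Z0) (S \<inter> root_space M Z1)"
proof -
  let ?U = "S \<inter> root_space M Z0" and ?V = "S \<inter> root_space M Z1"
  let ?W = "{u + v | u v. u \<in> ?U \<and> v \<in> ?V}"
  have U: "invariant_subspace M ?U" and V: "invariant_subspace M ?V"
    by (simp_all add: S invariant_root_space invariant_subspace_Int)
  have "M *v (u + v) \<in> ?W" if "u \<in> ?U" "v \<in> ?V" for u v
    using that invariant_subspaceD(2)[OF U] invariant_subspaceD(2)[OF V]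
    by (auto simp: matrix_vector_right_distrib)
  then have W: "invariant_subspace M ?W"
    using vec.subspace_sums[of ?U ?V] U V unfolding invariant_subspace_def by blast
  have WS: "?W \<subseteq> S" using S by (auto simp: invariant_subspace_def intro: vec.subspace_add)
  have 0: "0 \<in> ?U" "0 \<in> ?V" using U V unfolding invariant_subspace_def by (blast dest: vec.subspace_0)+
  have UW: "?U \<subseteq> ?W"
  proof
    fix x assume "x \<in> ?U"
    then have "x = x + 0 \<and> x \<in> ?U \<and> 0 \<in> ?V" using 0 by simp
    then show "x \<in> ?W" by blast
  qed
  have VW: "?V \<subseteq> ?W"
  proof
    fix x assume "x \<in> ?V"
    then have "x = 0 + x \<and> 0 \<in> ?U \<and> x \<in> ?V" using 0 by simp
    then show "x \<in> ?W" by blast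
  qed
  have "S \<subseteq> ?W"
  proof (rule ccontr)
    assume "\<not> S \<subseteq> ?W"
    then obtain y z where y: "y \<in> S" "y \<notin> ?W" "M *v y - z *s y \<in> ?W"
      using quotient_eigenvector[OF W S] by blast
    then obtain u v where uv: "M *v y - z *s y = u + v" "u \<in> ?U" "v \<in> ?V" by blast
    \<comment> \<open>The component \<open>v'\<close> of \<open>M y - z y\<close> in the part where
      \<open>z\<close> is no eigenvalue is removed by solving \<open>M w - z w = v'\<close> there.
      Then \<open>y - w\<close> lies in the root space containing \<open>z\<close>, so
      \<open>y\<close> belongs to the sum after all.\<close>
    have key: "False" if Z: "finite Z" "z \<in> Z" and TW: "S \<inter> root_space M Z \<subseteq> ?W"
      and T': "invariant_subspace M T'" "T' \<subseteq> ?W" "z \<notin> spectrum_on M T'" "v' \<in> T'"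
      and eq: "M *v y - z *s y - v' \<in> root_space M Z" for Z v' T'
    proof -
      obtain w where w: "w \<in> T'" "M *v w - z *s w = v'"
        using shift_surj_on[OF T'(1,3,4)] by blast
      have "M *v (y - w) - z *s (y - w) \<in> root_space M Z"
        using w eq by (simp add: matrix_vector_mult_diff_distrib vec.scale_right_diff_distrib algebra_simps)
      then have "y - w \<in> root_space M Z" using root_space_step Z by blast
      moreover have "y - w \<in> S" using y w T' WS S by (auto simp: invariant_subspace_def intro!: vec.subspace_diff)
      ultimately have "y - w \<in> ?W" using TW by blast
      then have "y - w + w \<in> ?W" using w T'(2) W vec.subspace_add unfolding invariant_subspace_def by blast
      then show False using y by simp
    qed
    have "z \<in> spectrum_on M S" by (rule quotient_eigenvalue_in_spectrum[OF W S y WS])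
    then consider "z \<in> Z0" | "z \<in> Z1" using spec by blast
    then show False
    proof cases
      case 1
      then have "z \<notin> spectrum_on M ?V" using disj by (auto simp: spectrum_on_root_space[OF Z1 S])
      then show ?thesis using key[OF Z0 1 UW V VW _ uv(3)] uv by simp
    next
      case 2
      then have "z \<notin> spectrum_on M ?U" using disj by (auto simp: spectrum_on_root_space[OF Z0 S])
      then show ?thesis using key[OF Z1 2 VW U UW _ uv(2)] uv by simp
    qed
  qed
  moreover have "?U \<inter> ?V = {0}"
    using root_space_Int[OF assms(1-3), of M] U V by (auto simp: invariant_subspace_def dest: vec.subspace_0)
  ultimately show ?thesis using WS unfolding direct_sum_def by blast
qed

lemma direct_sum_subset:
  assumes "direct_sum S U V" "vec.subspace U" "vec.subspace V"
  shows "U \<subseteq> S" "V \<subseteq> S"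
proof -
  have 0: "0 \<in> U" "0 \<in> V" using assms(2,3) by (auto dest: vec.subspace_0)
  show "U \<subseteq> S"
  proof
    fix x assume "x \<in> U"
    then have "x = x + 0 \<and> x \<in> U \<and> 0 \<in> V" using 0 by simp
    then show "x \<in> S" using assms(1) unfolding direct_sum_def by blast
  qed
  show "V \<subseteq> S"
  proof
    fix x assume "x \<in> V"
    then have "x = 0 + x \<and> 0 \<in> U \<and> x \<in> V" using 0 by simp
    then show "x \<in> S" using assms(1) unfolding direct_sum_def by blast
  qed
qed

text \<open>Decompose \<open>x\<close> in \<open>U\<close> along the smaller pair: the component in
  \<open>V'\<close> lies in both \<open>U\<close> and \<open>V\<close>, hence is zero. Containment
  is thus all that uniqueness requires.\<close>

lemma direct_sum_mono_eq:
  assumes "direct_sum S U V" "direct_sum S U' V'" "U' \<subseteq> U" "V' \<subseteq> V" "vec.subspace U" "vec.subspace V"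
  shows "U' = U \<and> V' = V"
proof -
  have key: "x \<in> U'" if ds: "direct_sum S U V" "direct_sum S U' V'" "U' \<subseteq> U" "V' \<subseteq> V" "vec.subspace U" "vec.subspace V" "x \<in> U"
    for U V U' V' and x :: "complex ^ 'a"
  proof -
    have "0 \<in> V" using that vec.subspace_0 by blast
    then have "x + 0 \<in> S" using that(1,7) unfolding direct_sum_def by blast
    then obtain u v where uv: "x = u + v" "u \<in> U'" "v \<in> V'" using ds(2) unfolding direct_sum_def by auto
    then have "v \<in> U" using ds vec.subspace_diff[of U x u] by auto
    then have "v = 0" using uv ds(1,4) unfolding direct_sum_def by blast
    then show ?thesis using uv by simp
  qed
  have flip: "direct_sum S V U" if "direct_sum S U V" for U V :: "(complex ^ 'a) set"
    using that unfolding direct_sum_def by (auto simp: add.commute; metis add.commute)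
  show ?thesis
    using key[OF assms] key[OF flip[OF assms(1)] flip[OF assms(2)] assms(4,3,6,5)] assms(3,4) by blast
qed

text \<open>By its spectra, a competing pair consists of subspaces of the two root spaces, and a
  decomposition contained in another one coincides with it.\<close>

lemma unique_spectral_splitting_root_space:
  assumes S: "invariant_subspace M S" and spec: "spectrum_on M S = Z0 \<union> Z1" and disj: "Z0 \<inter> Z1 = {}"
  shows "unique_spectral_splitting M S Z0 Z1 (S \<inter> root_space M Z0) (S \<inter> root_space M Z1)"
proof -
  have fin: "finite Z0" "finite Z1" using finite_spectrum_on[OF S] spec by auto
  have ds: "direct_sum S (S \<inter> root_space M Z0) (S \<inter> root_space M Z1)"
    by (rule direct_sum_root_space[OF fin disj S]) (simp add: spec)
  have inv: "invariant_subspace M (S \<inter> root_space M Z0)" "invariant_subspace M (S \<inter> root_space M Z1)"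
    by (simp_all add: S invariant_root_space invariant_subspace_Int)
  have "spectral_splitting M S Z0 Z1 (S \<inter> root_space M Z0) (S \<inter> root_space M Z1)"
    using ds inv spec by (auto simp: spectral_splitting_def spectrum_on_root_space[OF fin(1) S] spectrum_on_root_space[OF fin(2) S])
  moreover have "U' = S \<inter> root_space M Z0 \<and> V' = S \<inter> root_space M Z1" if s: "spectral_splitting M S Z0 Z1 U' V'" for U' V'
  proof (rule direct_sum_mono_eq[OF ds])
    have ds': "direct_sum S U' V'" and inv': "invariant_subspace M U'" "invariant_subspace M V'"
      using s by (auto simp: spectral_splitting_def)
    show "direct_sum S U' V'" by fact
    have "U' \<subseteq> S" "V' \<subseteq> S"
      using direct_sum_subset[OF ds' invariant_subspaceD(1)[OF inv'(1)] invariant_subspaceD(1)[OF inv'(2)]]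
      by blast+
    moreover have "U' \<subseteq> root_space M Z0" "V' \<subseteq> root_space M Z1"
      using invariant_subset_root_space[OF fin(1) inv'(1)] invariant_subset_root_space[OF fin(2) inv'(2)] s
      by (auto simp: spectral_splitting_def)
    ultimately show "U' \<subseteq> S \<inter> root_space M Z0" "V' \<subseteq> S \<inter> root_space M Z1" by auto
  qed (use inv in \<open>auto simp: invariant_subspace_def\<close>)
  ultimately show ?thesis unfolding unique_spectral_splitting_def by blast
qed

lemma dim_direct_sum:
  assumes "direct_sum S U V" "vec.subspace U" "vec.subspace V"
  shows "vec.dim S = vec.dim U + vec.dim V"
  using vec.dim_sums_Int[OF assms(2,3)] assms(1) by (simp add: direct_sum_def)

section \<open>Hermitian matrices and Lyapunov's theorem\<close>

lemma cscale_component_inner: "(c *s x) \<bullet> y = x \<bullet> (cnj c *s y)" for x y :: "complex ^ 'm"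
  unfolding inner_vec_def by (intro sum.cong) (auto simp: inner_complex_def algebra_simps)

lemma of_real_vector_smult: "complex_of_real c *s x = c *\<^sub>R x" for x :: "complex ^ 'm"
  by (simp add: vec_eq_iff) (simp add: scaleR_conv_of_real)

lemma inner_imaginary_self [simp]: "x \<bullet> (\<i> *s x) = 0" for x :: "complex ^ 'm"
  unfolding inner_vec_def by (intro sum.neutral) (auto simp: inner_complex_def)

lemma norm_vector_smult: "norm (c *s x) = cmod c * norm x" for x :: "complex ^ 'm"
proof -
  have "(c *s x) \<bullet> (c *s x) = x \<bullet> ((cnj c * c) *s x)"
    by (simp add: cscale_component_inner vec.scale_scale)
  also have "cnj c * c = complex_of_real ((cmod c)\<^sup>2)" by (metis complex_norm_square mult.commute)
  finally have "(norm (c *s x))\<^sup>2 = (cmod c * norm x)\<^sup>2"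
    by (simp add: of_real_vector_smult dot_square_norm power_mult_distrib del: of_real_power)
  then show ?thesis by simp
qed

lemma vector_smult_Re_Im: "z *s x = Re z *\<^sub>R x + Im z *\<^sub>R (\<i> *s x)" for x :: "complex ^ 'm"
  by (simp add: vec_eq_iff complex_eq_iff)

lemma Re_cinner: "Re (cinner x y) = x \<bullet> y"
  unfolding cinner_def inner_vec_def by (simp add: inner_complex_def)

lemma Im_cinner: "Im (cinner x y) = (\<i> *s x) \<bullet> y"
  unfolding cinner_def inner_vec_def by (simp add: inner_complex_def)

text \<open>A complex subspace contains \<open>\<i> *s y\<close> along with \<open>y\<close>, and
  the real inner product with that vector is the imaginary part of \<open>cinner\<close>.\<close>

lemma cinner_orthogonal_iff:
  assumes "vec.subspace S"
  shows "(\<forall>y\<in>S. cinner y z = 0) \<longleftrightarrow> (\<forall>y\<in>S. y \<bullet> z = 0)"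
  using vec.subspace_scale[OF assms, of _ \<i>] by (auto simp: complex_eq_iff Re_cinner Im_cinner)

lemma complex_subspace_imp_subspace: "vec.subspace S \<Longrightarrow> subspace S" for S :: "(complex ^ 'm) set"
  by (auto simp: vec.subspace_def subspace_def simp flip: of_real_vector_smult)

lemma linear_matrix_vector_mult [simp]: "linear ((*v) M)" for M :: "complex ^ 'm ^ 'n"
  by (rule linearI) (auto simp: matrix_vector_right_distrib vector_scalar_commute simp flip: of_real_vector_smult)

text \<open>Stated with the real inner product. For a complex-linear map this is the usual Hermitian
  symmetry, since \<open>y\<close> may be replaced by \<open>\<i> *s y\<close>.\<close>

definition selfadj :: "complex ^ 'm ^ 'm \<Rightarrow> bool" where
  "selfadj M \<longleftrightarrow> (\<forall>x y. (M *v x) \<bullet> y = x \<bullet> (M *v y))"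

lemma selfadjD: "selfadj M \<Longrightarrow> (M *v x) \<bullet> y = x \<bullet> (M *v y)"
  by (simp add: selfadj_def)

lemma selfadj_inner_imaginary: "selfadj M \<Longrightarrow> x \<bullet> (\<i> *s (M *v x)) = 0"
proof -
  assume M: "selfadj M"
  have "x \<bullet> (\<i> *s (M *v x)) = (M *v x) \<bullet> (\<i> *s x)"
    using selfadjD[OF M, of x "\<i> *s x"] by (simp add: vector_scalar_commute)
  also have "\<dots> = (\<i> *s x) \<bullet> (M *v x)" by (rule inner_commute)
  also have "\<dots> = - (x \<bullet> (\<i> *s (M *v x)))" by (simp add: cscale_component_inner)
  finally show ?thesis by simp
qed

lemma spectrum_real:
  assumes "selfadj M" "z \<in> spectrum M"
  shows "Im z = 0"
proof -
  obtain x where x: "x \<noteq> 0" "M *v x = z *s x" using assms(2) by (auto simp: spectrum_iff)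
  have "0 = (\<i> *s x) \<bullet> (M *v x)" using selfadj_inner_imaginary[OF assms(1), of x] by (simp add: cscale_component_inner)
  also have "\<dots> = Im z * (norm (\<i> *s x))\<^sup>2"
    unfolding x(2) vector_smult_Re_Im[of z]
    by (simp add: inner_add_right dot_square_norm inner_commute[of "\<i> *s x" x])
  finally show ?thesis using x by (simp add: norm_vector_smult)
qed

section \<open>Orthogonal projections\<close>

text \<open>\<open>orth_proj\<close> is a definite description, so this has to come first. The real
  orthogonal decomposition supplies the map; its uniqueness makes the map complex-linear, hence a
  matrix.\<close>

lemma orth_proj_exists:
  fixes S :: "(complex ^ 'm) set"
  assumes S: "vec.subspace S"
  shows "\<exists>!P. \<forall>x. P *v x \<in> S \<and> (\<forall>y\<in>S. cinner y (x - P *v x) = 0)"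
proof -
  have "\<exists>y. y \<in> S \<and> (\<forall>w\<in>S. w \<bullet> (x - y) = 0)" for x
  proof -
    obtain y z where yz: "y \<in> span S" "\<And>w. w \<in> span S \<Longrightarrow> orthogonal z w" "x = y + z"
      using orthogonal_subspace_decomp_exists[where S = S and x = x] by blast
    then show ?thesis using complex_subspace_imp_subspace[OF S]
      by (intro exI[of _ y]) (auto simp: span_eq_iff[THEN iffD2] orthogonal_def inner_commute)
  qed
  then obtain f where f: "\<And>x. f x \<in> S" "\<And>x w. w \<in> S \<Longrightarrow> w \<bullet> (x - f x) = 0" by metis
  have uniq: "f x = y" if y: "y \<in> S" "\<And>w. w \<in> S \<Longrightarrow> w \<bullet> (x - y) = 0" for x y
  proof -
    have "f x - y \<in> S" using f y S vec.subspace_diff by blast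
    then have "(f x - y) \<bullet> ((x - y) - (x - f x)) = 0" using f y by (simp only: inner_diff_right)
    then show ?thesis by simp
  qed
  have lin: "Vector_Spaces.linear (*s) (*s) f"
  proof (unfold_locales, goal_cases)
    case (1 x y)
    have "w \<bullet> (x + y - (f x + f y)) = 0" if "w \<in> S" for w
      using f(2)[OF that, of x] f(2)[OF that, of y] by (simp add: inner_diff_right inner_add_right)
    then show ?case by (intro uniq) (auto intro: f vec.subspace_add S)
  next
    case (2 c x)
    have "w \<bullet> (c *s x - c *s f x) = 0" if "w \<in> S" for w
    proof -
      have "w \<bullet> (c *s x - c *s f x) = (cnj c *s w) \<bullet> (x - f x)"
        by (simp add: cscale_component_inner vec.scale_right_diff_distrib)
      also have "\<dots> = 0" by (intro f(2) vec.subspace_scale[OF S] that)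
      finally show ?thesis .
    qed
    then show ?case by (intro uniq) (auto intro: f vec.subspace_scale S)
  qed
  show ?thesis
  proof (rule ex1I[of _ "matrix f"], intro allI)
    fix x
    show "matrix f *v x \<in> S \<and> (\<forall>y\<in>S. cinner y (x - matrix f *v x) = 0)"
      unfolding matrix_works[OF lin] cinner_orthogonal_iff[OF S] using f by blast
  next
    fix P assume P: "\<forall>x. P *v x \<in> S \<and> (\<forall>y\<in>S. cinner y (x - P *v x) = 0)"
    have "P *v x = f x" for x
      using P unfolding cinner_orthogonal_iff[OF S] by (intro uniq[symmetric]) auto
    then show "P = matrix f" by (simp add: matrix_eq matrix_works[OF lin])
  qed
qed

lemma
  assumes S: "vec.subspace S"
  shows orth_proj_in: "orth_proj S *v x \<in> S"
    and orth_proj_orthogonal: "y \<in> S \<Longrightarrow> y \<bullet> (x - orth_proj S *v x) = 0"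
proof -
  have "\<forall>x. orth_proj S *v x \<in> S \<and> (\<forall>y\<in>S. cinner y (x - orth_proj S *v x) = 0)"
    unfolding orth_proj_def by (rule theI'[OF orth_proj_exists[OF S]])
  then show "orth_proj S *v x \<in> S" "y \<in> S \<Longrightarrow> y \<bullet> (x - orth_proj S *v x) = 0"
    unfolding cinner_orthogonal_iff[OF S] by blast+
qed

lemma orth_proj_inner:
  assumes "vec.subspace S" "y \<in> S"
  shows "y \<bullet> (orth_proj S *v x) = y \<bullet> x"
  using orth_proj_orthogonal[OF assms, of x] by (simp add: inner_diff_right)

lemma orth_proj_unique:
  assumes S: "vec.subspace S" and "p \<in> S" "\<And>y. y \<in> S \<Longrightarrow> y \<bullet> (x - p) = 0"
  shows "orth_proj S *v x = p"
proof -
  have "orth_proj S *v x - p \<in> S" using orth_proj_in assms vec.subspace_diff by blast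
  then have "(orth_proj S *v x - p) \<bullet> ((x - p) - (x - orth_proj S *v x)) = 0"
    using assms orth_proj_orthogonal[OF S] by (simp only: inner_diff_right)
  then show ?thesis by simp
qed

lemma orth_proj_id: "vec.subspace S \<Longrightarrow> x \<in> S \<Longrightarrow> orth_proj S *v x = x"
  by (rule orth_proj_unique) auto

lemma selfadj_orth_proj: "vec.subspace S \<Longrightarrow> selfadj (orth_proj S)"
  unfolding selfadj_def by (metis inner_commute orth_proj_in orth_proj_inner)

lemma orth_proj_pythagoras:
  assumes "vec.subspace S"
  shows "(norm x)\<^sup>2 = (norm (orth_proj S *v x))\<^sup>2 + (norm (x - orth_proj S *v x))\<^sup>2"
  using norm_add_Pythagorean[of "orth_proj S *v x" "x - orth_proj S *v x"]
    orth_proj_orthogonal[OF assms orth_proj_in[OF assms], of x x]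
  by (simp add: orthogonal_def)

lemma norm_orth_proj_le:
  assumes "vec.subspace S"
  shows "norm (orth_proj S *v x) \<le> norm x" "norm (x - orth_proj S *v x) \<le> norm x"
proof -
  have "(norm (orth_proj S *v x))\<^sup>2 \<le> (norm x)\<^sup>2" "(norm (x - orth_proj S *v x))\<^sup>2 \<le> (norm x)\<^sup>2"
    using orth_proj_pythagoras[OF assms, of x] by simp_all
  then show "norm (orth_proj S *v x) \<le> norm x" "norm (x - orth_proj S *v x) \<le> norm x"
    using power2_le_imp_le norm_ge_zero by blast+
qed

section \<open>Lyapunov's theorem\<close>

text \<open>Take an invariant \<open>W\<close> of largest dimension on which \<open>J\<close> is
  already positive. If it is not all of \<open>U\<close>, adjoin an eigenvector of \<open>N\<close>
  modulo \<open>W\<close>, made \<open>J\<close>-orthogonal to \<open>W\<close>; the real part of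
  its eigenvalue decides the sign of \<open>J\<close> on it.\<close>

lemma lyapunov_positive:
  fixes N J :: "complex ^ 'm ^ 'm"
  assumes U: "invariant_subspace N U" and J: "selfadj J"
    and pos: "\<And>x. x \<in> U \<Longrightarrow> x \<noteq> 0 \<Longrightarrow> 0 < x \<bullet> (J *v (N *v x))"
    and sp: "\<And>z. z \<in> spectrum_on N U \<Longrightarrow> 0 < Re z"
    and x: "x \<in> U" "x \<noteq> 0"
  shows "0 < x \<bullet> (J *v x)"
proof -
  define good where "good W \<longleftrightarrow> invariant_subspace N W \<and> W \<subseteq> U \<and> (\<forall>x\<in>W. x \<noteq> 0 \<longrightarrow> 0 < x \<bullet> (J *v x))" for W
  have "0 \<in> U" using U by (simp add: invariant_subspace_def vec.subspace_0)
  then have "good {0}" by (simp add: good_def)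
  then have "\<exists>W. good W \<and> (\<forall>W'. good W' \<longrightarrow> vec.dim W' \<le> vec.dim W)"
    by (rule ex_has_greatest_nat[where b = "Suc CARD('m)"]) (simp add: dim_subset_UNIV_cart_gen less_Suc_eq_le)
  then obtain W where W: "good W" and max: "\<And>W'. good W' \<Longrightarrow> vec.dim W' \<le> vec.dim W" by blast
  have WI: "invariant_subspace N W" and WU: "W \<subseteq> U" and Wpos: "\<And>x. x \<in> W \<Longrightarrow> x \<noteq> 0 \<Longrightarrow> 0 < x \<bullet> (J *v x)"
    using W by (auto simp: good_def)
  have Ws: "vec.subspace W" using WI by (simp add: invariant_subspace_def)
  have "U \<subseteq> W"
  proof (rule ccontr)
    assume "\<not> U \<subseteq> W"
    then obtain y z where y: "y \<in> U" "y \<notin> W" "N *v y - z *s y \<in> W"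
      using quotient_eigenvector[OF WI U] by blast
    have z: "0 < Re z" by (rule sp[OF quotient_eigenvalue_in_spectrum[OF WI U y WU]])
    \<comment> \<open>The compression of \<open>J\<close> to \<open>W\<close>. Positivity makes it
      injective on \<open>W\<close>, hence onto, so \<open>y\<close> can be corrected within
      \<open>W\<close> to become \<open>J\<close>-orthogonal to \<open>W\<close>.\<close>
    define G where "G = orth_proj W ** J"
    have "(*v) G ` W = W"
    proof (rule inj_on_subspace_imp_surj(1))
      show "(*v) G ` W \<subseteq> W" using orth_proj_in[OF Ws] by (auto simp: G_def simp flip: matrix_vector_mul_assoc)
      fix w assume w: "w \<in> W" "G *v w = 0"
      then have "w \<bullet> (J *v w) = 0"
        using orth_proj_inner[OF Ws w(1), of "J *v w"] by (simp add: G_def matrix_vector_mul_assoc)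
      then show "w = 0" using Wpos[OF w(1)] by fastforce
    qed (use Ws in auto)
    moreover have "G *v y \<in> W" using orth_proj_in[OF Ws] by (simp add: G_def flip: matrix_vector_mul_assoc)
    ultimately obtain w where w: "w \<in> W" "G *v w = G *v y" by (metis imageE)
    define v where "v = y - w"
    have orth: "u \<bullet> (J *v v) = 0" if "u \<in> W" for u
    proof -
      have "u \<bullet> (J *v v) = u \<bullet> (G *v v)"
        using orth_proj_inner[OF Ws that, of "J *v v"] by (simp add: G_def matrix_vector_mul_assoc)
      also have "G *v v = 0" using w by (simp add: v_def matrix_vector_mult_diff_distrib)
      finally show ?thesis by simp
    qed
    have v: "v \<in> U" "v \<notin> W"
      using y w WU U Ws vec.subspace_diff vec.subspace_add[OF Ws, of v w]
      by (auto simp: v_def invariant_subspace_def)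
    define u where "u = N *v v - z *s v"
    have "u = (N *v y - z *s y) - (N *v w - z *s w)"
      by (simp add: u_def v_def matrix_vector_mult_diff_distrib vec.scale_right_diff_distrib)
    also have "\<dots> \<in> W"
      by (rule vec.subspace_diff[OF Ws y(3) vec.subspace_diff[OF Ws
            invariant_subspaceD(2)[OF WI w(1)] vec.subspace_scale[OF Ws w(1)]]])
    finally have u: "u \<in> W" .
    have Nv: "N *v v = z *s v + u" by (simp add: u_def)
    have "v \<noteq> 0" using v Ws vec.subspace_0 by blast
    \<comment> \<open>Since \<open>N v = z v + u\<close> with \<open>u\<close> in \<open>W\<close>,
      the contribution of \<open>u\<close> vanishes by \<open>J\<close>-orthogonality. What remains
      is \<open>Re z\<close> times the value of the form at \<open>v\<close>.\<close>
    have "0 < v \<bullet> (J *v (N *v v))" by (rule pos[OF v(1) \<open>v \<noteq> 0\<close>])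
    also have "v \<bullet> (J *v (N *v v)) = Re z * (v \<bullet> (J *v v)) + v \<bullet> (J *v u)"
      unfolding Nv by (simp add: matrix_vector_right_distrib vector_scalar_commute inner_add_right
          vector_smult_Re_Im[of z "J *v v"] selfadj_inner_imaginary[OF J])
    also have "v \<bullet> (J *v u) = 0"
      using orth[OF u] selfadjD[OF J, of v u] by (simp add: inner_commute)
    finally have vpos: "0 < v \<bullet> (J *v v)" using z by (simp add: zero_less_mult_iff)
    define W' where "W' = {a + b | a b. a \<in> W \<and> b \<in> vec.span {v}}"
    have W's: "vec.subspace W'" unfolding W'_def by (intro vec.subspace_sums Ws vec.subspace_span)
    have W'I: "a + c *s v \<in> W'" if "a \<in> W" for a c
      using that unfolding W'_def vec.span_singleton by blast
    have W'E: "\<exists>a c. a \<in> W \<and> x = a + c *s v" if "x \<in> W'" for x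
      using that unfolding W'_def vec.span_singleton by blast
    have "good W'"
      unfolding good_def
    proof (intro conjI ballI impI subsetI)
      show "invariant_subspace N W'"
        unfolding invariant_subspace_def
      proof (intro conjI ballI W's)
        fix x assume "x \<in> W'"
        then obtain a c where ac: "a \<in> W" "x = a + c *s v" using W'E by blast
        have "N *v x = (N *v a + c *s u) + (c * z) *s v"
          by (simp add: ac matrix_vector_right_distrib vector_scalar_commute Nv vec.scale_right_distrib vec.scale_scale)
        moreover have "N *v a + c *s u \<in> W"
          using ac u invariant_subspaceD(2)[OF WI] by (intro vec.subspace_add vec.subspace_scale Ws) auto
        ultimately show "N *v x \<in> W'" using W'I by simp
      qed
    next
      fix x assume "x \<in> W'"
      then obtain a c where ac: "a \<in> W" "x = a + c *s v" using W'E by blast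
      then show "x \<in> U" using WU v(1) U by (auto simp: invariant_subspace_def intro!: vec.subspace_add vec.subspace_scale)
    next
      fix x assume "x \<in> W'" "x \<noteq> 0"
      then obtain a c where ac: "a \<in> W" "x = a + c *s v" using W'E by blast
      have 1: "a \<bullet> (J *v (c *s v)) = 0"
        using orth[OF vec.subspace_scale[OF Ws ac(1), of "cnj c"]] by (simp add: vector_scalar_commute cscale_component_inner)
      then have 2: "(c *s v) \<bullet> (J *v a) = 0" using selfadjD[OF J, of "c *s v" a] by (simp add: inner_commute)
      have 3: "(c *s v) \<bullet> (J *v (c *s v)) = (cmod c)\<^sup>2 * (v \<bullet> (J *v v))"
        by (simp add: vector_scalar_commute cscale_component_inner vec.scale_scale mult.commute[of "cnj c"]
            complex_norm_square[symmetric] of_real_vector_smult del: of_real_power)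
      have "x \<bullet> (J *v x) = a \<bullet> (J *v a) + (cmod c)\<^sup>2 * (v \<bullet> (J *v v))"
        using 1 2 3 by (simp add: ac matrix_vector_right_distrib inner_add_left inner_add_right)
      moreover have "0 \<le> a \<bullet> (J *v a)" "a \<noteq> 0 \<Longrightarrow> 0 < a \<bullet> (J *v a)" using Wpos[OF ac(1)] by (cases "a = 0"; force)+
      moreover have "a \<noteq> 0 \<or> c \<noteq> 0" using \<open>x \<noteq> 0\<close> ac by auto
      moreover have "0 \<le> (cmod c)\<^sup>2 * (v \<bullet> (J *v v))" "c \<noteq> 0 \<Longrightarrow> 0 < (cmod c)\<^sup>2 * (v \<bullet> (J *v v))" using vpos by auto
      ultimately show "0 < x \<bullet> (J *v x)" by fastforce
    qed
    then have "vec.dim W' \<le> vec.dim W" by (rule max)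
    moreover have "W \<subset> W'"
      using W'I[of _ 0] W'I[OF vec.subspace_0[OF Ws], of 1] v(2) by auto
    then have "vec.dim W < vec.dim W'"
      by (intro vec.dim_psubset) (simp add: vec.span_eq_iff[THEN iffD2] Ws W's)
    ultimately show False by simp
  qed
  then show ?thesis using Wpos x by blast
qed

text \<open>Replacing both \<open>N\<close> and \<open>J\<close> by their negatives keeps the
  product \<open>J N\<close> and reflects the spectrum.\<close>

lemma lyapunov_negative:
  fixes N J :: "complex ^ 'm ^ 'm"
  assumes U: "invariant_subspace N U" and J: "selfadj J"
    and pos: "\<And>x. x \<in> U \<Longrightarrow> x \<noteq> 0 \<Longrightarrow> 0 < x \<bullet> (J *v (N *v x))"
    and sp: "\<And>z. z \<in> spectrum_on N U \<Longrightarrow> Re z < 0"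
    and x: "x \<in> U" "x \<noteq> 0"
  shows "x \<bullet> (J *v x) < 0"
proof -
  have NU: "invariant_subspace (- N) U"
    using U by (simp add: invariant_subspace_def matrix_uminus_vector_mult vec.subspace_neg)
  have "0 < x \<bullet> ((- J) *v x)"
  proof (rule lyapunov_positive[OF NU _ _ _ x])
    show "selfadj (- J)" using J by (simp add: selfadj_def matrix_uminus_vector_mult)
    show "0 < y \<bullet> (- J *v (- N *v y))" if "y \<in> U" "y \<noteq> 0" for y
      using pos[OF that] by (simp add: matrix_uminus_vector_mult matrix_vector_mult_uminus)
    fix z assume "z \<in> spectrum_on (- N) U"
    then obtain y where "y \<in> U" "y \<noteq> 0" "- (N *v y) = z *s y"
      unfolding spectrum_on_iff[OF NU] matrix_uminus_vector_mult by blast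
    then have "N *v y = (- z) *s y" by (metis minus_minus vec.scale_minus_left)
    then show "0 < Re z" using sp[of "- z"] \<open>y \<in> U\<close> \<open>y \<noteq> 0\<close> spectrum_on_iff[OF U] by auto
  qed
  then show ?thesis by (simp add: matrix_uminus_vector_mult)
qed

section \<open>The spectral theorem and square roots\<close>

text \<open>Maximise the Rayleigh quotient on the unit sphere of \<open>S\<close>. Stated for
  Euclidean spaces so that it serves real matrices and, through their real-linear action, complex
  ones.\<close>

lemma self_adjoint_eigenvector:
  fixes f :: "'a::euclidean_space \<Rightarrow> 'a"
  assumes f: "linear f" and sa: "\<And>x y. f x \<bullet> y = x \<bullet> f y"
    and S: "subspace S" "f ` S \<subseteq> S" "S \<noteq> {0}"
  obtains x \<mu> where "x \<in> S" "norm x = 1" "f x = \<mu> *\<^sub>R x"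
proof -
  define K where "K = sphere 0 1 \<inter> S"
  have "0 \<in> S" using S subspace_0 by blast
  then obtain y where y: "y \<in> S" "y \<noteq> 0" using S(3) by blast
  then have "y /\<^sub>R norm y \<in> K" using S by (auto simp: K_def subspace_scale)
  then have "K \<noteq> {}" by blast
  moreover have "compact K" unfolding K_def using S closed_subspace by (intro compact_Int_closed) auto
  moreover have "continuous_on K (\<lambda>x. x \<bullet> f x)"
    using linear_continuous_on[of f K] f by (intro continuous_intros) (simp add: linear_conv_bounded_linear)
  ultimately obtain x where x: "x \<in> K" "\<And>y. y \<in> K \<Longrightarrow> y \<bullet> f y \<le> x \<bullet> f x"
    using continuous_attains_sup by metis
  define \<mu> where "\<mu> = x \<bullet> f x"
  have nx: "norm x = 1" "x \<in> S" using x by (auto simp: K_def)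
  have psd: "z \<bullet> f z \<le> \<mu> * (norm z)\<^sup>2" if "z \<in> S" for z
  proof (cases "z = 0")
    case False
    then have "z /\<^sub>R norm z \<in> K" using that S by (auto simp: K_def subspace_scale)
    from x(2)[OF this] have "(z \<bullet> f z) / (norm z)\<^sup>2 \<le> \<mu>"
      by (simp add: \<mu>_def linear_scale[OF f] power2_eq_square field_simps)
    then show ?thesis using False by (simp add: divide_le_eq)
  qed (simp add: linear_0[OF f])
  define w where "w = f x - \<mu> *\<^sub>R x"
  have wS: "w \<in> S" unfolding w_def using nx S by (auto intro!: subspace_diff subspace_scale)
  \<comment> \<open>Move away from the maximiser in the direction of the residual \<open>w\<close>:
    the linear term of the defect is \<open>- 2 * t * (w \<bullet> w)\<close>, which contradicts
    maximality for small positive \<open>t\<close> unless \<open>w = 0\<close>.\<close>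
  have quad: "0 \<le> - 2 * t * (w \<bullet> w) + t\<^sup>2 * (\<mu> * (norm w)\<^sup>2 - w \<bullet> f w)" for t
  proof -
    have "x + t *\<^sub>R w \<in> S" using nx wS S by (auto intro!: subspace_add subspace_scale)
    from psd[OF this] have "0 \<le> \<mu> * ((x + t *\<^sub>R w) \<bullet> (x + t *\<^sub>R w)) - (x + t *\<^sub>R w) \<bullet> f (x + t *\<^sub>R w)"
      by (simp add: dot_square_norm)
    also have "\<dots> = \<mu> * (x \<bullet> x) - x \<bullet> f x + t * (2 * (\<mu> * (x \<bullet> w) - f x \<bullet> w)) + t\<^sup>2 * (\<mu> * (w \<bullet> w) - w \<bullet> f w)"
      using sa[of x w] by (simp add: linear_add[OF f] linear_scale[OF f] inner_add_left inner_add_right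
          inner_commute[of w "f x"] inner_commute[of "f x" x] inner_commute[of w x] power2_eq_square algebra_simps)
    also have "\<mu> * (x \<bullet> x) - x \<bullet> f x = 0" using nx by (simp add: \<mu>_def dot_square_norm)
    also have "\<mu> * (x \<bullet> w) - f x \<bullet> w = - (w \<bullet> w)"
      by (simp add: w_def inner_diff_left inner_diff_right inner_commute[of "f x" x] algebra_simps)
    finally show ?thesis by (simp add: dot_square_norm)
  qed
  have "w \<bullet> w = 0"
  proof (rule ccontr)
    assume "w \<bullet> w \<noteq> 0"
    then have pos: "0 < w \<bullet> w" by simp
    define q where "q = \<mu> * (norm w)\<^sup>2 - w \<bullet> f w"
    have q0: "0 \<le> q" using psd[OF wS] by (simp add: q_def)
    \<comment> \<open>Small enough for the quadratic term not to compensate: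
      \<open>t * q \<le> w \<bullet> w\<close>. The summand 1 avoids division by zero.\<close>
    define t where "t = (w \<bullet> w) / (q + 1)"
    have t: "0 < t" using pos q0 by (simp add: t_def)
    have "t * q \<le> w \<bullet> w" using pos q0 by (simp add: t_def field_simps)
    have "0 \<le> - 2 * t * (w \<bullet> w) + t\<^sup>2 * q" using quad[of t] by (simp add: q_def)
    then have "0 \<le> t * (t * q - 2 * (w \<bullet> w))" by (simp add: power2_eq_square algebra_simps)
    then have "0 \<le> t * q - 2 * (w \<bullet> w)" using t by (simp add: zero_le_mult_iff)
    then show False using \<open>t * q \<le> w \<bullet> w\<close> pos by linarith
  qed
  then have "f x = \<mu> *\<^sub>R x" by (simp add: w_def)
  then show thesis using that nx by blast
qed

lemma self_adjoint_orthonormal_basis_on: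
  fixes f :: "'a::euclidean_space \<Rightarrow> 'a"
  assumes f: "linear f" and sa: "\<And>x y. f x \<bullet> y = x \<bullet> f y"
  shows "subspace S \<Longrightarrow> f ` S \<subseteq> S \<Longrightarrow>
    \<exists>E. finite E \<and> E \<subseteq> S \<and> S \<subseteq> span E \<and> pairwise orthogonal E \<and> (\<forall>b\<in>E. norm b = 1 \<and> (\<exists>\<mu>. f b = \<mu> *\<^sub>R b))"
proof (induction "dim S" arbitrary: S rule: less_induct)
  case less
  show ?case
  proof (cases "S = {0}")
    case True
    then show ?thesis by (intro exI[of _ "{}"]) auto
  next
    case False
    then obtain x \<mu> where x: "x \<in> S" "norm x = 1" "f x = \<mu> *\<^sub>R x"
      using self_adjoint_eigenvector[OF f sa less.prems] by metis
    define T where "T = {y \<in> S. x \<bullet> y = 0}"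
    have T: "subspace T" using less.prems(1) unfolding T_def
      by (auto simp: subspace_def inner_add_right)
    have fT: "f ` T \<subseteq> T"
    proof
      fix z assume "z \<in> f ` T"
      then obtain y where y: "z = f y" "y \<in> S" "x \<bullet> y = 0" by (auto simp: T_def)
      have "x \<bullet> f y = 0" using sa[of x y] x y by simp
      then show "z \<in> T" using y less.prems(2) by (auto simp: T_def)
    qed
    have "x \<notin> T" using x by (auto simp: T_def dot_square_norm)
    moreover have "T \<subseteq> S" by (auto simp: T_def)
    ultimately have "T \<subset> S" using x(1) by blast
    then have "dim T < dim S" by (intro dim_psubset) (simp add: span_eq_iff[THEN iffD2] T less.prems)
    then obtain E where E: "finite E" "E \<subseteq> T" "T \<subseteq> span E" "pairwise orthogonal E" "\<forall>b\<in>E. norm b = 1 \<and> (\<exists>\<mu>. f b = \<mu> *\<^sub>R b)"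
      using less.hyps[OF _ T fT] by blast
    have "S \<subseteq> span (insert x E)"
    proof
      fix y assume y: "y \<in> S"
      have "y - (x \<bullet> y) *\<^sub>R x \<in> T"
        using y x less.prems(1) by (auto simp: T_def inner_diff_right dot_square_norm intro!: subspace_diff subspace_scale)
      then have "y - (x \<bullet> y) *\<^sub>R x \<in> span (insert x E)" using E(3) span_mono[of E "insert x E"] by blast
      moreover have "(x \<bullet> y) *\<^sub>R x \<in> span (insert x E)" by (intro span_scale span_base) simp
      ultimately have "(y - (x \<bullet> y) *\<^sub>R x) + (x \<bullet> y) *\<^sub>R x \<in> span (insert x E)" by (rule span_add)
      then show "y \<in> span (insert x E)" by simp
    qed
    moreover have "pairwise orthogonal (insert x E)"
      using E(2,4) by (auto simp: pairwise_insert T_def orthogonal_def inner_commute)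
    moreover have "insert x E \<subseteq> S" using E(2) x(1) by (auto simp: T_def)
    ultimately show ?thesis using E x by (intro exI[of _ "insert x E"]) auto
  qed
qed

text \<open>A spectral decomposition over the reals. For a complex matrix \<open>E\<close> is a
  basis of the underlying real space of twice the dimension: norms and forms can be computed in it,
  but complex multiplicities cannot be read off directly.\<close>

locale eigenbasis =
  fixes f :: "'a::euclidean_space \<Rightarrow> 'a" and E :: "'a set" and \<mu> :: "'a \<Rightarrow> real"
  assumes finite_E: "finite E"
    and orthonormal: "\<And>b c. b \<in> E \<Longrightarrow> c \<in> E \<Longrightarrow> b \<bullet> c = (if b = c then 1 else 0)"
    and eigen: "\<And>b. b \<in> E \<Longrightarrow> f b = \<mu> b *\<^sub>R b"
    and expand: "\<And>x. (\<Sum>b\<in>E. (x \<bullet> b) *\<^sub>R b) = x"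
    and sa: "\<And>x y. f x \<bullet> y = x \<bullet> f y"
begin

lemma inner_eq_sum: "x \<bullet> y = (\<Sum>b\<in>E. (x \<bullet> b) * (y \<bullet> b))"
proof -
  have "x \<bullet> y = (\<Sum>b\<in>E. (x \<bullet> b) *\<^sub>R b) \<bullet> y" by (simp only: expand)
  also have "\<dots> = (\<Sum>b\<in>E. (x \<bullet> b) * (y \<bullet> b))" by (simp add: inner_sum_left inner_commute[of y])
  finally show ?thesis .
qed

lemma norm_eq_sum: "(norm x)\<^sup>2 = (\<Sum>b\<in>E. (x \<bullet> b)\<^sup>2)"
  using inner_eq_sum[of x x] by (simp add: dot_square_norm power2_eq_square)

lemma image_component: "b \<in> E \<Longrightarrow> f x \<bullet> b = \<mu> b * (x \<bullet> b)"
  using sa[of x b] eigen by simp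

lemma nonzero: "b \<in> E \<Longrightarrow> b \<noteq> 0"
  using orthonormal[of b b] by auto

end

lemma self_adjoint_eigenbasis:
  fixes f :: "'a::euclidean_space \<Rightarrow> 'a"
  assumes f: "linear f" and sa: "\<And>x y. f x \<bullet> y = x \<bullet> f y"
  shows "\<exists>E \<mu>. eigenbasis f E \<mu>"
proof -
  obtain E where E: "finite E" "UNIV \<subseteq> span E" "pairwise orthogonal E" "\<forall>b\<in>E. norm b = 1 \<and> (\<exists>\<mu>. f b = \<mu> *\<^sub>R b)"
    using self_adjoint_orthonormal_basis_on[OF f sa, of UNIV] by auto
  then obtain \<mu> where \<mu>: "\<And>b. b \<in> E \<Longrightarrow> f b = \<mu> b *\<^sub>R b" by metis
  have "eigenbasis f E \<mu>"
  proof
    show "(\<Sum>b\<in>E. (x \<bullet> b) *\<^sub>R b) = x" for x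
      by (rule orthonormal_basis_expand) (use E in auto)
    show "b \<bullet> c = (if b = c then 1 else 0)" if "b \<in> E" "c \<in> E" for b c
      using that E by (auto simp: dot_square_norm pairwise_def orthogonal_def)
  qed (use E \<mu> sa in auto)
  then show ?thesis by blast
qed

lemma real_matrix_inner: "(M *v x) \<bullet> y = x \<bullet> (transpose M *v y)" for M :: "real ^ 'n ^ 'm"
  by (metis dot_lmul_matrix inner_commute transpose_matrix_vector)

text \<open>\<open>mat_sqrt\<close> is a definite description. Existence takes roots of the
  eigenvalues; uniqueness compares \<open>S\<close> with a second root \<open>T\<close> on an
  eigenbasis of \<open>T\<close>.\<close>

lemma pos_semidef_unique_sqrt:
  fixes M :: "real ^ 'n ^ 'n"
  assumes M: "pos_semidef M"
  shows "\<exists>!S. pos_semidef S \<and> S ** S = M"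
proof -
  have basis: "\<exists>E \<mu>. eigenbasis ((*v) S) E \<mu>" if "pos_semidef S" for S :: "real ^ 'n ^ 'n"
    using that by (intro self_adjoint_eigenbasis) (auto simp: pos_semidef_def real_matrix_inner)
  obtain E \<mu> where "eigenbasis ((*v) M) E \<mu>" using basis[OF M] by blast
  then interpret eigenbasis "(*v) M" E \<mu> .
  have \<mu>: "0 \<le> \<mu> b" if "b \<in> E" for b
    using M that eigen[OF that] orthonormal[OF that that] unfolding pos_semidef_def by (metis inner_scaleR_right mult.right_neutral)
  define g where "g x = (\<Sum>b\<in>E. (sqrt (\<mu> b) * (x \<bullet> b)) *\<^sub>R b)" for x
  have lin: "linear g"
    by (rule linearI) (simp_all add: g_def inner_add_left algebra_simps sum.distrib scaleR_sum_right)
  define S where "S = matrix g"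
  have S: "S *v x = g x" for x unfolding S_def by (rule matrix_works) (use lin in \<open>simp add: linear_def scalar_mult_eq_scaleR\<close>)
  have comp: "g x \<bullet> c = sqrt (\<mu> c) * (x \<bullet> c)" if c: "c \<in> E" for x c
  proof -
    have "g x \<bullet> c = (\<Sum>b\<in>E. if b = c then sqrt (\<mu> b) * (x \<bullet> b) else 0)"
      unfolding g_def inner_sum_left using orthonormal c by (intro sum.cong) auto
    then show ?thesis using c finite_E by simp
  qed
  have eqI: "x = y" if "\<And>b. b \<in> E \<Longrightarrow> x \<bullet> b = y \<bullet> b" for x y
    using that expand[of x] expand[of y] by (metis (no_types, lifting) sum.cong)
  have "S *v (S *v x) = M *v x" for x
    by (rule eqI) (use comp \<mu> image_component in \<open>simp add: S\<close>)
  then have SS: "S ** S = M" by (simp add: matrix_eq matrix_vector_mul_assoc)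
  have "(transpose S *v x) \<bullet> y = (S *v x) \<bullet> y" for x y
  proof -
    have "(transpose S *v x) \<bullet> y = x \<bullet> (S *v y)"
      by (simp add: real_matrix_inner del: transpose_matrix_vector)
    also have "\<dots> = (S *v x) \<bullet> y"
      by (subst (1 2) inner_eq_sum) (auto simp: S comp intro!: sum.cong)
    finally show ?thesis .
  qed
  then have "transpose S = S" by (metis matrix_eq vector_eq_rdot)
  moreover have "0 \<le> x \<bullet> (S *v x)" for x
  proof (subst inner_eq_sum, rule sum_nonneg)
    fix b assume b: "b \<in> E"
    have "(x \<bullet> b) * ((S *v x) \<bullet> b) = sqrt (\<mu> b) * (x \<bullet> b)\<^sup>2"
      by (simp add: S comp[OF b] power2_eq_square)
    then show "0 \<le> (x \<bullet> b) * ((S *v x) \<bullet> b)" using \<mu>[OF b] by simp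
  qed
  ultimately have Spsd: "pos_semidef S" by (simp add: pos_semidef_def)
  show ?thesis
  proof (rule ex1I[of _ S])
    show "pos_semidef S \<and> S ** S = M" using Spsd SS by blast
  next
    fix T assume T: "pos_semidef T \<and> T ** T = M"
    then obtain F \<nu> where F: "eigenbasis ((*v) T) F \<nu>" using basis by blast
    interpret T: eigenbasis "(*v) T" F \<nu> by (rule F)
    have "S *v e = T *v e" if e: "e \<in> F" for e
    proof -
      have \<nu>: "0 \<le> \<nu> e"
        using T e T.eigen[OF e] T.orthonormal[OF e e] unfolding pos_semidef_def by (metis inner_scaleR_right mult.right_neutral)
      have "S *v (S *v e) = T *v (T *v e)" using T SS by (simp add: matrix_vector_mul_assoc)
      also have "\<dots> = (\<nu> e)\<^sup>2 *\<^sub>R e" using T.eigen[OF e] by (simp add: matrix_vector_mult_scaleR power2_eq_square)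
      finally have SSe: "S *v (S *v e) = (\<nu> e)\<^sup>2 *\<^sub>R e" .
      have sym: "(S *v x) \<bullet> y = x \<bullet> (S *v y)" for x y using Spsd by (simp add: real_matrix_inner pos_semidef_def)
      have "S *v e = \<nu> e *\<^sub>R e"
      proof (cases "\<nu> e = 0")
        case True
        then have "(S *v e) \<bullet> (S *v e) = 0" using SSe sym[of e "S *v e"] by simp
        then show ?thesis using True by simp
      next
        case False
        \<comment> \<open>Applying \<open>S\<close> to \<open>w\<close> gives
          \<open>- \<nu> e\<close> times \<open>w\<close>, because \<open>S\<close> and
          \<open>T\<close> have the same square. As \<open>S\<close> is positive semidefinite and
          \<open>\<nu> e\<close> is positive, \<open>w\<close> vanishes.\<close>
        define w where "w = S *v e - \<nu> e *\<^sub>R e"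
        have "S *v w = - \<nu> e *\<^sub>R w"
          by (simp add: w_def matrix_vector_mult_diff_distrib SSe matrix_vector_mult_scaleR power2_eq_square scaleR_diff_right)
        moreover have "0 \<le> w \<bullet> (S *v w)" using Spsd by (simp add: pos_semidef_def)
        ultimately have "\<nu> e * (w \<bullet> w) \<le> 0" by simp
        then have "w \<bullet> w \<le> 0" using False \<nu> by (simp add: mult_le_0_iff)
        then have "w = 0" by (metis inner_eq_zero_iff inner_ge_zero order_antisym)
        then show ?thesis by (simp add: w_def)
      qed
      then show ?thesis using T.eigen[OF e] by simp
    qed
    then have "S *v (\<Sum>b\<in>F. (x \<bullet> b) *\<^sub>R b) = T *v (\<Sum>b\<in>F. (x \<bullet> b) *\<^sub>R b)" for x
      by (simp add: vec.sum matrix_vector_mult_scaleR)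
    then show "T = S" by (simp add: T.expand matrix_eq)
  qed
qed

lemma
  assumes "pos_semidef M"
  shows pos_semidef_mat_sqrt: "pos_semidef (mat_sqrt M)" and mat_sqrt_square: "mat_sqrt M ** mat_sqrt M = M"
  using theI'[OF pos_semidef_unique_sqrt[OF assms]] unfolding mat_sqrt_def by blast+

section \<open>Distance to the spectrum of a self-adjoint matrix\<close>

lemma selfadj_eigenbasis:
  assumes "selfadj M"
  shows "\<exists>E \<mu>. eigenbasis ((*v) M) E \<mu>"
  using assms by (intro self_adjoint_eigenbasis) (auto simp: selfadj_def)

text \<open>The resolvent bound, for complex \<open>z\<close>. The eigenbasis is only real, so the
  imaginary shift is split off: \<open>\<i> *s x\<close> is orthogonal to both \<open>x\<close> and
  \<open>M x\<close>, and Pythagoras adds its square.\<close>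

lemma selfadj_shift_norm_ge:
  fixes M :: "complex ^ 'm ^ 'm"
  assumes M: "selfadj M" and \<delta>: "0 \<le> \<delta>" "\<And>\<rho>. \<rho> \<in> spectrum M \<Longrightarrow> \<delta> \<le> cmod (z - \<rho>)"
  shows "\<delta> * norm x \<le> norm (M *v x - z *s x)"
proof -
  obtain E \<mu> where "eigenbasis ((*v) M) E \<mu>" using selfadj_eigenbasis[OF M] by blast
  then interpret eigenbasis "(*v) M" E \<mu> .
  have spec: "complex_of_real (\<mu> b) \<in> spectrum M" if "b \<in> E" for b
    using eigen[OF that] nonzero[OF that] by (auto simp: spectrum_iff of_real_vector_smult)
  define u where "u = M *v x - Re z *\<^sub>R x"
  have "(M *v x) \<bullet> (\<i> *s x) = 0"
    using selfadj_inner_imaginary[OF M, of x] by (simp add: inner_commute[of _ "\<i> *s x"] cscale_component_inner)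
  then have u: "u \<bullet> (Im z *\<^sub>R (\<i> *s x)) = 0"
    by (simp add: u_def inner_diff_left)
  have "(\<delta> * norm x)\<^sup>2 = (\<Sum>b\<in>E. \<delta>\<^sup>2 * (x \<bullet> b)\<^sup>2)"
    by (simp add: power_mult_distrib norm_eq_sum sum_distrib_left)
  also have "\<dots> \<le> (\<Sum>b\<in>E. ((\<mu> b - Re z)\<^sup>2 + (Im z)\<^sup>2) * (x \<bullet> b)\<^sup>2)"
  proof (intro sum_mono mult_right_mono)
    fix b assume "b \<in> E"
    then have "\<delta>\<^sup>2 \<le> (cmod (z - complex_of_real (\<mu> b)))\<^sup>2" using \<delta> spec by (intro power_mono) auto
    then show "\<delta>\<^sup>2 \<le> (\<mu> b - Re z)\<^sup>2 + (Im z)\<^sup>2" by (simp add: cmod_power2 power2_commute)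
  qed simp
  also have "\<dots> = (\<Sum>b\<in>E. (u \<bullet> b)\<^sup>2) + (Im z)\<^sup>2 * (\<Sum>b\<in>E. (x \<bullet> b)\<^sup>2)"
    unfolding sum_distrib_left sum.distrib[symmetric]
    by (intro sum.cong) (auto simp: u_def inner_diff_left image_component power2_eq_square algebra_simps)
  also have "\<dots> = (norm u)\<^sup>2 + (norm (- (Im z *\<^sub>R (\<i> *s x))))\<^sup>2"
    by (simp add: norm_eq_sum[symmetric] norm_vector_smult power_mult_distrib)
  also have "\<dots> = (norm (u + - (Im z *\<^sub>R (\<i> *s x))))\<^sup>2"
    by (subst norm_add_Pythagorean) (use u in \<open>auto simp: orthogonal_def\<close>)
  also have "u + - (Im z *\<^sub>R (\<i> *s x)) = M *v x - z *s x"
    by (simp add: u_def vector_smult_Re_Im[of z])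
  finally show ?thesis using norm_ge_zero power2_le_imp_le by blast
qed

text \<open>An approximate eigenvector forces an eigenvalue nearby. Both localisations of the
  spectrum of \<open>A\<close> by discs rest on this, once with \<open>B\<close> and once with
  \<open>C\<close> in the place of \<open>M\<close>.\<close>

lemma selfadj_near_eigenvalue:
  fixes M :: "complex ^ 'm ^ 'm"
  assumes M: "selfadj M" and x: "x \<noteq> 0" "norm (M *v x - z *s x) \<le> \<delta> * norm x"
  shows "\<exists>\<rho>\<in>spectrum M. cmod (z - \<rho>) \<le> \<delta>"
proof (rule ccontr)
  assume neg: "\<not> ?thesis"
  \<comment> \<open>The extra element makes the set nonempty for \<open>Min\<close> and exceeds
    \<open>\<delta>\<close>.\<close>
  define D where "D = insert (\<bar>\<delta>\<bar> + 1) ((\<lambda>\<rho>. cmod (z - \<rho>)) ` spectrum M)"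
  have fin: "finite D" by (simp add: D_def finite_spectrum_on)
  have "Min D \<in> D" by (rule Min_in[OF fin]) (simp add: D_def)
  then have D: "\<delta> < Min D" "0 \<le> Min D" using neg by (auto simp: D_def)
  have "Min D * norm x \<le> norm (M *v x - z *s x)"
    by (rule selfadj_shift_norm_ge[OF M D(2)]) (use fin in \<open>auto simp: D_def\<close>)
  moreover have "\<delta> * norm x < Min D * norm x" using D(1) x(1) by (intro mult_strict_right_mono) auto
  ultimately show False using x(2) by linarith
qed

lemma subspace_ker: "vec.subspace (ker M)" for M :: "complex ^ 'm ^ 'm"
  unfolding ker_def by (rule vec.subspace_kernel)

text \<open>Orthogonality to the kernel removes the components with eigenvalue 0, so only the
  nonzero eigenvalues enter. The first bound is applied to \<open>B\<close> and to \<open>C\<close>,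
  the second to \<open>B\<close> as the damping.\<close>

lemma
  fixes M :: "complex ^ 'm ^ 'm"
  assumes M: "selfadj M" and x: "\<And>y. y \<in> ker M \<Longrightarrow> y \<bullet> x = 0"
  shows selfadj_norm_ge: "0 \<le> r \<Longrightarrow> (\<And>\<rho>. \<rho> \<in> spectrum M - {0} \<Longrightarrow> r \<le> cmod \<rho>) \<Longrightarrow> r * norm x \<le> norm (M *v x)"
    and selfadj_inner_ge: "(\<And>\<rho>. \<rho> \<in> spectrum M - {0} \<Longrightarrow> r \<le> Re \<rho>) \<Longrightarrow> r * (norm x)\<^sup>2 \<le> x \<bullet> (M *v x)"
proof -
  obtain E \<mu> where "eigenbasis ((*v) M) E \<mu>" using selfadj_eigenbasis[OF M] by blast
  then interpret eigenbasis "(*v) M" E \<mu> .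
  have spec: "complex_of_real (\<mu> b) \<in> spectrum M" if "b \<in> E" for b
    using eigen[OF that] nonzero[OF that] by (auto simp: spectrum_iff of_real_vector_smult)
  have x0: "x \<bullet> b = 0" if "b \<in> E" "\<mu> b = 0" for b
    using x[of b] eigen[OF that(1)] that(2) by (simp add: ker_def inner_commute)
  { assume r: "0 \<le> r" "\<And>\<rho>. \<rho> \<in> spectrum M - {0} \<Longrightarrow> r \<le> cmod \<rho>"
    have "(r * norm x)\<^sup>2 = (\<Sum>b\<in>E. r\<^sup>2 * (x \<bullet> b)\<^sup>2)"
      by (simp add: power_mult_distrib norm_eq_sum sum_distrib_left)
    also have "\<dots> \<le> (\<Sum>b\<in>E. ((M *v x) \<bullet> b)\<^sup>2)"
    proof (rule sum_mono)
      fix b assume b: "b \<in> E"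
      show "r\<^sup>2 * (x \<bullet> b)\<^sup>2 \<le> ((M *v x) \<bullet> b)\<^sup>2"
      proof (cases "\<mu> b = 0")
        case False
        then have "r \<le> \<bar>\<mu> b\<bar>" using r(2)[of "\<mu> b"] spec[OF b] by simp
        then have "r\<^sup>2 \<le> (\<mu> b)\<^sup>2" using r(1) by (metis abs_le_square_iff abs_of_nonneg)
        then show ?thesis by (simp add: image_component[OF b] power_mult_distrib mult_right_mono)
      qed (simp add: x0[OF b])
    qed
    also have "\<dots> = (norm (M *v x))\<^sup>2" by (simp add: norm_eq_sum)
    finally show "r * norm x \<le> norm (M *v x)" using norm_ge_zero power2_le_imp_le by blast
  }
  { assume r: "\<And>\<rho>. \<rho> \<in> spectrum M - {0} \<Longrightarrow> r \<le> Re \<rho>"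
    have "r * (norm x)\<^sup>2 = (\<Sum>b\<in>E. r * (x \<bullet> b)\<^sup>2)"
      by (simp add: norm_eq_sum sum_distrib_left)
    also have "\<dots> \<le> (\<Sum>b\<in>E. (x \<bullet> b) * ((M *v x) \<bullet> b))"
    proof (rule sum_mono)
      fix b assume b: "b \<in> E"
      show "r * (x \<bullet> b)\<^sup>2 \<le> (x \<bullet> b) * ((M *v x) \<bullet> b)"
      proof (cases "\<mu> b = 0")
        case False
        then have "r \<le> \<mu> b" using r[of "\<mu> b"] spec[OF b] by simp
        then have "r * (x \<bullet> b)\<^sup>2 \<le> \<mu> b * (x \<bullet> b)\<^sup>2" by (intro mult_right_mono) auto
        then show ?thesis by (simp add: image_component[OF b] power2_eq_square algebra_simps)
      qed (simp add: x0[OF b])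
    qed
    also have "\<dots> = x \<bullet> (M *v x)" by (rule inner_eq_sum[symmetric])
    finally show "r * (norm x)\<^sup>2 \<le> x \<bullet> (M *v x)" . }
qed

lemma selfadj_nonzero_eigenvalue:
  fixes M :: "complex ^ 'm ^ 'm"
  assumes M: "selfadj M" and "M \<noteq> 0"
  shows "\<exists>\<rho>\<in>spectrum M. \<rho> \<noteq> 0"
proof (rule ccontr)
  obtain E \<mu> where "eigenbasis ((*v) M) E \<mu>" using selfadj_eigenbasis[OF M] by blast
  then interpret eigenbasis "(*v) M" E \<mu> .
  assume none: "\<not> ?thesis"
  have "\<mu> b = 0" if "b \<in> E" for b
  proof -
    have "complex_of_real (\<mu> b) \<in> spectrum M"
      using eigen[OF that] nonzero[OF that] by (auto simp: spectrum_iff of_real_vector_smult)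
    then show ?thesis using none by auto
  qed
  then have "M *v x = 0" for x using norm_eq_sum[of "M *v x"] by (simp add: image_component)
  then have "M = 0" by (simp add: matrix_eq)
  with assms show False by simp
qed

text \<open>For the harder inclusion let \<open>v\<close> be the part of \<open>x\<close> orthogonal
  to the range. Then \<open>M v\<close> has norm 0 because \<open>v\<close> is orthogonal to
  \<open>M (M v)\<close>, so \<open>v\<close> lies in the kernel, to which \<open>x\<close> is
  orthogonal.\<close>

lemma selfadj_range_iff:
  fixes M :: "complex ^ 'm ^ 'm"
  assumes M: "selfadj M"
  shows "x \<in> range ((*v) M) \<longleftrightarrow> (\<forall>y\<in>ker M. y \<bullet> x = 0)"
proof
  assume "x \<in> range ((*v) M)"
  then show "\<forall>y\<in>ker M. y \<bullet> x = 0" using M by (auto simp: ker_def simp flip: selfadjD)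
next
  assume x: "\<forall>y\<in>ker M. y \<bullet> x = 0"
  have R: "vec.subspace (range ((*v) M))" by (rule vec.subspace_image) simp
  define P where "P = orth_proj (range ((*v) M))"
  define v where "v = x - P *v x"
  have "(M *v v) \<bullet> (M *v v) = v \<bullet> (M *v (M *v v))" by (rule selfadjD[OF M])
  also have "\<dots> = 0" using orth_proj_orthogonal[OF R, of "M *v (M *v v)" x] by (simp add: v_def P_def inner_commute)
  finally have vk: "v \<in> ker M" by (simp add: ker_def)
  have Px: "P *v x \<in> range ((*v) M)" using orth_proj_in[OF R] by (simp add: P_def)
  then have "v \<bullet> (P *v x) = 0" using vk M by (auto simp: ker_def simp flip: selfadjD)
  moreover have "v \<bullet> x = 0" using x vk by blast
  ultimately have "v \<bullet> v = 0" by (simp add: v_def inner_diff_right)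
  then have "x = P *v x" by (simp add: v_def)
  then show "x \<in> range ((*v) M)" using Px by metis
qed

section \<open>Large dissipation\<close>

text \<open>The eigenspace of \<open>N\<close> for \<open>z\<close> is invariant under
  \<open>M\<close>, which commutes with \<open>N\<close>, so it contains an eigenvector of
  \<open>M\<close>.\<close>

lemma spectral_mapping_subset:
  assumes U: "invariant_subspace M U" and N: "\<And>x. N *v x = pev p M x"
    and z: "z \<in> spectrum_on N U"
  shows "\<exists>\<zeta>\<in>spectrum_on M U. z = poly p \<zeta>"
proof -
  have NU: "invariant_subspace N U"
    using U pev_in[OF U] by (simp add: invariant_subspace_def N)
  define X where "X = {x \<in> U. N *v x = z *s x}"
  have comm: "N *v (M *v x) = M *v (N *v x)" for x
  proof -
    have "pev p M (pev [:0, 1:] M x) = pev [:0, 1:] M (pev p M x)" by (metis mult.commute pev_mult)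
    then show ?thesis by (simp add: N)
  qed
  have "invariant_subspace M X"
    unfolding invariant_subspace_def
  proof
    show "vec.subspace X"
      using U unfolding X_def invariant_subspace_def
      by (auto intro!: vec.subspaceI simp: matrix_vector_right_distrib vec.scale_right_distrib
          vector_scalar_commute vec.scale_scale mult.commute vec.subspace_add vec.subspace_scale vec.subspace_0)
    show "\<forall>x\<in>X. M *v x \<in> X"
      using U by (auto simp: X_def comm invariant_subspace_def vector_scalar_commute)
  qed
  moreover have "X \<noteq> {0}" using z spectrum_on_iff[OF NU] by (auto simp: X_def)
  ultimately obtain \<zeta> where "\<zeta> \<in> spectrum_on M X" using spectrum_on_empty by blast
  then obtain x where x: "x \<in> X" "x \<noteq> 0" "M *v x = \<zeta> *s x"
    using spectrum_on_iff[OF \<open>invariant_subspace M X\<close>] by blast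
  then have "poly p \<zeta> *s x = z *s x" using pev_eigen[OF x(3), of p] by (simp add: X_def N)
  then have "z = poly p \<zeta>" using x(2) by (metis vec.scale_right_imp_eq)
  moreover have "\<zeta> \<in> spectrum_on M U" using x spectrum_on_iff[OF U] by (auto simp: X_def)
  ultimately show ?thesis by blast
qed

lemma dim_le_of_injective:
  fixes M :: "complex ^ 'm ^ 'n"
  assumes "vec.subspace U" "\<And>x. x \<in> U \<Longrightarrow> M *v x \<in> T" "\<And>x. x \<in> U \<Longrightarrow> M *v x = 0 \<Longrightarrow> x = 0"
  shows "vec.dim U \<le> vec.dim T"
proof -
  have "inj_on ((*v) M) U"
  proof (rule inj_onI)
    fix x y assume xy: "x \<in> U" "y \<in> U" "M *v x = M *v y"
    then show "x = y" using assms(3)[of "x - y"] vec.subspace_diff[OF assms(1)]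
      by (simp add: matrix_vector_mult_diff_distrib)
  qed
  then have "vec.dim ((*v) M ` U) = vec.dim U"
    using assms(1) by (intro vec.dim_image_eq) (auto simp: vec.span_eq_iff[THEN iffD2])
  moreover have "vec.dim ((*v) M ` U) \<le> vec.dim T" using assms(2) by (intro vec.dim_subset) auto
  ultimately show ?thesis by simp
qed

lemma subspace_orthogonal_within:
  assumes "vec.subspace L"
  shows "vec.subspace {x \<in> L. \<forall>y\<in>Y. y \<bullet> x = 0 \<and> (\<i> *s y) \<bullet> x = 0}"
proof -
  have "y \<bullet> (c *s x) = 0" if "y \<bullet> x = 0" "(\<i> *s y) \<bullet> x = 0" for c and x y :: "complex ^ 'a"
    using that unfolding vector_smult_Re_Im[of c x]
    by (simp add: inner_add_right cscale_component_inner)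
  moreover have "(\<i> *s y) \<bullet> (c *s x) = 0" if "y \<bullet> x = 0" "(\<i> *s y) \<bullet> x = 0" for c and x y :: "complex ^ 'a"
    using that unfolding vector_smult_Re_Im[of c x]
    by (simp add: inner_add_right cscale_component_inner vec.scale_scale)
  ultimately show ?thesis using assms
    by (intro vec.subspaceI) (auto simp: inner_add_right vec.subspace_0 vec.subspace_add vec.subspace_scale)
qed

lemma dim_orthogonal_within:
  fixes Y L :: "(complex ^ 'm) set"
  assumes Y: "vec.subspace Y" and L: "vec.subspace L" and "Y \<subseteq> L"
  shows "vec.dim L = vec.dim Y + vec.dim {x \<in> L. \<forall>y\<in>Y. y \<bullet> x = 0}"
proof -
  have eq: "{x \<in> L. \<forall>y\<in>Y. y \<bullet> x = 0} = {x \<in> L. \<forall>y\<in>Y. y \<bullet> x = 0 \<and> (\<i> *s y) \<bullet> x = 0}"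
    using vec.subspace_scale[OF Y, of _ \<i>] by auto
  have O: "vec.subspace {x \<in> L. \<forall>y\<in>Y. y \<bullet> x = 0}"
    unfolding eq by (rule subspace_orthogonal_within[OF L])
  show ?thesis
  proof (rule dim_direct_sum[OF _ Y O])
    show "direct_sum L Y {x \<in> L. \<forall>y\<in>Y. y \<bullet> x = 0}"
      unfolding direct_sum_def
    proof (intro conjI set_eqI iffI)
      fix x assume x: "x \<in> L"
      have "orth_proj Y *v x \<in> Y" "x - orth_proj Y *v x \<in> L"
        using orth_proj_in[OF Y] \<open>Y \<subseteq> L\<close> x vec.subspace_diff[OF L] by blast+
      moreover have "\<forall>y\<in>Y. y \<bullet> (x - orth_proj Y *v x) = 0" using orth_proj_orthogonal[OF Y] by blast
      moreover have "x = orth_proj Y *v x + (x - orth_proj Y *v x)" by simp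
      ultimately show "x \<in> {u + v |u v. u \<in> Y \<and> v \<in> {x \<in> L. \<forall>y\<in>Y. y \<bullet> x = 0}}" by blast
    next
      fix x assume "x \<in> {u + v |u v. u \<in> Y \<and> v \<in> {x \<in> L. \<forall>y\<in>Y. y \<bullet> x = 0}}"
      then show "x \<in> L" using \<open>Y \<subseteq> L\<close> vec.subspace_add[OF L] by blast
    next
      fix x assume "x \<in> Y \<inter> {x \<in> L. \<forall>y\<in>Y. y \<bullet> x = 0}"
      then have "x \<bullet> x = 0" by blast
      then show "x \<in> {0}" by simp
    next
      fix x :: "complex ^ 'm" assume "x \<in> {0}"
      then show "x \<in> Y \<inter> {x \<in> L. \<forall>y\<in>Y. y \<bullet> x = 0}" using vec.subspace_0 Y L by auto
    qed
  qed
qed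

lemma cscale_mult: "cscale c M *v x = c *s (M *v x)"
  by (simp add: vec_eq_iff cscale_def matrix_vector_mult_def sum_distrib_left mult.assoc)

lemma mat_mult_vec: "mat c *v x = c *s x" for x :: "complex ^ 'm"
  by (simp add: vec_eq_iff mat_def matrix_vector_mult_def if_distrib if_distribR cong: if_cong)

lemma A_mat_mult: "A_mat \<Omega> B \<beta> *v x = \<Omega> *v x - (\<i> * complex_of_real \<beta>) *s (B *v x)"
  by (simp add: A_mat_def matrix_vector_mult_diff_rdistrib cscale_mult)

section \<open>Dissipative pairs: localisation of the spectrum\<close>

text \<open>\<open>B_nonzero\<close> gives \<open>b_min\<close> a meaning and
  \<open>ker_B_nonzero\<close> makes the low-loss space nontrivial. By
  \<open>spectrum_symmetric\<close> the smallest positive eigenvalue of the compression also bounds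
  the negative ones.\<close>

locale dissipative =
  fixes \<Omega> B :: "complex ^ 'm ^ 'm"
  assumes selfadj_\<Omega>: "selfadj \<Omega>" and selfadj_B: "selfadj B"
    and B_nonneg: "\<And>x. 0 \<le> x \<bullet> (B *v x)"
    and B_nonzero: "B \<noteq> 0"
    and ker_B_nonzero: "ker B \<noteq> {0}"
    and spectrum_symmetric: "\<And>\<rho>. \<rho> \<in> spectrum (compression \<Omega> B) \<Longrightarrow> - \<rho> \<in> spectrum (compression \<Omega> B)"
begin

abbreviation "P \<equiv> orth_proj (ker B)"
abbreviation "C \<equiv> compression \<Omega> B"
abbreviation "\<omega> \<equiv> omega_max \<Omega>"
abbreviation "b \<equiv> b_min B"
abbreviation "r \<equiv> rho_min \<Omega> B"
abbreviation "A \<equiv> A_mat \<Omega> B"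
abbreviation "c \<equiv> c_bound \<Omega> B"

lemma bounded_linear_\<Omega>: "bounded_linear ((*v) \<Omega>)"
  by (simp add: linear_conv_bounded_linear[symmetric])

lemma norm_\<Omega>_le: "norm (\<Omega> *v x) \<le> \<omega> * norm x"
  unfolding omega_max_def using onorm[OF bounded_linear_\<Omega>] by simp

lemma \<omega>_nonneg: "0 \<le> \<omega>"
  unfolding omega_max_def by (rule onorm_pos_le[OF bounded_linear_\<Omega>])

lemma P_in: "P *v x \<in> ker B" by (rule orth_proj_in[OF subspace_ker])

lemma P_id: "x \<in> ker B \<Longrightarrow> P *v x = x" by (rule orth_proj_id[OF subspace_ker])

lemma selfadj_P: "selfadj P" by (rule selfadj_orth_proj[OF subspace_ker])

lemma norm_P_le: "norm (P *v x) \<le> norm x" by (rule norm_orth_proj_le[OF subspace_ker])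

lemma norm_Q_le: "norm (x - P *v x) \<le> norm x" by (rule norm_orth_proj_le[OF subspace_ker])

lemma P_pythagoras: "(norm x)\<^sup>2 = (norm (P *v x))\<^sup>2 + (norm (x - P *v x))\<^sup>2"
  by (rule orth_proj_pythagoras[OF subspace_ker])

lemma B_P [simp]: "B *v (P *v x) = 0" using P_in by (simp add: ker_def)

lemma B_Q: "B *v (x - P *v x) = B *v x" by (simp add: matrix_vector_mult_diff_distrib)

lemma P_B [simp]: "P *v (B *v x) = 0"
proof -
  have "(P *v (B *v x)) \<bullet> y = 0" for y
    by (simp add: selfadjD[OF selfadj_P] selfadjD[OF selfadj_B])
  then have "(P *v (B *v x)) \<bullet> (P *v (B *v x)) = 0" by blast
  then show ?thesis by simp
qed

lemma Q_orthogonal: "y \<in> ker B \<Longrightarrow> y \<bullet> (x - P *v x) = 0" by (rule orth_proj_orthogonal[OF subspace_ker])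

lemma C_apply: "C *v x = P *v (\<Omega> *v (P *v x))"
  by (simp add: compression_def matrix_vector_mul_assoc matrix_mul_assoc)

lemma C_in: "C *v x \<in> ker B" by (simp add: C_apply P_in)

lemma C_P [simp]: "C *v (P *v x) = C *v x" by (simp add: C_apply P_id P_in)

lemma selfadj_C: "selfadj C"
  unfolding selfadj_def by (simp add: C_apply selfadjD[OF selfadj_P] selfadjD[OF selfadj_\<Omega>])

lemma norm_C_le: "norm (C *v x) \<le> \<omega> * norm (P *v x)"
  unfolding C_apply using norm_P_le norm_\<Omega>_le order_trans by blast

lemma norm_C_le': "norm (C *v x) \<le> \<omega> * norm x"
  using norm_C_le[of x] mult_left_mono[OF norm_P_le[of x] \<omega>_nonneg] by linarith

lemma finite_nonzero_eigvals: "finite (nonzero_eigvals B)"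
proof -
  have "complex_of_real ` nonzero_eigvals B \<subseteq> spectrum B" by (auto simp: nonzero_eigvals_def)
  then have "finite (complex_of_real ` nonzero_eigvals B)"
    using finite_spectrum_on[OF invariant_subspace_UNIV] finite_subset by blast
  then show ?thesis by (rule finite_imageD) (auto simp: inj_on_def)
qed

lemma spectrum_B_cases: "\<mu> \<in> spectrum B \<Longrightarrow> \<mu> \<noteq> 0 \<Longrightarrow> Re \<mu> \<in> nonzero_eigvals B \<and> \<mu> = complex_of_real (Re \<mu>)"
proof -
  assume \<mu>: "\<mu> \<in> spectrum B" "\<mu> \<noteq> 0"
  have "\<mu> = complex_of_real (Re \<mu>)" using spectrum_real[OF selfadj_B \<mu>(1)] by (simp add: complex_eq_iff)
  with \<mu> show ?thesis by (metis (mono_tags, lifting) mem_Collect_eq nonzero_eigvals_def of_real_0)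
qed

lemma nonzero_eigvals_nonempty: "nonzero_eigvals B \<noteq> {}"
  using selfadj_nonzero_eigenvalue[OF selfadj_B B_nonzero] spectrum_B_cases by blast

lemma nonzero_eigvals_pos: "\<mu> \<in> nonzero_eigvals B \<Longrightarrow> 0 < \<mu>"
proof -
  assume \<mu>: "\<mu> \<in> nonzero_eigvals B"
  then obtain x where x: "x \<noteq> 0" "B *v x = \<mu> *\<^sub>R x"
    by (auto simp: nonzero_eigvals_def spectrum_iff of_real_vector_smult)
  have "0 \<le> \<mu> * (norm x)\<^sup>2" using B_nonneg[of x] by (simp add: x dot_square_norm)
  then have "0 \<le> \<mu>" using x by (simp add: zero_le_mult_iff)
  then show ?thesis using \<mu> by (auto simp: nonzero_eigvals_def)
qed

lemma b_pos: "0 < b"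
  unfolding b_min_def using nonzero_eigvals_pos Min_in[OF finite_nonzero_eigvals nonzero_eigvals_nonempty] by blast

lemma b_le: "\<mu> \<in> nonzero_eigvals B \<Longrightarrow> b \<le> \<mu>"
  unfolding b_min_def by (rule Min_le[OF finite_nonzero_eigvals])

lemma Q_inner_ge: "b * (norm (x - P *v x))\<^sup>2 \<le> (x - P *v x) \<bullet> (B *v x)"
proof -
  have "b * (norm (x - P *v x))\<^sup>2 \<le> (x - P *v x) \<bullet> (B *v (x - P *v x))"
  proof (rule selfadj_inner_ge[OF selfadj_B Q_orthogonal])
    fix \<rho> assume "\<rho> \<in> spectrum B - {0}"
    then show "b \<le> Re \<rho>" using spectrum_B_cases b_le by blast
  qed
  then show ?thesis by (simp only: B_Q)
qed

lemma norm_BQ_ge: "b * norm (x - P *v x) \<le> norm (B *v x)"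
proof -
  have "b * norm (x - P *v x) \<le> norm (B *v (x - P *v x))"
  proof (rule selfadj_norm_ge[OF selfadj_B Q_orthogonal])
    fix \<rho> assume "\<rho> \<in> spectrum B - {0}"
    then have "b \<le> Re \<rho>" using spectrum_B_cases b_le by blast
    then show "b \<le> cmod \<rho>" using complex_Re_le_cmod[of \<rho>] by linarith
  qed (use b_pos in auto)
  then show ?thesis by (simp only: B_Q)
qed

lemma finite_spectrum_C: "finite (spectrum C)" by (rule finite_spectrum_on) simp

lemma zero_in_spectrum_C: "0 \<in> spectrum C"
proof -
  obtain x where "B *v x \<noteq> 0" using B_nonzero by (auto simp: matrix_eq)
  moreover have "C *v (B *v x) = 0 *s (B *v x)" by (simp add: C_apply)
  ultimately show ?thesis unfolding spectrum_iff by blast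
qed

lemma spectrum_C_real: "\<rho> \<in> spectrum C \<Longrightarrow> Im \<rho> = 0"
  by (rule spectrum_real[OF selfadj_C])

lemma spectrum_C_le: "\<rho> \<in> spectrum C \<Longrightarrow> cmod \<rho> \<le> \<omega>"
proof -
  assume "\<rho> \<in> spectrum C"
  then obtain x where x: "x \<noteq> 0" "C *v x = \<rho> *s x" by (auto simp: spectrum_iff)
  then have "cmod \<rho> * norm x \<le> \<omega> * norm x" using norm_C_le'[of x] by (simp add: norm_vector_smult)
  then show ?thesis using x by simp
qed

text \<open>By symmetry the modulus of every nonzero eigenvalue is again an eigenvalue, so the
  smallest positive one bounds all these moduli from below. \<open>C \<noteq> 0\<close> makes the
  set under \<open>Min\<close> nonempty.\<close>

lemma
  assumes "C \<noteq> 0"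
  shows r_pos: "0 < r" and r_in_spectrum: "complex_of_real r \<in> spectrum C"
    and r_le: "\<rho> \<in> spectrum C - {0} \<Longrightarrow> r \<le> cmod \<rho>" and r_le_\<omega>: "r \<le> \<omega>"
proof -
  define X where "X = {x. 0 < x \<and> complex_of_real x \<in> spectrum C}"
  have "complex_of_real ` X \<subseteq> spectrum C" by (auto simp: X_def)
  then have "finite (complex_of_real ` X)" using finite_spectrum_C finite_subset by blast
  then have fin: "finite X" by (rule finite_imageD) (auto simp: inj_on_def)
  have abs: "cmod \<rho> \<in> X" if "\<rho> \<in> spectrum C - {0}" for \<rho>
  proof -
    have "\<rho> = complex_of_real (cmod \<rho>) \<or> - \<rho> = complex_of_real (cmod \<rho>)"
      using spectrum_C_real[of \<rho>] that by (auto simp: complex_eq_iff cmod_def)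
    then show ?thesis using that spectrum_symmetric[of \<rho>] by (auto simp: X_def)
  qed
  have ne: "X \<noteq> {}" using selfadj_nonzero_eigenvalue[OF selfadj_C assms] abs by blast
  have r: "r = Min X" by (simp add: rho_min_def X_def)
  have rX: "r \<in> X" unfolding r by (rule Min_in[OF fin ne])
  then show "0 < r" "complex_of_real r \<in> spectrum C" by (auto simp: X_def)
  then show "r \<le> \<omega>" using spectrum_C_le[of "complex_of_real r"] by simp
  show "r \<le> cmod \<rho>" if "\<rho> \<in> spectrum C - {0}" unfolding r by (rule Min_le[OF fin abs[OF that]])
qed

lemma P_A: "P *v (A \<beta> *v x) = C *v x + P *v (\<Omega> *v (x - P *v x))"
  by (simp add: A_mat_mult matrix_vector_mult_diff_distrib vector_scalar_commute C_apply)

text \<open>In the quadratic form of \<open>A \<beta>\<close> the matrix \<open>\<Omega>\<close>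
  contributes a real number, so the imaginary part is \<open>- \<beta>\<close> times the form of
  \<open>B\<close>.\<close>

lemma spectrum_A_Im:
  assumes "0 \<le> \<beta>" "\<zeta> \<in> spectrum (A \<beta>)"
  shows "Im \<zeta> \<le> 0"
proof -
  obtain x where x: "x \<noteq> 0" "A \<beta> *v x = \<zeta> *s x" using assms by (auto simp: spectrum_iff)
  have "(\<i> *s x) \<bullet> (A \<beta> *v x) = - (\<beta> * (x \<bullet> (B *v x)))"
    using selfadj_inner_imaginary[OF selfadj_\<Omega>, of x]
    by (simp add: A_mat_mult inner_diff_right cscale_component_inner vec.scale_scale
        of_real_vector_smult)
  moreover have "(\<i> *s x) \<bullet> (A \<beta> *v x) = Im \<zeta> * (norm x)\<^sup>2"
    unfolding x(2) vector_smult_Re_Im[of \<zeta>]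
    by (simp add: inner_add_right dot_square_norm norm_vector_smult inner_commute[of "\<i> *s x" x])
  ultimately have "Im \<zeta> * (norm x)\<^sup>2 \<le> 0" using assms B_nonneg[of x] by simp
  then show ?thesis using x by (simp add: mult_le_0_iff)
qed

text \<open>After division by \<open>\<i> * \<beta>\<close> the eigenvalue equation says that
  \<open>x\<close> is an eigenvector of \<open>B\<close> up to a relative error
  \<open>\<omega> / \<beta>\<close>, with approximate eigenvalue
  \<open>\<i> * \<zeta> / \<beta>\<close>.\<close>

lemma spectrum_A_near:
  assumes "0 < \<beta>" "\<zeta> \<in> spectrum (A \<beta>)"
  shows "\<exists>\<mu>\<in>insert 0 (nonzero_eigvals B). cmod (\<zeta> + \<i> * complex_of_real (\<beta> * \<mu>)) \<le> \<omega>"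
proof -
  obtain x where x: "x \<noteq> 0" "A \<beta> *v x = \<zeta> *s x" using assms by (auto simp: spectrum_iff)
  define z where "z = \<i> * \<zeta> / complex_of_real \<beta>"
  have "\<i> * complex_of_real \<beta> * z = - \<zeta>" using assms by (simp add: z_def)
  then have "(\<i> * complex_of_real \<beta>) *s (B *v x - z *s x) = \<Omega> *v x"
    using x(2) by (simp add: A_mat_mult vec.scale_right_diff_distrib vec.scale_scale algebra_simps)
  then have "\<beta> * norm (B *v x - z *s x) = norm (\<Omega> *v x)"
    using assms(1) norm_vector_smult[of "\<i> * complex_of_real \<beta>" "B *v x - z *s x"] by (simp add: norm_mult)
  then have "norm (B *v x - z *s x) \<le> \<omega> / \<beta> * norm x"
    using norm_\<Omega>_le[of x] assms(1) by (simp add: field_simps)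
  then obtain \<rho> where \<rho>: "\<rho> \<in> spectrum B" "cmod (z - \<rho>) \<le> \<omega> / \<beta>"
    using selfadj_near_eigenvalue[OF selfadj_B x(1)] by blast
  have "\<exists>\<mu>\<in>insert 0 (nonzero_eigvals B). \<rho> = complex_of_real \<mu>"
    using spectrum_B_cases[OF \<rho>(1)] by (cases "\<rho> = 0") auto
  then obtain \<mu> where \<mu>: "\<mu> \<in> insert 0 (nonzero_eigvals B)" "\<rho> = complex_of_real \<mu>" by blast
  have "\<i> * (\<zeta> + \<i> * complex_of_real (\<beta> * \<mu>)) = complex_of_real \<beta> * (z - \<rho>)"
    using assms(1) by (simp add: z_def \<mu> field_simps)
  then have "cmod (\<zeta> + \<i> * complex_of_real (\<beta> * \<mu>)) = cmod (complex_of_real \<beta> * (z - \<rho>))"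
    by (metis norm_mult norm_ii mult_1)
  also have "\<dots> \<le> \<omega>" using \<rho>(2) assms(1) by (simp only: norm_mult norm_of_real) (simp add: field_simps)
  finally show ?thesis using \<mu>(1) by blast
qed

text \<open>The damping controls the component outside \<open>ker B\<close>: \<open>\<beta> * b *
  norm x1 \<le> \<omega> * norm x0 + 2 * \<omega> * norm x1\<close>. Then \<open>x0\<close> is an
  approximate eigenvector of \<open>C\<close> with error \<open>P \<Omega> x1\<close>. The resulting
  radius is half of \<open>c \<beta>\<close>.\<close>

lemma spectrum_A_low:
  assumes \<beta>: "0 < \<beta>" "2 * \<omega> < \<beta> * b" and \<zeta>: "\<zeta> \<in> spectrum (A \<beta>)" "cmod \<zeta> \<le> \<omega>"
  shows "\<exists>\<rho>\<in>spectrum C. cmod (\<zeta> - \<rho>) \<le> \<omega>\<^sup>2 / (\<beta> * b - 2 * \<omega>)"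
proof -
  obtain x where x: "x \<noteq> 0" "A \<beta> *v x = \<zeta> *s x" using \<zeta> by (auto simp: spectrum_iff)
  define x0 x1 where "x0 = P *v x" and "x1 = x - P *v x"
  have x01: "x = x0 + x1" by (simp add: x0_def x1_def)
  have "\<beta> * b * norm x1 \<le> \<beta> * norm (B *v x)" using norm_BQ_ge[of x] \<beta> by (simp add: x1_def)
  also have "\<dots> = norm ((\<i> * complex_of_real \<beta>) *s (B *v x))" using \<beta> by (simp add: norm_vector_smult norm_mult)
  also have "(\<i> * complex_of_real \<beta>) *s (B *v x) = (\<Omega> *v x - P *v (\<Omega> *v x)) - \<zeta> *s x1"
  proof -
    have "(\<i> * complex_of_real \<beta>) *s (B *v x) = \<Omega> *v x - \<zeta> *s x" using x(2) by (simp add: A_mat_mult algebra_simps)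
    moreover have "P *v ((\<i> * complex_of_real \<beta>) *s (B *v x)) = 0" by (simp add: vector_scalar_commute)
    ultimately have "P *v (\<Omega> *v x) = \<zeta> *s x0"
      by (simp add: matrix_vector_mult_diff_distrib vector_scalar_commute x0_def)
    with \<open>(\<i> * complex_of_real \<beta>) *s (B *v x) = \<Omega> *v x - \<zeta> *s x\<close> show ?thesis
      by (simp add: x01 vec.scale_right_distrib)
  qed
  also have "norm \<dots> \<le> norm (\<Omega> *v x - P *v (\<Omega> *v x)) + norm (\<zeta> *s x1)" by (rule norm_triangle_ineq4)
  also have "\<dots> \<le> (\<omega> * norm x0 + \<omega> * norm x1) + \<omega> * norm x1"
  proof (rule add_mono)
    have "norm (\<Omega> *v x - P *v (\<Omega> *v x)) \<le> norm (\<Omega> *v x0 + \<Omega> *v x1)"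
      using norm_Q_le[of "\<Omega> *v x"] by (simp add: x01 matrix_vector_right_distrib)
    also have "\<dots> \<le> \<omega> * norm x0 + \<omega> * norm x1"
      using norm_triangle_ineq[of "\<Omega> *v x0" "\<Omega> *v x1"] norm_\<Omega>_le[of x0] norm_\<Omega>_le[of x1] by linarith
    finally show "norm (\<Omega> *v x - P *v (\<Omega> *v x)) \<le> \<omega> * norm x0 + \<omega> * norm x1" .
    show "norm (\<zeta> *s x1) \<le> \<omega> * norm x1" using \<zeta>(2) by (simp add: norm_vector_smult mult_right_mono)
  qed
  finally have "(\<beta> * b - 2 * \<omega>) * norm x1 \<le> \<omega> * norm x0" by (simp add: algebra_simps)
  then have x1: "norm x1 \<le> \<omega> * norm x0 / (\<beta> * b - 2 * \<omega>)" using \<beta> by (simp add: field_simps)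
  have "x0 \<noteq> 0" using x1 x01 x(1) by auto
  have eq: "C *v x0 - \<zeta> *s x0 = - (P *v (\<Omega> *v x1))"
    using P_A[of \<beta> x] x(2) by (simp add: x0_def x1_def vector_scalar_commute algebra_simps)
  have "norm (C *v x0 - \<zeta> *s x0) \<le> \<omega> * norm x1"
    unfolding eq using norm_P_le[of "\<Omega> *v x1"] norm_\<Omega>_le[of x1] by simp
  also have "\<dots> \<le> \<omega> * (\<omega> * norm x0 / (\<beta> * b - 2 * \<omega>))" using x1 \<omega>_nonneg by (rule mult_left_mono)
  finally have "norm (C *v x0 - \<zeta> *s x0) \<le> \<omega>\<^sup>2 / (\<beta> * b - 2 * \<omega>) * norm x0"
    by (simp add: power2_eq_square)
  then show ?thesis by (rule selfadj_near_eigenvalue[OF selfadj_C \<open>x0 \<noteq> 0\<close>])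
qed

text \<open>The quadratic form \<open>\<epsilon>\<^sup>2 \<bar>P x\<bar>\<^sup>2 - \<bar>x - P x\<bar>\<^sup>2\<close> is a Lyapunov function for \<open>- \<i> A + \<beta> b / 2\<close>.\<close>

lemma low_high_form:
  assumes \<beta>: "0 < \<beta>" and \<epsilon>: "0 < \<epsilon>" "\<epsilon> \<le> 1" "\<omega> < \<epsilon>\<^sup>2 * (\<beta> * b / 2)"
    and U: "invariant_subspace (A \<beta>) U" and x: "x \<in> U" "x \<noteq> 0"
  shows low_form: "(\<And>\<zeta>. \<zeta> \<in> spectrum_on (A \<beta>) U \<Longrightarrow> - Im \<zeta> \<le> \<omega>) \<Longrightarrow> norm (x - P *v x) < \<epsilon> * norm (P *v x)"
    and high_form: "(\<And>\<zeta>. \<zeta> \<in> spectrum_on (A \<beta>) U \<Longrightarrow> \<beta> * b - \<omega> \<le> - Im \<zeta>) \<Longrightarrow> x \<noteq> P *v x"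
proof -
  \<comment> \<open>Halfway between the two bands: for \<open>N\<close> below, low-loss eigenvalues
    get real part at least \<open>s - \<omega>\<close> and high-loss ones at most
    \<open>\<omega> - s\<close>.\<close>
  define s where "s = \<beta> * b / 2"
  have "\<epsilon>\<^sup>2 \<le> 1" using \<epsilon> by (simp add: power_le_one)
  moreover have "0 \<le> s" using \<beta> b_pos by (simp add: s_def)
  ultimately have "\<epsilon>\<^sup>2 * s \<le> 1 * s" by (rule mult_right_mono)
  moreover have "\<omega> < \<epsilon>\<^sup>2 * s" using \<epsilon>(3) by (simp add: s_def)
  ultimately have s: "\<omega> < s" "\<omega> < \<epsilon>\<^sup>2 * s" by simp_all
  define J where "J = cscale (complex_of_real (\<epsilon>\<^sup>2)) P - (mat 1 - P)"
  define N where "N = cscale (- \<i>) (A \<beta>) + mat (complex_of_real s)"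
  have J: "J *v y = \<epsilon>\<^sup>2 *\<^sub>R (P *v y) - (y - P *v y)" for y
    by (simp add: J_def matrix_vector_mult_diff_rdistrib cscale_mult of_real_vector_smult del: of_real_power)
  have N: "N *v y = (- \<i>) *s (A \<beta> *v y) + s *\<^sub>R y" for y
    by (simp add: N_def matrix_vector_mult_add_rdistrib cscale_mult mat_mult_vec of_real_vector_smult)
  have selfJ: "selfadj J"
    unfolding selfadj_def by (simp add: J inner_diff_left inner_diff_right selfadjD[OF selfadj_P])
  have Jx: "y \<bullet> (J *v y) = \<epsilon>\<^sup>2 * (norm (P *v y))\<^sup>2 - (norm (y - P *v y))\<^sup>2" for y
  proof -
    have "y \<bullet> (P *v y) = (norm (P *v y))\<^sup>2"
      using Q_orthogonal[OF P_in, of y y] by (simp add: inner_diff_right dot_square_norm inner_commute)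
    then show ?thesis using P_pythagoras[of y] by (simp add: J inner_diff_right dot_square_norm)
  qed
  have pos: "0 < y \<bullet> (J *v (N *v y))" if "y \<noteq> 0" for y
  proof -
    define y0 y1 where "y0 = P *v y" and "y1 = y - P *v y"
    have y: "y = y0 + y1" by (simp add: y0_def y1_def)
    have y01: "y0 \<bullet> y1 = 0" "y1 \<bullet> y0 = 0"
      using Q_orthogonal[OF P_in, of y y] by (simp_all add: y0_def y1_def inner_commute)
    have y0B: "y0 \<bullet> (B *v y) = 0" using selfadjD[OF selfadj_B, of y0 y] by (simp add: y0_def)
    have By: "b * (norm y1)\<^sup>2 \<le> y1 \<bullet> (B *v y)" using Q_inner_ge[of y] by (simp add: y1_def)
    have Jy: "J *v y = \<epsilon>\<^sup>2 *\<^sub>R y0 + (- y1)" by (simp add: J y0_def y1_def)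
    \<comment> \<open>Because \<open>\<epsilon> \<le> 1\<close>, \<open>J\<close> does not increase
      norms, so the term with \<open>\<Omega>\<close> costs at most \<open>\<omega>\<close> times
      the squared norm of \<open>y\<close>.\<close>
    have nJ: "norm (J *v y) \<le> norm y"
    proof -
      have "(norm (\<epsilon>\<^sup>2 *\<^sub>R y0 + (- y1)))\<^sup>2 = (norm (\<epsilon>\<^sup>2 *\<^sub>R y0))\<^sup>2 + (norm (- y1))\<^sup>2"
        by (rule norm_add_Pythagorean) (simp add: orthogonal_def y01)
      also have "\<dots> \<le> (norm y0)\<^sup>2 + (norm y1)\<^sup>2"
      proof -
        have "norm (\<epsilon>\<^sup>2 *\<^sub>R y0) \<le> norm y0" using \<open>\<epsilon>\<^sup>2 \<le> 1\<close> by (simp add: mult_left_le_one_le)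
        then have "(norm (\<epsilon>\<^sup>2 *\<^sub>R y0))\<^sup>2 \<le> (norm y0)\<^sup>2" by (intro power_mono) auto
        then show ?thesis by simp
      qed
      also have "\<dots> = (norm y)\<^sup>2" using P_pythagoras[of y] by (simp add: y0_def y1_def)
      finally have "(norm (J *v y))\<^sup>2 \<le> (norm y)\<^sup>2" by (simp only: Jy)
      then show ?thesis using norm_ge_zero power2_le_imp_le by blast
    qed
    have "\<bar>(J *v y) \<bullet> (\<i> *s (\<Omega> *v y))\<bar> \<le> norm (J *v y) * norm (\<i> *s (\<Omega> *v y))" by (rule Cauchy_Schwarz_ineq2)
    also have "\<dots> \<le> norm y * (\<omega> * norm y)"
      using nJ norm_\<Omega>_le[of y] by (intro mult_mono) (auto simp: norm_vector_smult)
    also have "\<dots> = \<omega> * ((norm y0)\<^sup>2 + (norm y1)\<^sup>2)"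
      unfolding y0_def y1_def P_pythagoras[symmetric] by (simp add: power2_eq_square)
    finally have err: "\<bar>(J *v y) \<bullet> (\<i> *s (\<Omega> *v y))\<bar> \<le> \<omega> * ((norm y0)\<^sup>2 + (norm y1)\<^sup>2)" .
    have Ny: "N *v y = s *\<^sub>R y - \<i> *s (\<Omega> *v y) - \<beta> *\<^sub>R (B *v y)"
    proof -
      have "(- \<i>) *s (A \<beta> *v y) = - (\<i> *s (\<Omega> *v y)) + ((- \<i>) * - (\<i> * complex_of_real \<beta>)) *s (B *v y)"
        unfolding A_mat_mult by (simp add: vec.scale_right_diff_distrib vec.scale_scale vec.scale_left_diff_distrib)
      also have "(- \<i>) * - (\<i> * complex_of_real \<beta>) = complex_of_real (- \<beta>)" by simp
      finally show ?thesis unfolding N by (simp add: of_real_vector_smult del: of_real_minus)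
    qed
    have "y \<bullet> (J *v (N *v y)) = (J *v y) \<bullet> (N *v y)" by (simp add: selfadjD[OF selfJ])
    also have "\<dots> = s * (y \<bullet> (J *v y)) - (J *v y) \<bullet> (\<i> *s (\<Omega> *v y)) - \<beta> * ((J *v y) \<bullet> (B *v y))"
      by (simp add: Ny inner_diff_right selfadjD[OF selfJ])
    also have "(J *v y) \<bullet> (B *v y) = - (y1 \<bullet> (B *v y))"
      using y0B by (simp add: Jy inner_diff_left)
    also have "y \<bullet> (J *v y) = \<epsilon>\<^sup>2 * (norm y0)\<^sup>2 - (norm y1)\<^sup>2" by (simp add: Jx y0_def y1_def)
    finally have eq: "y \<bullet> (J *v (N *v y)) = s * (\<epsilon>\<^sup>2 * (norm y0)\<^sup>2 - (norm y1)\<^sup>2)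
        - (J *v y) \<bullet> (\<i> *s (\<Omega> *v y)) + \<beta> * (y1 \<bullet> (B *v y))" by simp
    \<comment> \<open>The sign change of \<open>J\<close> on the damped component makes dissipation
      help: it contributes at least \<open>2 * s\<close> times the square of \<open>norm y1\<close>,
      which outweighs the \<open>- s\<close> from the shift.\<close>
    have "\<beta> * (b * (norm y1)\<^sup>2) \<le> \<beta> * (y1 \<bullet> (B *v y))" using By \<beta> by simp
    then have "s * \<epsilon>\<^sup>2 * (norm y0)\<^sup>2 + s * (norm y1)\<^sup>2 - \<omega> * ((norm y0)\<^sup>2 + (norm y1)\<^sup>2) \<le> y \<bullet> (J *v (N *v y))"
      unfolding eq using err by (simp add: s_def algebra_simps)
    moreover have "0 < (s * \<epsilon>\<^sup>2 - \<omega>) * (norm y0)\<^sup>2 + (s - \<omega>) * (norm y1)\<^sup>2"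
    proof (cases "y0 = 0")
      case True
      then have "y1 \<noteq> 0" using that y by auto
      then show ?thesis using s True by simp
    next
      case False
      then have "0 < (s * \<epsilon>\<^sup>2 - \<omega>) * (norm y0)\<^sup>2" using s by (simp add: mult.commute)
      moreover have "0 \<le> (s - \<omega>) * (norm y1)\<^sup>2" using s by simp
      ultimately show ?thesis by linarith
    qed
    ultimately show ?thesis by (simp add: algebra_simps)
  qed
  have NU: "invariant_subspace N U"
    unfolding invariant_subspace_def N of_real_vector_smult[symmetric]
    using U unfolding invariant_subspace_def by (blast intro: vec.subspace_add vec.subspace_scale)
  have Npev: "N *v y = pev [:complex_of_real s, - \<i>:] (A \<beta>) y" for y
    by (simp only: N pev_pCons pev_0 matrix_vector_mult_0_right add_0_left add_0_right vector_scalar_commute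
        of_real_vector_smult add.commute)
  { assume sp: "\<And>\<zeta>. \<zeta> \<in> spectrum_on (A \<beta>) U \<Longrightarrow> - Im \<zeta> \<le> \<omega>"
    have "0 < x \<bullet> (J *v x)"
    proof (rule lyapunov_positive[OF NU selfJ _ _ x])
      fix z assume "z \<in> spectrum_on N U"
      then obtain \<zeta> where "\<zeta> \<in> spectrum_on (A \<beta>) U" "z = poly [:complex_of_real s, - \<i>:] \<zeta>"
        using spectral_mapping_subset[OF U Npev] by blast
      then show "0 < Re z" using sp[of \<zeta>] s by simp
    qed (use pos in auto)
    then have "(norm (x - P *v x))\<^sup>2 < (\<epsilon> * norm (P *v x))\<^sup>2" by (simp add: Jx power_mult_distrib)
    then show "norm (x - P *v x) < \<epsilon> * norm (P *v x)"
      by (rule power2_less_imp_less) (use \<epsilon> in simp) }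
  { assume sp: "\<And>\<zeta>. \<zeta> \<in> spectrum_on (A \<beta>) U \<Longrightarrow> \<beta> * b - \<omega> \<le> - Im \<zeta>"
    have "x \<bullet> (J *v x) < 0"
    proof (rule lyapunov_negative[OF NU selfJ _ _ x])
      fix z assume "z \<in> spectrum_on N U"
      then obtain \<zeta> where "\<zeta> \<in> spectrum_on (A \<beta>) U" "z = poly [:complex_of_real s, - \<i>:] \<zeta>"
        using spectral_mapping_subset[OF U Npev] by blast
      then show "Re z < 0" using sp[of \<zeta>] s by (simp add: s_def)
    qed (use pos in auto)
    then have "\<epsilon>\<^sup>2 * (norm (P *v x))\<^sup>2 < (norm (x - P *v x))\<^sup>2" by (simp add: Jx)
    moreover have "0 \<le> \<epsilon>\<^sup>2 * (norm (P *v x))\<^sup>2" by simp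
    ultimately have "0 < (norm (x - P *v x))\<^sup>2" by linarith
    then show "x \<noteq> P *v x" by auto }
qed

end

section \<open>Separating the low-loss eigenvalues near 0 from the other low-loss ones\<close>

context dissipative
begin

text \<open>Not the real matrix \<open>R\<close> of the system, which enters only with
  \<open>lossy_system\<close>.\<close>

abbreviation "R \<equiv> orth_proj (range ((*v) C))"

lemma subspace_range_C: "vec.subspace (range ((*v) C))"
  by (rule vec.subspace_image) simp

lemma R_in: "R *v x \<in> range ((*v) C)" by (rule orth_proj_in[OF subspace_range_C])

lemma R_orthogonal: "(C *v y) \<bullet> (x - R *v x) = 0"
  by (rule orth_proj_orthogonal[OF subspace_range_C]) simp

lemma range_C_subset: "range ((*v) C) \<subseteq> ker B" using C_in by auto

lemma P_R [simp]: "P *v (R *v x) = R *v x"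
  using R_in range_C_subset by (intro P_id) blast

lemma R_P [simp]: "R *v (P *v x) = R *v x"
proof (rule orth_proj_unique[OF subspace_range_C R_in])
  fix y assume y: "y \<in> range ((*v) C)"
  then have "y \<bullet> (R *v x) = y \<bullet> x" by (rule orth_proj_inner[OF subspace_range_C])
  moreover have "y \<bullet> (P *v x) = y \<bullet> x"
    using Q_orthogonal[of y x] y range_C_subset by (auto simp: inner_diff_right)
  ultimately show "y \<bullet> (P *v x - R *v x) = 0" by (simp add: inner_diff_right)
qed

lemma C_compl_R [simp]: "C *v (x - R *v x) = 0"
proof -
  have "(C *v (x - R *v x)) \<bullet> (C *v (x - R *v x)) = (C *v (C *v (x - R *v x))) \<bullet> (x - R *v x)"
    by (simp only: selfadjD[OF selfadj_C])
  also have "\<dots> = 0" by (rule R_orthogonal)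
  finally show ?thesis by simp
qed

text \<open>On an invariant subspace close to \<open>ker B\<close>, the form \<open>\<bar>R x\<bar>\<^sup>2 - \<bar>P x - R x\<bar>\<^sup>2\<close> is a Lyapunov
  function for \<open>A\<^sup>2 - r\<^sup>2 / 4\<close>.\<close>

lemma zero_nonzero_form:
  assumes C: "C \<noteq> 0" and \<epsilon>: "0 < \<epsilon>" "\<epsilon> \<le> 1" "3 * \<omega>\<^sup>2 * \<epsilon> < r\<^sup>2 / 4"
    and U: "invariant_subspace (A \<beta>) U"
    and near: "\<And>x. x \<in> U \<Longrightarrow> norm (x - P *v x) \<le> \<epsilon> * norm (P *v x)"
    and x: "x \<in> U" "x \<noteq> 0"
  shows nonzero_form: "(\<And>\<zeta>. \<zeta> \<in> spectrum_on (A \<beta>) U \<Longrightarrow> r\<^sup>2 / 4 < Re (\<zeta>\<^sup>2)) \<Longrightarrow> R *v x \<noteq> 0"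
    and zero_form: "(\<And>\<zeta>. \<zeta> \<in> spectrum_on (A \<beta>) U \<Longrightarrow> Re (\<zeta>\<^sup>2) < r\<^sup>2 / 4) \<Longrightarrow> P *v x \<noteq> R *v x"
proof -
  \<comment> \<open>The square of the threshold \<open>r / 2\<close> that separates eigenvalues near
    0 from those near the nonzero eigenvalues of \<open>C\<close>.\<close>
  define \<kappa> where "\<kappa> = r\<^sup>2 / 4"
  have \<kappa>: "0 < \<kappa>" using r_pos[OF C] by (simp add: \<kappa>_def)
  define J where "J = R + R - P"
  define N where "N = A \<beta> ** A \<beta> - mat (complex_of_real \<kappa>)"
  have J: "J *v y = R *v y + R *v y - P *v y" for y
    by (simp only: J_def matrix_vector_mult_diff_rdistrib matrix_vector_mult_add_rdistrib)
  have N: "N *v y = A \<beta> *v (A \<beta> *v y) - \<kappa> *\<^sub>R y" for y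
    by (simp add: N_def matrix_vector_mult_diff_rdistrib mat_mult_vec of_real_vector_smult matrix_vector_mul_assoc)
  have selfJ: "selfadj J"
    unfolding selfadj_def
    by (intro allI) (simp only: J inner_diff_left inner_diff_right inner_add_left inner_add_right selfadjD[OF selfadj_P]
        selfadjD[OF selfadj_orth_proj[OF subspace_range_C]])
  have x0: "P *v y \<noteq> 0" if "y \<in> U" "y \<noteq> 0" for y
    using near[OF that(1)] that(2) by auto
  have pos: "0 < y \<bullet> (J *v (N *v y))" if y: "y \<in> U" "y \<noteq> 0" for y
  proof -
    define y0 u k where "y0 = P *v y" and "u = R *v y" and "k = P *v y - R *v y"
    have y0: "y0 = u + k" by (simp add: y0_def u_def k_def)
    have Ck: "C *v k = 0" using C_compl_R[of "P *v y"] by (simp add: k_def)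
    have Cy: "C *v y = C *v u" using C_P[of y] Ck by (simp add: y0_def[symmetric] y0 matrix_vector_right_distrib del: C_P)
    have uC: "u \<in> range ((*v) C)" by (simp add: u_def R_in)
    have orth: "z \<bullet> k = 0" if "z \<in> range ((*v) C)" for z
      using R_orthogonal[of _ "P *v y"] that by (auto simp: k_def)
    have uk: "u \<bullet> k = 0" "k \<bullet> u = 0" using orth[OF uC] by (simp_all add: inner_commute)
    have kCC: "k \<bullet> (C *v (C *v u)) = 0" using orth[of "C *v (C *v u)"] by (simp add: inner_commute)
    have norm0: "(norm y0)\<^sup>2 = (norm u)\<^sup>2 + (norm k)\<^sup>2"
      unfolding y0 by (rule norm_add_Pythagorean) (simp add: orthogonal_def uk)
    have Jy: "J *v y = u + (- k)" by (simp add: J u_def k_def)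
    have "(norm (u + (- k)))\<^sup>2 = (norm u)\<^sup>2 + (norm (- k))\<^sup>2"
      by (rule norm_add_Pythagorean) (simp add: orthogonal_def uk)
    then have "(norm (J *v y))\<^sup>2 = (norm y0)\<^sup>2" by (simp add: Jy norm0)
    then have normJ: "norm (J *v y) = norm y0" by simp
    have rCu: "r * norm u \<le> norm (C *v u)"
    proof (rule selfadj_norm_ge[OF selfadj_C])
      fix z assume "z \<in> ker C"
      then show "z \<bullet> u = 0" using uC selfadj_range_iff[OF selfadj_C] by blast
    qed (use r_pos[OF C] r_le[OF C] in auto)
    define z where "z = A \<beta> *v y"
    have zU: "z \<in> U" using y U by (simp add: z_def invariant_subspace_def)
    \<comment> \<open>Since \<open>P A = C P + P \<Omega> (1 - P)\<close>, these are the errors of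
      replacing \<open>A\<close> by \<open>C\<close> in its first and in its second
      application.\<close>
    define e1 e2 where "e1 = P *v (\<Omega> *v (y - P *v y))" and "e2 = P *v (\<Omega> *v (z - P *v z))"
    have Pz: "P *v z = C *v u + e1" unfolding z_def P_A Cy by (simp add: e1_def)
    have e1: "norm e1 \<le> \<omega> * (\<epsilon> * norm y0)"
      unfolding e1_def y0_def using norm_P_le norm_\<Omega>_le[of "y - P *v y"] mult_left_mono[OF near[OF y(1)] \<omega>_nonneg]
      by (meson order_trans)
    have e2: "norm e2 \<le> \<omega> * (\<epsilon> * norm (P *v z))"
      unfolding e2_def using norm_P_le norm_\<Omega>_le[of "z - P *v z"] mult_left_mono[OF near[OF zU] \<omega>_nonneg]
      by (meson order_trans)
    have "norm (P *v z) \<le> norm (C *v u) + norm e1" unfolding Pz by (rule norm_triangle_ineq)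
    also have "norm (C *v u) \<le> \<omega> * norm y0" using norm_C_le[of y] by (simp add: Cy y0_def)
    also have "norm e1 \<le> \<omega> * norm y0"
    proof -
      have "\<epsilon> * norm y0 \<le> 1 * norm y0" using \<epsilon> by (intro mult_right_mono) auto
      then show ?thesis using e1 mult_left_mono[of "\<epsilon> * norm y0" "norm y0" \<omega>] \<omega>_nonneg by simp
    qed
    finally have normPz: "norm (P *v z) \<le> 2 * \<omega> * norm y0" by simp
    define e where "e = C *v e1 + e2"
    have PAA: "P *v (A \<beta> *v (A \<beta> *v y)) = C *v (C *v u) + e"
    proof -
      have "P *v (A \<beta> *v z) = C *v (P *v z) + e2" by (simp add: P_A e2_def)
      then show ?thesis by (simp add: z_def[symmetric] Pz e_def matrix_vector_right_distrib del: C_P)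
    qed
    have "norm e \<le> norm (C *v e1) + norm e2" unfolding e_def by (rule norm_triangle_ineq)
    also have "norm (C *v e1) \<le> \<omega> * (\<omega> * (\<epsilon> * norm y0))"
      using norm_C_le'[of e1] mult_left_mono[OF e1 \<omega>_nonneg] by linarith
    also have "norm e2 \<le> \<omega> * (\<epsilon> * (2 * \<omega> * norm y0))"
      using e2 mult_left_mono[OF mult_left_mono[OF normPz, of \<epsilon>] \<omega>_nonneg] \<epsilon> by simp
    \<comment> \<open>The factor 3 collects one part from \<open>C e1\<close> and two from
      \<open>e2\<close>, where \<open>P z\<close> has norm at most
      \<open>2 * \<omega> * norm y0\<close>.\<close>
    finally have norme: "norm e \<le> 3 * \<omega>\<^sup>2 * \<epsilon> * norm y0" by (simp add: power2_eq_square algebra_simps)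
    have PJ: "P *v (J *v y) = J *v y"
      by (simp only: J matrix_vector_mult_diff_distrib matrix_vector_right_distrib P_R P_id[OF P_in])
    have "y \<bullet> (J *v (N *v y)) = (J *v y) \<bullet> (N *v y)" by (simp add: selfadjD[OF selfJ])
    also have "\<dots> = (P *v (J *v y)) \<bullet> (N *v y)" by (simp only: PJ)
    also have "\<dots> = (J *v y) \<bullet> (P *v (N *v y))" by (simp add: selfadjD[OF selfadj_P])
    also have "P *v (N *v y) = C *v (C *v u) + e - \<kappa> *\<^sub>R y0"
      by (simp add: N matrix_vector_mult_diff_distrib PAA y0_def linear_scale[OF linear_matrix_vector_mult])
    also have "(J *v y) \<bullet> (C *v (C *v u) + e - \<kappa> *\<^sub>R y0)
        = u \<bullet> (C *v (C *v u)) - \<kappa> * (norm u)\<^sup>2 + \<kappa> * (norm k)\<^sup>2 + (J *v y) \<bullet> e"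
      by (simp add: Jy y0 inner_add_left inner_add_right inner_diff_left inner_diff_right uk kCC dot_square_norm algebra_simps)
    also have "u \<bullet> (C *v (C *v u)) = (norm (C *v u))\<^sup>2"
      using selfadjD[OF selfadj_C, of u "C *v u"] by (simp add: dot_square_norm)
    finally have eq: "y \<bullet> (J *v (N *v y)) = (norm (C *v u))\<^sup>2 - \<kappa> * (norm u)\<^sup>2 + \<kappa> * (norm k)\<^sup>2 + (J *v y) \<bullet> e" .
    have "(r * norm u)\<^sup>2 \<le> (norm (C *v u))\<^sup>2" using rCu r_pos[OF C] by (intro power_mono) auto
    \<comment> \<open>Here \<open>r\<^sup>2 = 4 * \<kappa>\<close>, of which half suffices: the main
      terms then leave at least \<open>\<kappa> * (norm y0)\<^sup>2\<close>, and the error is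
      strictly smaller.\<close>
    then have 1: "2 * \<kappa> * (norm u)\<^sup>2 \<le> (norm (C *v u))\<^sup>2"
      by (simp add: \<kappa>_def power_mult_distrib) (smt (verit) mult_nonneg_nonneg zero_le_power2)
    have "\<bar>(J *v y) \<bullet> e\<bar> \<le> norm y0 * (3 * \<omega>\<^sup>2 * \<epsilon> * norm y0)"
      using Cauchy_Schwarz_ineq2[of "J *v y" e] mult_left_mono[OF norme, of "norm y0"] by (simp add: normJ)
    also have "\<dots> = 3 * \<omega>\<^sup>2 * \<epsilon> * (norm y0)\<^sup>2" by (simp add: power2_eq_square)
    also have "\<dots> < \<kappa> * (norm y0)\<^sup>2"
      using x0[OF y] \<epsilon>(3) by (intro mult_strict_right_mono) (auto simp: \<kappa>_def y0_def)
    finally show ?thesis unfolding eq norm0 using 1 by (simp add: algebra_simps)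
  qed
  have NU: "invariant_subspace N U"
    unfolding invariant_subspace_def N of_real_vector_smult[symmetric]
    using U unfolding invariant_subspace_def by (blast intro: vec.subspace_diff vec.subspace_scale)
  have Npev: "N *v y = pev [:- complex_of_real \<kappa>, 0, 1:] (A \<beta>) y" for y
    by (simp add: N of_real_vector_smult)
  have Jy: "y \<bullet> (J *v y) = 2 * (y \<bullet> (R *v y)) - y \<bullet> (P *v y)" for y
    unfolding J inner_diff_right inner_add_right by simp
  have yP: "y \<bullet> (P *v y) = (norm (P *v y))\<^sup>2" for y
    using Q_orthogonal[OF P_in, of y y] by (simp add: inner_diff_right dot_square_norm inner_commute)
  { assume sp: "\<And>\<zeta>. \<zeta> \<in> spectrum_on (A \<beta>) U \<Longrightarrow> r\<^sup>2 / 4 < Re (\<zeta>\<^sup>2)"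
    have "0 < x \<bullet> (J *v x)"
    proof (rule lyapunov_positive[OF NU selfJ pos _ x])
      fix z assume "z \<in> spectrum_on N U"
      then obtain \<zeta> where "\<zeta> \<in> spectrum_on (A \<beta>) U" "z = poly [:- complex_of_real \<kappa>, 0, 1:] \<zeta>"
        using spectral_mapping_subset[OF U Npev] by blast
      then show "0 < Re z" using sp[of \<zeta>] by (simp add: \<kappa>_def power2_eq_square)
    qed
    then show "R *v x \<noteq> 0" unfolding Jy yP by auto }
  { assume sp: "\<And>\<zeta>. \<zeta> \<in> spectrum_on (A \<beta>) U \<Longrightarrow> Re (\<zeta>\<^sup>2) < r\<^sup>2 / 4"
    have "x \<bullet> (J *v x) < 0"
    proof (rule lyapunov_negative[OF NU selfJ pos _ x])
      fix z assume "z \<in> spectrum_on N U"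
      then obtain \<zeta> where "\<zeta> \<in> spectrum_on (A \<beta>) U" "z = poly [:- complex_of_real \<kappa>, 0, 1:] \<zeta>"
        using spectral_mapping_subset[OF U Npev] by blast
      then show "Re z < 0" using sp[of \<zeta>] by (simp add: \<kappa>_def power2_eq_square)
    qed
    then have neg: "2 * (x \<bullet> (R *v x)) < (norm (P *v x))\<^sup>2" by (simp add: Jy yP)
    show "P *v x \<noteq> R *v x"
    proof
      assume eq: "P *v x = R *v x"
      show False using neg yP[of x] x0[OF x] by (simp add: eq)
    qed }
qed

abbreviation "NR \<equiv> vec.dim (range ((*v) B))"

section \<open>Multiplicities of the nonzero eigenvalues of B\<close>

text \<open>Eigenspaces of a Hermitian matrix for different eigenvalues are orthogonal, hence
  independent. Together with \<open>span_eigenspaces\<close> this counts the entries of the list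
  behind \<open>b_eig\<close>.\<close>

lemma dim_eigenspaces:
  assumes "finite F"
  shows "vec.dim (vec.span (\<Union>\<mu>\<in>F. {v. B *v v = complex_of_real \<mu> *s v}))
    = (\<Sum>\<mu>\<in>F. vec.dim {v. B *v v = complex_of_real \<mu> *s v})"
  using assms
proof (induction F rule: finite_induct)
  case (insert \<nu> F)
  define E where "E \<mu> = {v. B *v v = complex_of_real \<mu> *s v}" for \<mu>
  define X where "X = (\<Union>\<mu>\<in>F. E \<mu>)"
  have E: "vec.subspace (E \<mu>)" for \<mu>
    unfolding E_def by (rule vec.subspaceI)
      (auto simp: matrix_vector_right_distrib vec.scale_right_distrib vector_scalar_commute vec.scale_scale mult.commute)
  have "vec.span X \<subseteq> {w. \<forall>u\<in>E \<nu>. u \<bullet> w = 0}"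
  proof
    fix w assume "w \<in> vec.span X"
    then show "w \<in> {w. \<forall>u\<in>E \<nu>. u \<bullet> w = 0}"
    proof (induction rule: vec.span_induct_alt)
      case base
      then show ?case by simp
    next
      case (step c v y)
      then obtain \<mu> where \<mu>: "\<mu> \<in> F" "B *v v = complex_of_real \<mu> *s v" by (auto simp: X_def E_def)
      have "u \<bullet> (c *s v) = 0" if u: "u \<in> E \<nu>" for u
      proof -
        define u' where "u' = cnj c *s u"
        have "u' \<in> E \<nu>" using vec.subspace_scale[OF E u] by (simp add: u'_def)
        then have "B *v u' = \<nu> *\<^sub>R u'" by (simp add: E_def of_real_vector_smult)
        then have "\<nu> * (u' \<bullet> v) = \<mu> * (u' \<bullet> v)"
          using selfadjD[OF selfadj_B, of u' v] \<mu>(2) by (simp add: of_real_vector_smult)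
        then have "u' \<bullet> v = 0" using \<mu>(1) insert.hyps(2) by auto
        then show ?thesis by (simp add: u'_def cscale_component_inner)
      qed
      then show ?case using step by (simp add: inner_add_right)
    qed
  qed
  then have "E \<nu> \<inter> vec.span X = {0}"
    using E[of \<nu>] vec.subspace_0 vec.span_zero by fastforce
  then have "direct_sum (vec.span (E \<nu> \<union> X)) (E \<nu>) (vec.span X)"
    using E by (simp add: direct_sum_def vec.span_Un vec.span_eq_iff[THEN iffD2])
  then have "vec.dim (vec.span (E \<nu> \<union> X)) = vec.dim (E \<nu>) + vec.dim (vec.span X)"
    by (rule dim_direct_sum[OF _ E vec.subspace_span])
  moreover have "(\<Union>\<mu>\<in>insert \<nu> F. E \<mu>) = E \<nu> \<union> X" by (simp add: X_def)
  ultimately show ?case using insert unfolding E_def X_def by simp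
qed simp

lemma span_eigenspaces:
  "vec.span (\<Union>\<mu>\<in>nonzero_eigvals B. {v. B *v v = complex_of_real \<mu> *s v}) = range ((*v) B)"
  (is "vec.span ?X = _")
proof
  show "vec.span ?X \<subseteq> range ((*v) B)"
  proof (rule vec.span_minimal)
    show "vec.subspace (range ((*v) B))" by (rule vec.subspace_image) simp
    show "?X \<subseteq> range ((*v) B)"
    proof
      fix v assume "v \<in> ?X"
      then obtain \<mu> where \<mu>: "\<mu> \<noteq> 0" "B *v v = complex_of_real \<mu> *s v" by (auto simp: nonzero_eigvals_def)
      then have "v = B *v (inverse (complex_of_real \<mu>) *s v)" by (simp add: vector_scalar_commute vec.scale_scale)
      then show "v \<in> range ((*v) B)" by blast
    qed
  qed
  show "range ((*v) B) \<subseteq> vec.span ?X"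
  proof
    fix y assume "y \<in> range ((*v) B)"
    then obtain x where x: "y = B *v x" by blast
    obtain E \<mu> where "eigenbasis ((*v) B) E \<mu>" using selfadj_eigenbasis[OF selfadj_B] by blast
    then interpret eigenbasis "(*v) B" E \<mu> .
    have "y = (\<Sum>e\<in>E. complex_of_real (\<mu> e * (x \<bullet> e)) *s e)"
      using expand[of y] by (simp add: x image_component of_real_vector_smult del: of_real_mult)
    also have "\<dots> \<in> vec.span ?X"
    proof (intro vec.span_sum)
      fix e assume e: "e \<in> E"
      show "complex_of_real (\<mu> e * (x \<bullet> e)) *s e \<in> vec.span ?X"
      proof (cases "\<mu> e = 0")
        case False
        then have "\<mu> e \<in> nonzero_eigvals B"
          using eigen[OF e] nonzero[OF e] by (auto simp: nonzero_eigvals_def spectrum_iff of_real_vector_smult)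
        then have "e \<in> ?X" using eigen[OF e] by (auto simp: of_real_vector_smult)
        then show ?thesis by (intro vec.span_scale vec.span_base)
      qed (simp add: vec.span_zero)
    qed
    finally show "y \<in> vec.span ?X" .
  qed
qed

text \<open>The list behind \<open>b_eig\<close> has length \<open>NR\<close>, so the indices from 1
  to \<open>NR\<close> reach every nonzero eigenvalue and never run past its end, where
  \<open>!\<close> is unspecified.\<close>

lemma b_eig_image: "b_eig B ` {1..NR} = nonzero_eigvals B"
proof -
  define m where "m x = vec.dim {v. B *v v = complex_of_real x *s v}" for x
  define xs where "xs = concat (map (\<lambda>x. replicate (m x) x) (sorted_list_of_set (nonzero_eigvals B)))"
  have "length xs = sum_list (map m (sorted_list_of_set (nonzero_eigvals B)))"
    by (simp add: xs_def length_concat comp_def)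
  also have "\<dots> = sum m (nonzero_eigvals B)"
    by (subst sum_list_distinct_conv_sum_set) (simp_all add: finite_nonzero_eigvals)
  also have "\<dots> = NR"
    using dim_eigenspaces[OF finite_nonzero_eigvals] unfolding span_eigenspaces m_def by simp
  finally have len: "length xs = NR" .
  have "m x \<noteq> 0" if x: "x \<in> nonzero_eigvals B" for x
  proof -
    obtain v where "v \<noteq> 0" "B *v v = complex_of_real x *s v" using x by (auto simp: nonzero_eigvals_def spectrum_iff)
    then have "\<not> {v. B *v v = complex_of_real x *s v} \<subseteq> {0}" by blast
    then show ?thesis unfolding m_def vec.dim_eq_0 by blast
  qed
  then have set: "set xs = nonzero_eigvals B"
    using finite_nonzero_eigvals by (auto simp: xs_def)
  have "b_eig B ` {1..NR} = (\<lambda>j. xs ! (j - 1)) ` {1..NR}"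
    by (rule image_cong) (auto simp: b_eig_def xs_def m_def)
  also have "\<dots> = (\<lambda>i. xs ! i) ` {..<NR}"
  proof -
    have "{1..NR} = Suc ` {..<NR}" by (auto simp: image_iff) (metis Suc_pred' less_Suc_eq_le lessThan_iff not_less_eq_eq Suc_le_eq diff_Suc_1 gr0_implies_Suc)
    then show ?thesis by (simp add: image_image)
  qed
  also have "\<dots> = set xs" unfolding set_conv_nth len by auto
  finally show ?thesis by (simp add: set)
qed

lemma sigma0_eq: "sigma0 \<Omega> B \<beta> = {\<zeta> \<in> spectrum (A \<beta>). cmod \<zeta> \<le> \<omega>}"
  by (auto simp: sigma0_def disc_def b_eig_def)

lemma sigma1_eq: "sigma1 NR \<Omega> B \<beta> =
    {\<zeta> \<in> spectrum (A \<beta>). \<exists>\<mu>\<in>nonzero_eigvals B. cmod (\<zeta> + \<i> * complex_of_real (\<beta> * \<mu>)) \<le> \<omega>}"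
proof -
  have "\<zeta> \<in> disc \<Omega> B \<beta> j \<longleftrightarrow> cmod (\<zeta> + \<i> * complex_of_real (\<beta> * b_eig B j)) \<le> \<omega>" for \<zeta> j
  proof -
    have "- \<i> * complex_of_real (\<beta> * b_eig B j) - \<zeta> = - (\<zeta> + \<i> * complex_of_real (\<beta> * b_eig B j))" by simp
    then show ?thesis unfolding disc_def mem_cball dist_norm by (simp only: norm_minus_cancel)
  qed
  then show ?thesis
    unfolding sigma1_def b_eig_image[symmetric] by auto
qed

section \<open>The spectral subspaces for large damping\<close>

text \<open>The first conditions separate the two bands, even after the low one is widened by
  \<open>c \<beta>\<close>. With \<open>c \<beta> < r / 10\<close> the eigenvalues near 0 stay below
  \<open>r / 2\<close> in modulus, while the other low-loss ones have real part above
  \<open>9 / 10 * r\<close> and imaginary part below \<open>r / 10\<close> in modulus, so squaring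
  separates them at \<open>r\<^sup>2 / 4\<close>. The last condition is that of
  \<open>low_form\<close> for \<open>\<epsilon> = r\<^sup>2 / (16 * \<omega>\<^sup>2)\<close>, a
  value with \<open>3 * \<omega>\<^sup>2 * \<epsilon> < r\<^sup>2 / 4\<close>.\<close>

definition good :: "real \<Rightarrow> bool" where
  "good \<beta> \<longleftrightarrow> 0 < \<beta> \<and> 2 * \<omega> < \<beta> * b \<and> c \<beta> < \<beta> * b - 2 * \<omega> \<and>
     (C \<noteq> 0 \<longrightarrow> c \<beta> < r / 10 \<and> \<omega> < (r\<^sup>2 / (16 * \<omega>\<^sup>2))\<^sup>2 * (\<beta> * b / 2))"

lemma c_eq: "2 * \<omega> < \<beta> * b \<Longrightarrow> c \<beta> = 2 * (\<omega>\<^sup>2 / (\<beta> * b - 2 * \<omega>))"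
  using b_pos by (simp add: c_bound_def field_simps)

lemma c_tendsto: "(c \<longlongrightarrow> 0) at_top"
proof -
  have "filterlim (\<lambda>\<beta>. - (2 * \<omega> / b) + \<beta>) at_top at_top"
    by (rule filterlim_tendsto_add_at_top[OF tendsto_const filterlim_ident])
  then have "((\<lambda>\<beta>. inverse (- (2 * \<omega> / b) + \<beta>)) \<longlongrightarrow> 0) at_top"
    by (rule tendsto_inverse_0_at_top)
  from tendsto_mult[OF tendsto_const[of "2 * \<omega>\<^sup>2 / b"] this] show ?thesis
    by (simp add: c_bound_def[abs_def])
qed

lemma c_antimono: "antimono_on {2 * \<omega> / b<..} c"
proof (rule monotone_onI)
  fix x y :: real assume xy: "x \<in> {2 * \<omega> / b<..}" "y \<in> {2 * \<omega> / b<..}" "x \<le> y"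
  then have "inverse (y - 2 * \<omega> / b) \<le> inverse (x - 2 * \<omega> / b)" by (intro le_imp_inverse_le) auto
  then show "c y \<le> c x" unfolding c_bound_def using b_pos by (intro mult_left_mono) auto
qed

text \<open>\<open>C \<noteq> 0\<close> gives \<open>0 < r \<le> \<omega>\<close>; for
  \<open>\<omega> = 0\<close> the function \<open>c\<close> would be identically zero.\<close>

lemma c_strict:
  assumes "C \<noteq> 0"
  shows "monotone_on {2 * \<omega> / b<..} (<) (>) c"
proof (rule monotone_onI)
  fix x y :: real assume xy: "x \<in> {2 * \<omega> / b<..}" "y \<in> {2 * \<omega> / b<..}" "x < y"
  then have "inverse (y - 2 * \<omega> / b) < inverse (x - 2 * \<omega> / b)" by (intro less_imp_inverse_less) auto
  moreover have "0 < \<omega>" using r_pos[OF assms] r_le_\<omega>[OF assms] by simp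
  ultimately show "c y < c x" unfolding c_bound_def using b_pos by (intro mult_strict_left_mono) auto
qed

lemma eventually_good: "\<forall>\<^sub>F \<beta> in at_top. good \<beta>"
proof -
  have lim: "filterlim (\<lambda>\<beta>. k * \<beta>) at_top at_top" if "0 < k" for k :: real
    by (rule filterlim_tendsto_pos_mult_at_top[OF tendsto_const that filterlim_ident])
  have ev: "\<forall>\<^sub>F \<beta> in at_top. m < k * \<beta>" if "0 < k" for k m :: real
    using lim[OF that] unfolding filterlim_at_top_dense by blast
  have c1: "\<forall>\<^sub>F \<beta> in at_top. c \<beta> < 1" by (rule order_tendstoD(2)[OF c_tendsto]) simp
  have 1: "\<forall>\<^sub>F \<beta> in at_top. C \<noteq> 0 \<longrightarrow> c \<beta> < r / 10 \<and> \<omega> < (r\<^sup>2 / (16 * \<omega>\<^sup>2))\<^sup>2 * (\<beta> * b / 2)"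
  proof (cases "C = 0")
    case False
    have "0 < \<omega>" using r_pos[OF False] r_le_\<omega>[OF False] by simp
    then have "0 < (r\<^sup>2 / (16 * \<omega>\<^sup>2))\<^sup>2 * (b / 2)" using b_pos r_pos[OF False] by simp
    note ev1 = ev[OF this, of \<omega>]
    have "\<forall>\<^sub>F \<beta> in at_top. c \<beta> < r / 10"
      by (rule order_tendstoD(2)[OF c_tendsto]) (use r_pos[OF False] in simp)
    with ev1 show ?thesis
      by eventually_elim (simp add: mult.commute mult.left_commute)
  qed simp
  \<comment> \<open>\<open>c \<beta> < 1\<close> and \<open>2 * \<omega> + 1 < \<beta> * b\<close>
    together give the third condition.\<close>
  from 1 c1 ev[OF b_pos, of "2 * \<omega> + 1"] eventually_gt_at_top[of 0] show ?thesis
    by eventually_elim (auto simp: good_def mult.commute)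
qed

text \<open>These families exist for every \<open>\<beta>\<close> and have the asserted properties
  once \<open>\<beta>\<close> is \<open>good\<close>. Intersecting with \<open>Hll\<close> gives
  \<open>H0\<close> and \<open>H1\<close> the form delivered by
  \<open>unique_spectral_splitting_root_space\<close>.\<close>

definition "Hll \<beta> = root_space (A \<beta>) (sigma0 \<Omega> B \<beta>)"
definition "Hhl \<beta> = root_space (A \<beta>) (sigma1 NR \<Omega> B \<beta>)"
definition "Z0 \<beta> = spectrum (A \<beta>) \<inter> cball 0 (c \<beta>)"
definition "Z1 \<beta> = spectrum (A \<beta>) \<inter> (\<Union>\<rho>\<in>spectrum C - {0}. cball \<rho> (c \<beta>))"
definition "H0 \<beta> = Hll \<beta> \<inter> root_space (A \<beta>) (Z0 \<beta>)"
definition "H1 \<beta> = Hll \<beta> \<inter> root_space (A \<beta>) (Z1 \<beta>)"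

lemma dim_ker_range: "vec.dim (ker B) + NR = CARD('m)"
proof -
  have "{x \<in> UNIV. \<forall>y\<in>ker B. y \<bullet> x = 0} = range ((*v) B)" using selfadj_range_iff[OF selfadj_B] by blast
  then show ?thesis
    using dim_orthogonal_within[OF subspace_ker vec.subspace_UNIV, of B] by (simp add: card_cart_basis)
qed

lemma ker_C_eq: "{x \<in> ker B. \<forall>y\<in>range ((*v) C). y \<bullet> x = 0} = ker B \<inter> ker C"
proof -
  have "(\<forall>y\<in>range ((*v) C). y \<bullet> x = 0) \<longleftrightarrow> C *v x = 0" for x
  proof
    assume "\<forall>y\<in>range ((*v) C). y \<bullet> x = 0"
    then have "(C *v (C *v x)) \<bullet> x = 0" by blast
    then have "(C *v x) \<bullet> (C *v x) = 0" by (simp only: selfadjD[OF selfadj_C])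
    then show "C *v x = 0" by simp
  qed (auto simp: selfadjD[OF selfadj_C])
  then show ?thesis by (auto simp: ker_def)
qed

text \<open>\<open>ker B \<inter> ker C\<close> is the space into which \<open>P - R\<close> maps
  \<open>H0\<close>; inside \<open>ker B\<close> it is the orthogonal complement of the range of
  \<open>C\<close>.\<close>

lemma dim_ker_C: "vec.dim (ker B) = vec.dim (range ((*v) C)) + vec.dim (ker B \<inter> ker C)"
  using dim_orthogonal_within[OF subspace_range_C subspace_ker range_C_subset] unfolding ker_C_eq by simp

lemma finite_spectrum: "finite (spectrum (A \<beta>))" by (rule finite_spectrum_on) simp

lemma invariant_H: "invariant_subspace (A \<beta>) (Hll \<beta>)" "invariant_subspace (A \<beta>) (Hhl \<beta>)"
    "invariant_subspace (A \<beta>) (H0 \<beta>)" "invariant_subspace (A \<beta>) (H1 \<beta>)"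
  by (simp_all add: Hll_def Hhl_def H0_def H1_def invariant_root_space invariant_subspace_Int)

lemma NR_pos: "0 < NR"
proof (rule ccontr)
  assume "\<not> 0 < NR"
  then have "range ((*v) B) \<subseteq> {0}" by simp
  then have "B *v x = 0" for x by blast
  then show False using B_nonzero by (simp add: matrix_eq)
qed

lemma dim_ker_pos: "0 < vec.dim (ker B)"
proof (rule ccontr)
  assume "\<not> 0 < vec.dim (ker B)"
  then have "ker B \<subseteq> {0}" by simp
  then show False using ker_B_nonzero vec.subspace_0[OF subspace_ker, of B] by blast
qed

context
  fixes \<beta> :: real
  assumes good: "good \<beta>"
begin

lemma goodD: "0 < \<beta>" "2 * \<omega> < \<beta> * b" "c \<beta> < \<beta> * b - 2 * \<omega>"
  and goodD_C: "C \<noteq> 0 \<Longrightarrow> c \<beta> < r / 10" "C \<noteq> 0 \<Longrightarrow> \<omega> < (r\<^sup>2 / (16 * \<omega>\<^sup>2))\<^sup>2 * (\<beta> * b / 2)"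
  using good by (auto simp: good_def)

lemma c_nonneg: "0 \<le> c \<beta>"
  using goodD(2) by (simp add: c_eq)

lemma high_Im:
  assumes "\<mu> \<in> nonzero_eigvals B" "cmod (z + \<i> * complex_of_real (\<beta> * \<mu>)) \<le> \<omega>"
  shows "\<beta> * b - \<omega> \<le> - Im z" "\<bar>Re z\<bar> \<le> \<omega>"
proof -
  have "\<beta> * b \<le> \<beta> * \<mu>" using b_le[OF assms(1)] goodD by simp
  moreover have "\<bar>Im z + \<beta> * \<mu>\<bar> \<le> \<omega>"
    using abs_Im_le_cmod[of "z + \<i> * complex_of_real (\<beta> * \<mu>)"] assms(2) by simp
  ultimately show "\<beta> * b - \<omega> \<le> - Im z" by linarith
  show "\<bar>Re z\<bar> \<le> \<omega>"
    using abs_Re_le_cmod[of "z + \<i> * complex_of_real (\<beta> * \<mu>)"] assms(2) by simp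
qed

lemma spectrum_cases: "z \<in> spectrum (A \<beta>) \<Longrightarrow> z \<in> sigma0 \<Omega> B \<beta> \<or> z \<in> sigma1 NR \<Omega> B \<beta>"
  using spectrum_A_near[OF goodD(1), of z] by (auto simp: sigma0_eq sigma1_eq)

lemma sigma1D: "z \<in> sigma1 NR \<Omega> B \<beta> \<Longrightarrow> z \<in> spectrum (A \<beta>) \<and> \<beta> * b - \<omega> \<le> - Im z \<and> \<bar>Re z\<bar> \<le> \<omega>"
  using high_Im by (auto simp: sigma1_eq)

lemma sigma0D: "z \<in> sigma0 \<Omega> B \<beta> \<Longrightarrow> z \<in> spectrum (A \<beta>) \<and> 0 \<le> - Im z \<and> - Im z \<le> \<omega> \<and> cmod z \<le> \<omega>"
  using abs_Im_le_cmod[of z] spectrum_A_Im[of \<beta> z] goodD(1) by (auto simp: sigma0_eq)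

lemma sigma1_iff: "sigma1 NR \<Omega> B \<beta> = {z \<in> spectrum (A \<beta>). - Im z \<ge> \<beta> * b - \<omega>}"
proof (intro set_eqI iffI)
  fix z assume "z \<in> {z \<in> spectrum (A \<beta>). - Im z \<ge> \<beta> * b - \<omega>}"
  then show "z \<in> sigma1 NR \<Omega> B \<beta>" using spectrum_cases[of z] sigma0D[of z] goodD(2) by force
qed (use sigma1D in auto)

lemma sigma0_iff: "sigma0 \<Omega> B \<beta> = {z \<in> spectrum (A \<beta>). 0 \<le> - Im z \<and> - Im z \<le> \<omega>}"
proof (intro set_eqI iffI)
  fix z assume "z \<in> {z \<in> spectrum (A \<beta>). 0 \<le> - Im z \<and> - Im z \<le> \<omega>}"
  then show "z \<in> sigma0 \<Omega> B \<beta>" using spectrum_cases[of z] sigma1D[of z] goodD(2) by force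
qed (use sigma0D in auto)

lemma sigma_Un: "spectrum (A \<beta>) = sigma0 \<Omega> B \<beta> \<union> sigma1 NR \<Omega> B \<beta>"
  using spectrum_cases sigma0D sigma1D by blast

lemma sigma_Int: "sigma0 \<Omega> B \<beta> \<inter> sigma1 NR \<Omega> B \<beta> = {}"
  using sigma0D sigma1D goodD(2) by fastforce

lemma splitting_ll_hl:
  "unique_spectral_splitting (A \<beta>) UNIV (sigma0 \<Omega> B \<beta>) (sigma1 NR \<Omega> B \<beta>) (Hll \<beta>) (Hhl \<beta>)"
  using unique_spectral_splitting_root_space[OF invariant_subspace_UNIV sigma_Un sigma_Int]
  by (simp add: Hll_def Hhl_def)

lemma spectrum_on_ll: "spectrum_on (A \<beta>) (Hll \<beta>) = sigma0 \<Omega> B \<beta>"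
  and spectrum_on_hl: "spectrum_on (A \<beta>) (Hhl \<beta>) = sigma1 NR \<Omega> B \<beta>"
  and direct_sum_ll_hl: "direct_sum UNIV (Hll \<beta>) (Hhl \<beta>)"
  using splitting_ll_hl by (auto simp: unique_spectral_splitting_def spectral_splitting_def)

lemma dim_ll_hl: "vec.dim (Hll \<beta>) = vec.dim (ker B)" "vec.dim (Hhl \<beta>) = NR"
proof -
  \<comment> \<open>For this count \<open>\<epsilon> = 1\<close> is enough, which needs only
    \<open>2 * \<omega> < \<beta> * b\<close>.\<close>
  have \<epsilon>: "\<omega> < 1\<^sup>2 * (\<beta> * b / 2)" using goodD(2) by simp
  have "vec.dim (Hll \<beta>) \<le> vec.dim (ker B)"
  proof (rule dim_le_of_injective[of _ P])
    fix x assume x: "x \<in> Hll \<beta>" "P *v x = 0"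
    show "x = 0"
    proof (rule ccontr)
      assume "x \<noteq> 0"
      then have "norm (x - P *v x) < 1 * norm (P *v x)"
        using low_form[OF goodD(1) _ _ \<epsilon> invariant_H(1) x(1)] sigma0D by (auto simp: spectrum_on_ll)
      then show False using x by simp
    qed
  qed (use invariant_H in \<open>auto simp: invariant_subspace_def P_in\<close>)
  moreover have "vec.dim (Hhl \<beta>) \<le> NR"
  proof (rule dim_le_of_injective[of _ "mat 1 - P"])
    fix x
    have eq: "(mat 1 - P) *v x = x - P *v x" by (simp add: matrix_vector_mult_diff_rdistrib)
    show "(mat 1 - P) *v x \<in> range ((*v) B)"
      unfolding eq selfadj_range_iff[OF selfadj_B] using Q_orthogonal by blast
    assume x: "x \<in> Hhl \<beta>" "(mat 1 - P) *v x = 0"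
    show "x = 0"
    proof (rule ccontr)
      assume "x \<noteq> 0"
      then have "x \<noteq> P *v x"
        using high_form[OF goodD(1) _ _ \<epsilon> invariant_H(2) x(1)] sigma1D by (auto simp: spectrum_on_hl)
      then show False using x eq by simp
    qed
  qed (use invariant_H in \<open>auto simp: invariant_subspace_def\<close>)
  moreover have "vec.dim (Hll \<beta>) + vec.dim (Hhl \<beta>) = CARD('m)"
    using dim_direct_sum[OF direct_sum_ll_hl] invariant_H by (simp add: invariant_subspace_def card_cart_basis)
  ultimately show "vec.dim (Hll \<beta>) = vec.dim (ker B)" "vec.dim (Hhl \<beta>) = NR"
    using dim_ker_range by linarith+
qed

lemma low_near: "z \<in> sigma0 \<Omega> B \<beta> \<Longrightarrow> \<exists>\<rho>\<in>spectrum C. cmod (z - \<rho>) \<le> c \<beta>"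
proof -
  assume "z \<in> sigma0 \<Omega> B \<beta>"
  then obtain \<rho> where \<rho>: "\<rho> \<in> spectrum C" "cmod (z - \<rho>) \<le> \<omega>\<^sup>2 / (\<beta> * b - 2 * \<omega>)"
    using spectrum_A_low[OF goodD(1,2)] sigma0D by blast
  have "0 \<le> \<omega>\<^sup>2 / (\<beta> * b - 2 * \<omega>)" using goodD(2) by simp
  then have "\<omega>\<^sup>2 / (\<beta> * b - 2 * \<omega>) \<le> c \<beta>" unfolding c_eq[OF goodD(2)] by linarith
  then show ?thesis using \<rho> by force
qed

lemma nonzero_spectrum_C: "\<rho> \<in> spectrum C - {0} \<Longrightarrow> C \<noteq> 0"
  by (auto simp: spectrum_iff)

lemma Z1D:
  assumes "z \<in> Z1 \<beta>"
  shows "C \<noteq> 0" "r - c \<beta> \<le> \<bar>Re z\<bar>" "cmod z \<le> \<omega> + c \<beta>"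
proof -
  obtain \<rho> where \<rho>: "\<rho> \<in> spectrum C - {0}" "cmod (z - \<rho>) \<le> c \<beta>"
    using assms by (auto simp: Z1_def dist_norm norm_minus_commute)
  show C: "C \<noteq> 0" by (rule nonzero_spectrum_C[OF \<rho>(1)])
  have "\<bar>Re z - Re \<rho>\<bar> \<le> c \<beta>" using abs_Re_le_cmod[of "z - \<rho>"] \<rho>(2) by simp
  moreover have "r \<le> \<bar>Re \<rho>\<bar>" using r_le[OF C \<rho>(1)] spectrum_C_real \<rho>(1) by (auto simp: cmod_def)
  ultimately show "r - c \<beta> \<le> \<bar>Re z\<bar>" by linarith
  have "cmod \<rho> \<le> \<omega>" using spectrum_C_le \<rho>(1) by blast
  then show "cmod z \<le> \<omega> + c \<beta>" using \<rho>(2) norm_triangle_sub[of z \<rho>] by linarith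
qed

text \<open>The discs of radius \<open>c \<beta>\<close> may stick out of the disc of radius
  \<open>\<omega>\<close> around 0. Their points still have modulus at most
  \<open>\<omega> + c \<beta>\<close>, too small for the high-loss band, so an eigenvalue in them is
  a low-loss one.\<close>

lemma sigma0_eq_Z: "spectrum_on (A \<beta>) (Hll \<beta>) = Z0 \<beta> \<union> Z1 \<beta>"
proof (intro set_eqI iffI)
  fix z assume z: "z \<in> spectrum_on (A \<beta>) (Hll \<beta>)"
  then obtain \<rho> where \<rho>: "\<rho> \<in> spectrum C" "cmod (z - \<rho>) \<le> c \<beta>" using low_near by (auto simp: spectrum_on_ll)
  then show "z \<in> Z0 \<beta> \<union> Z1 \<beta>" using z sigma0D
    by (cases "\<rho> = 0") (auto simp: Z0_def Z1_def spectrum_on_ll dist_norm norm_minus_commute)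
next
  fix z assume z: "z \<in> Z0 \<beta> \<union> Z1 \<beta>"
  then have sp: "z \<in> spectrum (A \<beta>)" by (auto simp: Z0_def Z1_def)
  have "cmod z \<le> \<omega> + c \<beta>" using z Z1D(3) \<omega>_nonneg by (auto simp: Z0_def)
  then have "\<not> \<beta> * b - \<omega> \<le> - Im z" using abs_Im_le_cmod[of z] goodD(3) by linarith
  then show "z \<in> spectrum_on (A \<beta>) (Hll \<beta>)"
    using spectrum_cases[OF sp] sigma1D[of z] by (auto simp: spectrum_on_ll)
qed

lemma Z_Int: "Z0 \<beta> \<inter> Z1 \<beta> = {}"
proof -
  have False if "z \<in> Z0 \<beta>" "z \<in> Z1 \<beta>" for z
    using Z1D[OF that(2)] goodD_C(1) that(1) abs_Re_le_cmod[of z] r_pos by (auto simp: Z0_def)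
  then show ?thesis by blast
qed

lemma splitting_0_1: "unique_spectral_splitting (A \<beta>) (Hll \<beta>) (Z0 \<beta>) (Z1 \<beta>) (H0 \<beta>) (H1 \<beta>)"
  using unique_spectral_splitting_root_space[OF invariant_H(1) sigma0_eq_Z Z_Int] by (simp add: H0_def H1_def)

lemma spectrum_on_0: "spectrum_on (A \<beta>) (H0 \<beta>) = Z0 \<beta>"
  and spectrum_on_1: "spectrum_on (A \<beta>) (H1 \<beta>) = Z1 \<beta>"
  and direct_sum_0_1: "direct_sum (Hll \<beta>) (H0 \<beta>) (H1 \<beta>)"
  using splitting_0_1 by (auto simp: unique_spectral_splitting_def spectral_splitting_def)

lemma ZD: "z \<in> Z0 \<beta> \<union> Z1 \<beta> \<Longrightarrow> z \<in> spectrum (A \<beta>) \<and> 0 \<le> - Im z \<and> - Im z \<le> c \<beta> \<and> cmod z \<le> \<omega>"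
proof -
  assume z: "z \<in> Z0 \<beta> \<union> Z1 \<beta>"
  then have s: "z \<in> sigma0 \<Omega> B \<beta>" using sigma0_eq_Z spectrum_on_ll by simp
  then obtain \<rho> where \<rho>: "\<rho> \<in> spectrum C" "cmod (z - \<rho>) \<le> c \<beta>" using low_near by blast
  have "\<bar>Im z\<bar> \<le> c \<beta>" using abs_Im_le_cmod[of "z - \<rho>"] \<rho> spectrum_C_real[of \<rho>] by simp
  then show ?thesis using sigma0D[OF s] by simp
qed

lemma dim_sum_0_1: "vec.dim (H0 \<beta>) + vec.dim (H1 \<beta>) = vec.dim (ker B)"
  using dim_direct_sum[OF direct_sum_0_1] invariant_H dim_ll_hl by (simp add: invariant_subspace_def)

lemma dim_1: "vec.dim (H1 \<beta>) = vec.dim (range ((*v) C))"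
proof (cases "C = 0")
  case True
  then have "Z1 \<beta> = {}" using Z1D(1) by blast
  then have "H1 \<beta> = {0}" using spectrum_on_empty[OF invariant_H(4)] spectrum_on_1 by simp
  moreover have "range ((*v) C) = {0}" using True by auto
  ultimately show ?thesis by simp
next
  case C: False
  \<comment> \<open>Unlike in the count for \<open>Hll\<close>, injectivity of \<open>P\<close> is
    not enough: the low-loss space must be so close to \<open>ker B\<close> that the errors in
    \<open>zero_nonzero_form\<close> stay below \<open>r\<^sup>2 / 4\<close>.\<close>
  define \<epsilon> where "\<epsilon> = r\<^sup>2 / (16 * \<omega>\<^sup>2)"
  have r: "0 < r" "r \<le> \<omega>" using r_pos[OF C] r_le_\<omega>[OF C] by auto
  then have "r\<^sup>2 \<le> \<omega>\<^sup>2" by (intro power_mono) auto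
  then have "r\<^sup>2 \<le> 16 * \<omega>\<^sup>2" using zero_le_power2[of \<omega>] by linarith
  then have \<epsilon>: "0 < \<epsilon>" "\<epsilon> \<le> 1" "3 * \<omega>\<^sup>2 * \<epsilon> < r\<^sup>2 / 4" "\<omega> < \<epsilon>\<^sup>2 * (\<beta> * b / 2)"
    using r goodD_C(2)[OF C] by (auto simp: \<epsilon>_def divide_simps)
  have near: "norm (x - P *v x) \<le> \<epsilon> * norm (P *v x)" if "x \<in> Hll \<beta>" for x
  proof (cases "x = 0")
    case False
    have "norm (x - P *v x) < \<epsilon> * norm (P *v x)"
      using low_form[OF goodD(1) \<epsilon>(1,2,4) invariant_H(1) that False] sigma0D by (auto simp: spectrum_on_ll)
    then show ?thesis by simp
  qed simp
  have near0: "norm (x - P *v x) \<le> \<epsilon> * norm (P *v x)" if "x \<in> H0 \<beta>" for x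
    using near that by (auto simp: H0_def)
  have near1: "norm (x - P *v x) \<le> \<epsilon> * norm (P *v x)" if "x \<in> H1 \<beta>" for x
    using near that by (auto simp: H1_def)
  have c: "c \<beta> < r / 10" by (rule goodD_C(1)[OF C])
  have sq0: "Re (z\<^sup>2) < r\<^sup>2 / 4" if "z \<in> Z0 \<beta>" for z
  proof -
    have "\<bar>Re z\<bar> < r / 2" using that c r abs_Re_le_cmod[of z] by (auto simp: Z0_def)
    then have "\<bar>Re z\<bar>\<^sup>2 < (r / 2)\<^sup>2" by (intro power_strict_mono) auto
    moreover have "Re (z\<^sup>2) \<le> \<bar>Re z\<bar>\<^sup>2" by (simp add: Re_power2)
    ultimately show ?thesis by (simp add: power_divide)
  qed
  have sq1: "r\<^sup>2 / 4 < Re (z\<^sup>2)" if z: "z \<in> Z1 \<beta>" for z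
  proof -
    have "9 / 10 * r \<le> \<bar>Re z\<bar>" using Z1D(2)[OF z] c by simp
    then have 1: "(9 / 10 * r)\<^sup>2 \<le> (Re z)\<^sup>2" using r by (metis abs_le_square_iff abs_of_nonneg zero_le_mult_iff less_imp_le zero_le_divide_iff zero_le_numeral)
    have "\<bar>Im z\<bar> \<le> r / 10" using ZD[of z] z c by auto
    then have 2: "(Im z)\<^sup>2 \<le> (r / 10)\<^sup>2" using r by (metis abs_le_square_iff abs_of_nonneg less_imp_le zero_le_divide_iff zero_le_numeral)
    have "r\<^sup>2 / 4 < (9 / 10 * r)\<^sup>2 - (r / 10)\<^sup>2" using r by (simp add: power2_eq_square field_simps)
    then show ?thesis using 1 2 unfolding Re_power2 by linarith
  qed
  have "vec.dim (H1 \<beta>) \<le> vec.dim (range ((*v) C))"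
  proof (rule dim_le_of_injective[of _ R])
    fix x assume x: "x \<in> H1 \<beta>" "R *v x = 0"
    show "x = 0"
    proof (rule ccontr)
      assume "x \<noteq> 0"
      then show False
        using nonzero_form[OF C \<epsilon>(1-3) invariant_H(4) near1 x(1)] sq1 x(2) by (auto simp: spectrum_on_1)
    qed
  qed (use invariant_H in \<open>auto simp: invariant_subspace_def intro: R_in\<close>)
  moreover have "vec.dim (H0 \<beta>) \<le> vec.dim (ker B \<inter> ker C)"
  proof (rule dim_le_of_injective[of _ "P - R"])
    fix x
    have eq: "(P - R) *v x = P *v x - R *v x" by (simp add: matrix_vector_mult_diff_rdistrib)
    have "P *v x - R *v x \<in> ker B"
      using P_in R_in range_C_subset vec.subspace_diff[OF subspace_ker] by blast
    moreover have "C *v (P *v x - R *v x) = 0" using C_compl_R[of "P *v x"] by simp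
    then have "P *v x - R *v x \<in> ker C" unfolding ker_def by blast
    ultimately show "(P - R) *v x \<in> ker B \<inter> ker C" unfolding eq by blast
    assume x: "x \<in> H0 \<beta>" "(P - R) *v x = 0"
    show "x = 0"
    proof (rule ccontr)
      assume "x \<noteq> 0"
      then show False
        using zero_form[OF C \<epsilon>(1-3) invariant_H(3) near0 x(1)] sq0 x(2) by (auto simp: spectrum_on_0 eq)
    qed
  qed (use invariant_H in \<open>auto simp: invariant_subspace_def\<close>)
  ultimately show ?thesis using dim_sum_0_1 dim_ker_C by linarith
qed

lemma finite_spectrum_on_H: "finite (spectrum_on (A \<beta>) (Hll \<beta>))" "finite (spectrum_on (A \<beta>) (Hhl \<beta>))"
    "finite (spectrum_on (A \<beta>) (H1 \<beta>))"
  by (intro finite_spectrum_on invariant_H)+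

text \<open>Ensures that \<open>Max\<close> and \<open>Min\<close> below are not taken over the
  empty set.\<close>

lemma spectrum_on_nonempty:
  assumes "invariant_subspace (A \<beta>) S" "0 < vec.dim S"
  shows "spectrum_on (A \<beta>) S \<noteq> {}"
proof
  assume "spectrum_on (A \<beta>) S = {}"
  then have "S = {0}" by (rule spectrum_on_empty[OF assms(1)])
  then show False using assms(2) by simp
qed

section \<open>Claims (a) to (d) for a fixed large damping\<close>

lemma low_high_splitting:
  "spectrum (A \<beta>) = sigma0 \<Omega> B \<beta> \<union> sigma1 NR \<Omega> B \<beta> \<and>
   sigma0 \<Omega> B \<beta> \<inter> sigma1 NR \<Omega> B \<beta> = {} \<and>
   unique_spectral_splitting (A \<beta>) UNIV (sigma0 \<Omega> B \<beta>) (sigma1 NR \<Omega> B \<beta>) (Hll \<beta>) (Hhl \<beta>) \<and>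
   vec.dim (Hhl \<beta>) = NR \<and> vec.dim (Hll \<beta>) = vec.dim (ker B)"
  using sigma_Un sigma_Int splitting_ll_hl dim_ll_hl by blast

lemma low_high_loss:
  "spectrum_on (A \<beta>) (Hll \<beta>) = {z \<in> spectrum (A \<beta>). 0 \<le> - Im z \<and> - Im z \<le> \<omega>} \<and>
   spectrum_on (A \<beta>) (Hhl \<beta>) = {z \<in> spectrum (A \<beta>). - Im z \<ge> \<beta> * b - \<omega>} \<and>
   \<beta> * b - \<omega> > \<omega> \<and>
   Max (quality ` spectrum_on (A \<beta>) (Hhl \<beta>)) \<le> ereal (1 / 2 * (\<omega> / (\<beta> * b - \<omega>))) \<and>
   1 / 2 * (\<omega> / (\<beta> * b - \<omega>)) < 1 / 2"
proof (intro conjI)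
  have pos: "0 < \<beta> * b - \<omega>" using goodD(2) \<omega>_nonneg by linarith
  show "Max (quality ` spectrum_on (A \<beta>) (Hhl \<beta>)) \<le> ereal (1 / 2 * (\<omega> / (\<beta> * b - \<omega>)))"
  proof (subst Max_le_iff)
    show "quality ` spectrum_on (A \<beta>) (Hhl \<beta>) \<noteq> {}"
      using spectrum_on_nonempty[OF invariant_H(2)] dim_ll_hl(2) NR_pos by simp
    show "\<forall>q\<in>quality ` spectrum_on (A \<beta>) (Hhl \<beta>). q \<le> ereal (1 / 2 * (\<omega> / (\<beta> * b - \<omega>)))"
    proof
      fix q assume "q \<in> quality ` spectrum_on (A \<beta>) (Hhl \<beta>)"
      then obtain z where z: "q = quality z" "\<beta> * b - \<omega> \<le> - Im z" "\<bar>Re z\<bar> \<le> \<omega>"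
        using sigma1D by (auto simp: spectrum_on_hl)
      have le: "\<bar>Re z\<bar> / (- Im z) \<le> \<omega> / (\<beta> * b - \<omega>)" using z pos by (intro frac_le) auto
      have "Im z \<noteq> 0" using z pos by auto
      then have "q = ereal (1 / 2 * (\<bar>Re z\<bar> / (- Im z)))"
        unfolding z(1) quality_def by (rule if_not_P)
      moreover have "1 / 2 * (\<bar>Re z\<bar> / (- Im z)) \<le> 1 / 2 * (\<omega> / (\<beta> * b - \<omega>))"
        using le by (intro mult_left_mono) auto
      ultimately show "q \<le> ereal (1 / 2 * (\<omega> / (\<beta> * b - \<omega>)))" by (metis ereal_less_eq(3))
    qed
  qed (simp add: finite_spectrum_on_H)
  show "1 / 2 * (\<omega> / (\<beta> * b - \<omega>)) < 1 / 2" using pos goodD(2) by (simp add: divide_simps)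
qed (use spectrum_on_ll spectrum_on_hl sigma0_iff sigma1_iff goodD(2) in auto)

lemma low_loss_splitting:
  "\<beta> > 2 * \<omega> / b \<and>
   (C \<noteq> 0 \<longrightarrow> c \<beta> < r / 2 \<and> r / 2 \<le> \<omega> / 2) \<and>
   Max ((\<lambda>z. Min ((\<lambda>\<rho>. cmod (z - \<rho>)) ` spectrum C)) ` spectrum_on (A \<beta>) (Hll \<beta>)) \<le> c \<beta> \<and>
   (\<forall>z \<in> spectrum_on (A \<beta>) (Hll \<beta>).
      Min ((\<lambda>\<rho>. cmod (complex_of_real (Re z) - \<rho>)) ` spectrum C) \<in> {0..c \<beta>} \<and>
      - Im z \<in> {0..c \<beta>}) \<and>
   unique_spectral_splitting (A \<beta>) (Hll \<beta>)
     (spectrum (A \<beta>) \<inter> cball 0 (c \<beta>))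
     (spectrum (A \<beta>) \<inter> (\<Union>\<rho> \<in> spectrum C - {0}. cball \<rho> (c \<beta>)))
     (H0 \<beta>) (H1 \<beta>) \<and>
   (C \<noteq> 0 \<longrightarrow>
      spectrum_on (A \<beta>) (H1 \<beta>) = spectrum (A \<beta>) \<inter> {z. r / 2 < cmod z \<and> cmod z \<le> \<omega>} \<and>
      spectrum_on (A \<beta>) (H0 \<beta>) = spectrum (A \<beta>) \<inter> {z. cmod z < r / 2}) \<and>
   vec.dim (H1 \<beta>) = vec.dim (range (\<lambda>x. C *v x)) \<and>
   vec.dim (H0 \<beta>) + vec.dim (H1 \<beta>) = vec.dim (ker B)"
proof (intro conjI impI ballI)
  show "\<beta> > 2 * \<omega> / b" using goodD(2) b_pos by (simp add: divide_less_eq)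
  have le: "Min ((\<lambda>\<rho>. cmod (z - \<rho>)) ` spectrum C) \<le> c \<beta>" if "\<exists>\<rho>\<in>spectrum C. cmod (z - \<rho>) \<le> c \<beta>" for z
    using that finite_spectrum_C by (auto intro: order_trans[OF Min_le])
  show "Max ((\<lambda>z. Min ((\<lambda>\<rho>. cmod (z - \<rho>)) ` spectrum C)) ` spectrum_on (A \<beta>) (Hll \<beta>)) \<le> c \<beta>"
  proof (subst Max_le_iff)
    show "(\<lambda>z. Min ((\<lambda>\<rho>. cmod (z - \<rho>)) ` spectrum C)) ` spectrum_on (A \<beta>) (Hll \<beta>) \<noteq> {}"
      using spectrum_on_nonempty[OF invariant_H(1)] dim_ll_hl(1) dim_ker_pos by simp
    show "\<forall>q\<in>(\<lambda>z. Min ((\<lambda>\<rho>. cmod (z - \<rho>)) ` spectrum C)) ` spectrum_on (A \<beta>) (Hll \<beta>). q \<le> c \<beta>"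
      using le low_near by (auto simp: spectrum_on_ll)
  qed (simp add: finite_spectrum_on_H)
  {
    fix z assume z: "z \<in> spectrum_on (A \<beta>) (Hll \<beta>)"
    then show "- Im z \<in> {0..c \<beta>}" using ZD sigma0_eq_Z by auto
    obtain \<rho> where \<rho>: "\<rho> \<in> spectrum C" "cmod (z - \<rho>) \<le> c \<beta>"
      using low_near z by (auto simp: spectrum_on_ll)
    have "complex_of_real (Re z) - \<rho> = complex_of_real (Re (z - \<rho>))"
      using spectrum_C_real[OF \<rho>(1)] by (simp add: complex_eq_iff)
    then have "cmod (complex_of_real (Re z) - \<rho>) = \<bar>Re (z - \<rho>)\<bar>" by (simp only: norm_of_real)
    then have "cmod (complex_of_real (Re z) - \<rho>) \<le> c \<beta>"
      using abs_Re_le_cmod[of "z - \<rho>"] \<rho>(2) by linarith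
    then have "Min ((\<lambda>\<rho>. cmod (complex_of_real (Re z) - \<rho>)) ` spectrum C) \<le> c \<beta>"
      using le \<rho>(1) by blast
    moreover have "Min ((\<lambda>\<rho>. cmod (complex_of_real (Re z) - \<rho>)) ` spectrum C)
        \<in> (\<lambda>\<rho>. cmod (complex_of_real (Re z) - \<rho>)) ` spectrum C"
      using finite_spectrum_C zero_in_spectrum_C by (intro Min_in) auto
    then have "0 \<le> Min ((\<lambda>\<rho>. cmod (complex_of_real (Re z) - \<rho>)) ` spectrum C)" by auto
    ultimately show "Min ((\<lambda>\<rho>. cmod (complex_of_real (Re z) - \<rho>)) ` spectrum C) \<in> {0..c \<beta>}" by simp
  }
  show "unique_spectral_splitting (A \<beta>) (Hll \<beta>)
     (spectrum (A \<beta>) \<inter> cball 0 (c \<beta>))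
     (spectrum (A \<beta>) \<inter> (\<Union>\<rho> \<in> spectrum C - {0}. cball \<rho> (c \<beta>)))
     (H0 \<beta>) (H1 \<beta>)" using splitting_0_1 by (simp add: Z0_def Z1_def)
  show "vec.dim (H1 \<beta>) = vec.dim (range (\<lambda>x. C *v x))" by (rule dim_1)
  show "vec.dim (H0 \<beta>) + vec.dim (H1 \<beta>) = vec.dim (ker B)" by (rule dim_sum_0_1)
  assume C: "C \<noteq> 0"
  have r: "0 < r" "r \<le> \<omega>" "c \<beta> < r / 10" using r_pos[OF C] r_le_\<omega>[OF C] goodD_C(1)[OF C] by auto
  show "c \<beta> < r / 2" "r / 2 \<le> \<omega> / 2" using r by auto
  have low: "z \<in> Z0 \<beta> \<union> Z1 \<beta>" if "z \<in> spectrum (A \<beta>)" "cmod z \<le> \<omega>" for z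
  proof -
    have "z \<in> sigma0 \<Omega> B \<beta>" using that by (simp add: sigma0_eq)
    then show ?thesis using sigma0_eq_Z spectrum_on_ll by simp
  qed
  have z0: "cmod z < r / 2" if "z \<in> Z0 \<beta>" for z using that r by (auto simp: Z0_def)
  have z1: "r / 2 < cmod z" if "z \<in> Z1 \<beta>" for z
    using Z1D(2)[OF that] abs_Re_le_cmod[of z] r by linarith
  show "spectrum_on (A \<beta>) (H1 \<beta>) = spectrum (A \<beta>) \<inter> {z. r / 2 < cmod z \<and> cmod z \<le> \<omega>}"
    using low z0 z1 ZD unfolding spectrum_on_1 by fastforce
  show "spectrum_on (A \<beta>) (H0 \<beta>) = spectrum (A \<beta>) \<inter> {z. cmod z < r / 2}"
  proof (intro set_eqI iffI)
    fix z assume z: "z \<in> spectrum (A \<beta>) \<inter> {z. cmod z < r / 2}"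
    then have "cmod z \<le> \<omega>" using r by auto
    then show "z \<in> spectrum_on (A \<beta>) (H0 \<beta>)"
      using low[of z] z1[of z] z unfolding spectrum_on_0 by auto
  qed (use z0 ZD in \<open>auto simp: spectrum_on_0\<close>)
qed

text \<open>\<open>c \<beta> < \<beta> * b - 2 * \<omega>\<close> keeps this strip away from the
  high-loss band, and the spectrum has no other part.\<close>

lemma low_if_Im_le:
  assumes "z \<in> spectrum (A \<beta>)" "- Im z \<le> c \<beta>"
  shows "z \<in> Z0 \<beta> \<union> Z1 \<beta>"
proof -
  have "z \<notin> sigma1 NR \<Omega> B \<beta>" using sigma1D[of z] assms(2) goodD(3) \<omega>_nonneg by auto
  then have "z \<in> sigma0 \<Omega> B \<beta>" using spectrum_cases[OF assms(1)] by blast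
  then show ?thesis using sigma0_eq_Z spectrum_on_ll by simp
qed

lemma low_loss_quality:
  "spectrum_on (A \<beta>) (H0 \<beta>) =
     {z \<in> spectrum (A \<beta>). 0 \<le> - Im z \<and> - Im z \<le> c \<beta> \<and> \<bar>Re z\<bar> \<le> c \<beta>} \<and>
   (C \<noteq> 0 \<longrightarrow>
      spectrum_on (A \<beta>) (H1 \<beta>) =
        {z \<in> spectrum (A \<beta>). 0 \<le> - Im z \<and> - Im z \<le> c \<beta> \<and> \<bar>Re z\<bar> \<ge> r - c \<beta>} \<and>
      r - c \<beta> > max (c \<beta>) (r / 2) \<and> r / 2 \<le> \<omega> / 2 \<and>
      Min (quality ` spectrum_on (A \<beta>) (H1 \<beta>)) \<ge> ereal (1 / 2 * ((r - c \<beta>) / c \<beta>)) \<and>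
      1 / 2 * ((r - c \<beta>) / c \<beta>) > 1 / 4 * (r / c \<beta>) \<and>
      1 / 4 * (r / c \<beta>) \<ge> 1 / 2) \<and>
   (\<forall>z \<in> spectrum_on (A \<beta>) (H1 \<beta>). Re z \<noteq> 0)"
proof (intro conjI impI)
  have z0: "\<bar>Re z\<bar> \<le> c \<beta>" if "z \<in> Z0 \<beta>" for z
    using that abs_Re_le_cmod[of z] by (auto simp: Z0_def)
  have z1: "c \<beta> < \<bar>Re z\<bar>" if "z \<in> Z1 \<beta>" for z
    using Z1D(1,2)[OF that] goodD_C(1) r_pos by force
  show "spectrum_on (A \<beta>) (H0 \<beta>) =
     {z \<in> spectrum (A \<beta>). 0 \<le> - Im z \<and> - Im z \<le> c \<beta> \<and> \<bar>Re z\<bar> \<le> c \<beta>}"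
    using low_if_Im_le z0 z1 ZD unfolding spectrum_on_0 by fastforce
  show "\<forall>z \<in> spectrum_on (A \<beta>) (H1 \<beta>). Re z \<noteq> 0"
    using z1 c_nonneg unfolding spectrum_on_1 by fastforce
  assume C: "C \<noteq> 0"
  have r: "0 < r" "r \<le> \<omega>" "c \<beta> < r / 10" using r_pos[OF C] r_le_\<omega>[OF C] goodD_C(1)[OF C] by auto
  \<comment> \<open>Division by \<open>c \<beta>\<close> is meaningful: \<open>C \<noteq> 0\<close>
    forces \<open>0 < \<omega>\<close>.\<close>
  have cpos: "0 < c \<beta>" using r goodD(2) by (simp add: c_eq)
  have z0': "\<bar>Re z\<bar> < r - c \<beta>" if "z \<in> Z0 \<beta>" for z using z0[OF that] r by linarith
  show "spectrum_on (A \<beta>) (H1 \<beta>) =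
        {z \<in> spectrum (A \<beta>). 0 \<le> - Im z \<and> - Im z \<le> c \<beta> \<and> \<bar>Re z\<bar> \<ge> r - c \<beta>}"
    using low_if_Im_le z0' Z1D(2) ZD unfolding spectrum_on_1 by fastforce
  show "r - c \<beta> > max (c \<beta>) (r / 2)" "r / 2 \<le> \<omega> / 2" using r by auto
  show "1 / 2 * ((r - c \<beta>) / c \<beta>) > 1 / 4 * (r / c \<beta>)" "1 / 4 * (r / c \<beta>) \<ge> 1 / 2"
    using r cpos by (auto simp: field_simps)
  show "Min (quality ` spectrum_on (A \<beta>) (H1 \<beta>)) \<ge> ereal (1 / 2 * ((r - c \<beta>) / c \<beta>))"
  proof (subst Min_ge_iff)
    have "\<not> range ((*v) C) \<subseteq> {0}" using C by (auto simp: matrix_eq)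
    then have "0 < vec.dim (H1 \<beta>)" unfolding dim_1 using vec.dim_eq_0 by (metis gr0I)
    then show "quality ` spectrum_on (A \<beta>) (H1 \<beta>) \<noteq> {}" using spectrum_on_nonempty[OF invariant_H(4)] by simp
    show "\<forall>q\<in>quality ` spectrum_on (A \<beta>) (H1 \<beta>). ereal (1 / 2 * ((r - c \<beta>) / c \<beta>)) \<le> q"
    proof
      fix q assume "q \<in> quality ` spectrum_on (A \<beta>) (H1 \<beta>)"
      then obtain z where z: "q = quality z" "z \<in> Z1 \<beta>" by (auto simp: spectrum_on_1)
      have Im: "0 \<le> - Im z" "- Im z \<le> c \<beta>" using ZD z(2) by auto
      have Re: "r - c \<beta> \<le> \<bar>Re z\<bar>" "Re z \<noteq> 0" using Z1D(2)[OF z(2)] r by auto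
      show "ereal (1 / 2 * ((r - c \<beta>) / c \<beta>)) \<le> q"
      \<comment> \<open>A real eigenvalue has infinite quality because its real part is nonzero;
        otherwise numerator and denominator are estimated separately.\<close>
      proof (cases "Im z = 0")
        case True
        then show ?thesis using Re z(1) by (simp add: quality_def)
      next
        case False
        then have "(r - c \<beta>) / c \<beta> \<le> \<bar>Re z\<bar> / (- Im z)" using Im Re r by (intro frac_le) auto
        then show ?thesis using False z(1) by (simp add: quality_def)
      qed
    qed
  qed (simp add: finite_spectrum_on_H)
qed

end

end

section \<open>Spans of the perturbed eigenvectors\<close>

text \<open>The two spans again decompose \<open>S\<close> and are contained in the given summands,
  so they are equal to them. No dimension has to be known.\<close>

lemma direct_sum_span:
  assumes S: "direct_sum S U V" and U: "vec.subspace U" and V: "vec.subspace V"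
    and X: "X \<subseteq> U" and Y: "Y \<subseteq> V" and "S \<subseteq> vec.span (X \<union> Y)"
  shows "vec.span X = U \<and> vec.span Y = V"
proof -
  have XU: "vec.span X \<subseteq> U" and YV: "vec.span Y \<subseteq> V"
    using vec.span_minimal X Y U V by auto
  have "vec.span X \<inter> vec.span Y = {0}"
    using XU YV S vec.span_zero unfolding direct_sum_def by blast
  moreover have "S = {x + y | x y. x \<in> vec.span X \<and> y \<in> vec.span Y}"
    using assms(6) XU YV S unfolding vec.span_Un direct_sum_def by blast
  ultimately have "direct_sum S (vec.span X) (vec.span Y)" by (simp add: direct_sum_def)
  from direct_sum_mono_eq[OF S this XU YV U V] show ?thesis .
qed

lemma bigo_tendsto_zero:
  fixes f g :: "real \<Rightarrow> real"
  assumes "f \<in> O[at_top](g)" "(g \<longlongrightarrow> 0) at_top"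
  shows "(f \<longlongrightarrow> 0) at_top"
proof -
  obtain k where k: "\<forall>\<^sub>F x in at_top. norm (f x) \<le> k * norm (g x)"
    using landau_o.bigE[OF assms(1)] by blast
  have "((\<lambda>x. k * norm (g x)) \<longlongrightarrow> 0) at_top"
    using tendsto_mult[OF tendsto_const[of k] tendsto_norm[OF assms(2)]] by simp
  then show ?thesis by (rule Lim_null_comparison[OF k])
qed

lemma inverse_power_tendsto_zero: "((\<lambda>\<beta>::real. 1 / \<beta>) \<longlongrightarrow> 0) at_top" "((\<lambda>\<beta>::real. 1 / \<beta>\<^sup>2) \<longlongrightarrow> 0) at_top"
proof -
  show *: "((\<lambda>\<beta>::real. 1 / \<beta>) \<longlongrightarrow> 0) at_top"
    using tendsto_inverse_0_at_top[OF filterlim_ident] by (simp add: inverse_eq_divide)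
  show "((\<lambda>\<beta>::real. 1 / \<beta>\<^sup>2) \<longlongrightarrow> 0) at_top"
    using tendsto_mult[OF * *] by (simp add: power2_eq_square)
qed

lemma not_tendsto_filterlim_at_top:
  fixes f :: "real \<Rightarrow> complex"
  assumes "(f \<longlongrightarrow> z) at_top" "filterlim (\<lambda>t. cmod (f t)) at_top at_top"
  shows False
proof -
  have "\<forall>\<^sub>F t in at_top. cmod (f t) < cmod z + 1"
    by (rule order_tendstoD(2)[OF tendsto_norm[OF assms(1)]]) simp
  moreover have "\<forall>\<^sub>F t in at_top. cmod z + 1 < cmod (f t)"
    using assms(2) unfolding filterlim_at_top_dense by blast
  ultimately have "\<forall>\<^sub>F t::real in at_top. False" by eventually_elim simp
  then show False by simp
qed

context dissipative
begin

lemma eigenpair_spans: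
  assumes exp: "eigenpair_expansion NR \<Omega> B w0 w \<zeta> \<rho> d"
  shows "\<forall>\<^sub>F \<beta> in at_top.
      Hhl \<beta> = vec.span {w j \<beta> | j. j \<in> {1..CARD('m)} \<and> filterlim (\<lambda>t. cmod (\<zeta> j t)) at_top at_top} \<and>
      H0 \<beta> = vec.span {w j \<beta> | j. j \<in> {1..CARD('m)} \<and>
        ((\<lambda>t. \<zeta> j t) \<longlongrightarrow> complex_of_real (\<rho> j)) at_top \<and> \<rho> j = 0} \<and>
      H1 \<beta> = vec.span {w j \<beta> | j. j \<in> {1..CARD('m)} \<and> w j \<beta> \<in> Hll \<beta> \<and>
        ((\<lambda>t. \<zeta> j t) \<longlongrightarrow> complex_of_real (\<rho> j)) at_top \<and> \<rho> j \<noteq> 0}"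
proof -
  let ?M = "CARD('m)"
  have NR_le: "NR \<le> ?M" using dim_ker_range by linarith
  have high: "filterlim (\<lambda>t. cmod (\<zeta> j t)) at_top at_top" if j: "j \<in> {1..NR}" for j
  proof -
    define f where "f t = cmod (\<zeta> j t - (- \<i> * complex_of_real (b_eig B j * t) + complex_of_real (\<rho> j)))" for t
    have "f \<in> O[at_top](\<lambda>\<beta>. 1 / \<beta>)" using exp j unfolding eigenpair_expansion_def f_def by blast
    then have "(f \<longlongrightarrow> 0) at_top" by (rule bigo_tendsto_zero[OF _ inverse_power_tendsto_zero(1)])
    then have "\<forall>\<^sub>F t in at_top. f t < 1" by (rule order_tendstoD(2)) simp
    \<comment> \<open>Growth is read off from the imaginary part, which is
      \<open>- b_eig B j * t\<close> up to a bounded error.\<close>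
    then have ev: "\<forall>\<^sub>F t in at_top. - (\<bar>\<rho> j\<bar> + 1) + b_eig B j * t \<le> cmod (\<zeta> j t)"
    proof eventually_elim
      case (elim t)
      have "\<bar>Im (\<zeta> j t) + b_eig B j * t\<bar> \<le> f t"
        using abs_Im_le_cmod[of "\<zeta> j t - (- \<i> * complex_of_real (b_eig B j * t) + complex_of_real (\<rho> j))"]
        by (simp add: f_def)
      then show ?case using elim abs_Im_le_cmod[of "\<zeta> j t"] abs_ge_zero[of "\<rho> j"] by linarith
    qed
    have "0 < b_eig B j" using b_eig_image nonzero_eigvals_pos j by blast
    then have "filterlim (\<lambda>t. b_eig B j * t) at_top at_top"
      by (rule filterlim_tendsto_pos_mult_at_top[OF tendsto_const _ filterlim_ident])
    then have "filterlim (\<lambda>t. - (\<bar>\<rho> j\<bar> + 1) + b_eig B j * t) at_top at_top"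
      by (rule filterlim_tendsto_add_at_top[OF tendsto_const])
    then show ?thesis using ev by (rule filterlim_at_top_mono)
  qed
  have low: "(\<zeta> j \<longlongrightarrow> complex_of_real (\<rho> j)) at_top" if j: "j \<in> {NR + 1..?M}" for j
  proof -
    define f where "f t = \<zeta> j t - (complex_of_real (\<rho> j) - \<i> * complex_of_real (d j / t))" for t
    have "(\<lambda>t. cmod (f t)) \<in> O[at_top](\<lambda>\<beta>. 1 / \<beta>\<^sup>2)" using exp j unfolding eigenpair_expansion_def f_def by blast
    then have "((\<lambda>t. cmod (f t)) \<longlongrightarrow> 0) at_top" by (rule bigo_tendsto_zero[OF _ inverse_power_tendsto_zero(2)])
    then have f0: "(f \<longlongrightarrow> 0) at_top" by (rule tendsto_norm_zero_cancel)
    have "((\<lambda>t. d j / t) \<longlongrightarrow> 0) at_top"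
      using tendsto_mult[OF tendsto_const[of "d j"] inverse_power_tendsto_zero(1)] by simp
    then have "((\<lambda>t. complex_of_real (d j / t)) \<longlongrightarrow> 0) at_top" by (metis tendsto_of_real of_real_0)
    then have "((\<lambda>t. f t + (complex_of_real (\<rho> j) - \<i> * complex_of_real (d j / t)))
        \<longlongrightarrow> 0 + (complex_of_real (\<rho> j) - \<i> * 0)) at_top"
      by (intro tendsto_intros f0)
    then show ?thesis by (simp add: f_def)
  qed
  have \<rho>: "complex_of_real (\<rho> j) \<in> spectrum C" if j: "j \<in> {NR + 1..?M}" for j
  proof -
    have "cinner (w0 j) (w0 j) = 1" using exp j unfolding eigenpair_expansion_def by fastforce
    then have "w0 j \<noteq> 0" by (auto simp: cinner_def)
    moreover have "C *v w0 j = complex_of_real (\<rho> j) *s w0 j" using exp j unfolding eigenpair_expansion_def by blast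
    ultimately show ?thesis unfolding spectrum_iff by blast
  qed
  \<comment> \<open>If \<open>C = 0\<close>, every \<open>\<rho> j\<close> with
    \<open>j > NR\<close> is an eigenvalue of the zero matrix, so \<open>J3\<close> is
    empty.\<close>
  define J1 J2 J3 where "J1 = {1..NR}" and "J2 = {j \<in> {NR + 1..?M}. \<rho> j = 0}"
    and "J3 = {j \<in> {NR + 1..?M}. \<rho> j \<noteq> 0}"
  have J: "{1..?M} = J1 \<union> (J2 \<union> J3)" using NR_le by (auto simp: J1_def J2_def J3_def)
  have basis: "\<forall>\<^sub>F \<beta> in at_top. vec.independent ((\<lambda>j. w j \<beta>) ` {1..?M}) \<and>
      vec.span ((\<lambda>j. w j \<beta>) ` {1..?M}) = UNIV \<and> (\<forall>j\<in>{1..?M}. A \<beta> *v w j \<beta> = \<zeta> j \<beta> *s w j \<beta>)"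
    using exp unfolding eigenpair_expansion_def by (auto elim: eventually_mono)
  have spec: "\<forall>\<^sub>F \<beta> in at_top. \<forall>j\<in>{1..?M}. A \<beta> *v w j \<beta> = \<zeta> j \<beta> *s w j \<beta> \<and> \<zeta> j \<beta> \<in> spectrum (A \<beta>)"
    using basis
  proof eventually_elim
    case (elim \<beta>)
    show ?case
    proof
      fix j assume j: "j \<in> {1..?M}"
      then have "w j \<beta> \<noteq> 0" using elim vec.dependent_zero[of "(\<lambda>j. w j \<beta>) ` {1..?M}"] by (metis image_eqI)
      then show "A \<beta> *v w j \<beta> = \<zeta> j \<beta> *s w j \<beta> \<and> \<zeta> j \<beta> \<in> spectrum (A \<beta>)"
        using elim j unfolding spectrum_iff by blast
    qed
  qed
  \<comment> \<open>The asymptotics enter only through thresholds: modulus above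
    \<open>\<omega>\<close> excludes the low-loss band, modulus below
    \<open>\<beta> * b - \<omega>\<close> the high-loss band, and \<open>r / 2\<close> decides
    between \<open>Z0\<close> and \<open>Z1\<close>.\<close>
  have ev1: "\<forall>\<^sub>F \<beta> in at_top. \<forall>j\<in>J1. \<omega> < cmod (\<zeta> j \<beta>)"
    using high unfolding J1_def filterlim_at_top_dense by (intro eventually_ball_finite) auto
  have ev2: "\<forall>\<^sub>F \<beta> in at_top. \<forall>j\<in>J2 \<union> J3. cmod (\<zeta> j \<beta>) < \<beta> * b - \<omega>"
  proof (intro eventually_ball_finite ballI)
    fix j assume "j \<in> J2 \<union> J3"
    then have "(\<zeta> j \<longlongrightarrow> complex_of_real (\<rho> j)) at_top" using low by (auto simp: J2_def J3_def)
    from order_tendstoD(2)[OF tendsto_norm[OF this], of "\<bar>\<rho> j\<bar> + 1"]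
    have 1: "\<forall>\<^sub>F \<beta> in at_top. cmod (\<zeta> j \<beta>) < \<bar>\<rho> j\<bar> + 1" by simp
    have "filterlim (\<lambda>\<beta>. - \<omega> + b * \<beta>) at_top at_top"
      by (rule filterlim_tendsto_add_at_top[OF tendsto_const
            filterlim_tendsto_pos_mult_at_top[OF tendsto_const b_pos filterlim_ident]])
    then have "\<forall>\<^sub>F \<beta> in at_top. \<bar>\<rho> j\<bar> + 1 < - \<omega> + b * \<beta>" unfolding filterlim_at_top_dense by blast
    with 1 show "\<forall>\<^sub>F \<beta> in at_top. cmod (\<zeta> j \<beta>) < \<beta> * b - \<omega>"
      by eventually_elim (simp add: mult.commute)
  qed (simp add: J2_def J3_def)
  have ev3: "\<forall>\<^sub>F \<beta> in at_top. \<forall>j\<in>J2. C \<noteq> 0 \<longrightarrow> cmod (\<zeta> j \<beta>) < r / 2"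
  proof (cases "C = 0")
    case C: False
    show ?thesis
    proof (intro eventually_ball_finite ballI)
      fix j assume j: "j \<in> J2"
      then have "(\<zeta> j \<longlongrightarrow> 0) at_top" using low[of j] by (auto simp: J2_def)
      from order_tendstoD(2)[OF tendsto_norm[OF this], of "r / 2"]
      show "\<forall>\<^sub>F \<beta> in at_top. C \<noteq> 0 \<longrightarrow> cmod (\<zeta> j \<beta>) < r / 2" using r_pos[OF C] by simp
    qed (simp add: J2_def)
  qed simp
  have ev4: "\<forall>\<^sub>F \<beta> in at_top. \<forall>j\<in>J3. C \<noteq> 0 \<and> r / 2 < cmod (\<zeta> j \<beta>)"
  proof (intro eventually_ball_finite ballI)
    fix j assume j: "j \<in> J3"
    then have \<rho>j: "complex_of_real (\<rho> j) \<in> spectrum C - {0}" using \<rho>[of j] by (simp add: J3_def)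
    have C: "C \<noteq> 0" using \<rho>j by (auto simp: spectrum_iff)
    have lim: "((\<lambda>t. cmod (\<zeta> j t)) \<longlongrightarrow> cmod (complex_of_real (\<rho> j))) at_top"
      by (rule tendsto_norm[OF low]) (use j in \<open>simp add: J3_def\<close>)
    have "r / 2 < cmod (complex_of_real (\<rho> j))" using r_le[OF C \<rho>j] r_pos[OF C] by simp
    then have "\<forall>\<^sub>F \<beta> in at_top. r / 2 < cmod (\<zeta> j \<beta>)" by (rule order_tendstoD(1)[OF lim])
    then show "\<forall>\<^sub>F \<beta> in at_top. C \<noteq> 0 \<and> r / 2 < cmod (\<zeta> j \<beta>)" using C by simp
  qed (simp add: J3_def)
  have not_low: "\<not> (\<zeta> j \<longlongrightarrow> complex_of_real (\<rho> j)) at_top" if "j \<in> J1" for j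
    using not_tendsto_filterlim_at_top high that by (auto simp: J1_def)
  have not_high: "\<not> filterlim (\<lambda>t. cmod (\<zeta> j t)) at_top at_top" if "j \<in> J2 \<union> J3" for j
    using not_tendsto_filterlim_at_top low[of j] that by (auto simp: J2_def J3_def)
  from basis spec ev1 ev2 ev3 ev4 eventually_good show ?thesis
  proof eventually_elim
    case (elim \<beta>)
    note good = elim(7)
    let ?W = "\<lambda>J. (\<lambda>j. w j \<beta>) ` J"
    have eig: "A \<beta> *v w j \<beta> = \<zeta> j \<beta> *s w j \<beta>" "\<zeta> j \<beta> \<in> spectrum (A \<beta>)" if "j \<in> {1..?M}" for j
      using elim(2) that by blast+
    have fin: "finite (sigma0 \<Omega> B \<beta>)" "finite (sigma1 NR \<Omega> B \<beta>)" "finite (Z0 \<beta>)" "finite (Z1 \<beta>)"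
      using finite_spectrum[of \<beta>] by (auto simp: sigma0_def sigma1_def Z0_def Z1_def)
    have W1: "?W J1 \<subseteq> Hhl \<beta>"
    proof
      fix x assume "x \<in> ?W J1"
      then obtain j where j: "x = w j \<beta>" "j \<in> J1" by blast
      then have jM: "j \<in> {1..?M}" using J by blast
      have "\<zeta> j \<beta> \<notin> sigma0 \<Omega> B \<beta>" using elim(3) j sigma0D[OF good, of "\<zeta> j \<beta>"] by force
      then have "\<zeta> j \<beta> \<in> sigma1 NR \<Omega> B \<beta>" using spectrum_cases[OF good eig(2)[OF jM]] by blast
      then show "x \<in> Hhl \<beta>" unfolding Hhl_def j(1) by (rule eigenvector_in_root_space[OF fin(2) _ eig(1)[OF jM]])
    qed
    have s0: "\<zeta> j \<beta> \<in> sigma0 \<Omega> B \<beta>" if "j \<in> J2 \<union> J3" for j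
    proof -
      have jM: "j \<in> {1..?M}" using that J by blast
      have "\<zeta> j \<beta> \<notin> sigma1 NR \<Omega> B \<beta>"
        using elim(4) that sigma1D[OF good, of "\<zeta> j \<beta>"] abs_Im_le_cmod[of "\<zeta> j \<beta>"] by force
      then show ?thesis using spectrum_cases[OF good eig(2)[OF jM]] by blast
    qed
    have wll: "w j \<beta> \<in> Hll \<beta>" if "j \<in> J2 \<union> J3" for j
    proof -
      have jM: "j \<in> {1..?M}" using that J by blast
      show ?thesis unfolding Hll_def by (rule eigenvector_in_root_space[OF fin(1) s0[OF that] eig(1)[OF jM]])
    qed
    have sZ: "\<zeta> j \<beta> \<in> Z0 \<beta> \<union> Z1 \<beta>" if "j \<in> J2 \<union> J3" for j
      using s0[OF that] sigma0_eq_Z[OF good] spectrum_on_ll[OF good] by simp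
    have W2: "?W J2 \<subseteq> H0 \<beta>"
    proof
      fix x assume "x \<in> ?W J2"
      then obtain j where j: "x = w j \<beta>" "j \<in> J2" by blast
      then have jM: "j \<in> {1..?M}" using J by blast
      have "\<zeta> j \<beta> \<notin> Z1 \<beta>"
        using elim(5) j(2) Z1D(1,2)[OF good, of "\<zeta> j \<beta>"] goodD_C(1)[OF good] abs_Re_le_cmod[of "\<zeta> j \<beta>"] r_pos by force
      then have "\<zeta> j \<beta> \<in> Z0 \<beta>" using sZ j(2) by blast
      then have "w j \<beta> \<in> root_space (A \<beta>) (Z0 \<beta>)" by (rule eigenvector_in_root_space[OF fin(3) _ eig(1)[OF jM]])
      then show "x \<in> H0 \<beta>" using wll j by (simp add: H0_def)
    qed
    have W3: "?W J3 \<subseteq> H1 \<beta>"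
    proof
      fix x assume "x \<in> ?W J3"
      then obtain j where j: "x = w j \<beta>" "j \<in> J3" by blast
      then have jM: "j \<in> {1..?M}" using J by blast
      have "C \<noteq> 0" "r / 2 < cmod (\<zeta> j \<beta>)" using elim(6) j(2) by blast+
      then have "\<zeta> j \<beta> \<notin> Z0 \<beta>" using goodD_C(1)[OF good] r_pos by (auto simp: Z0_def)
      then have "\<zeta> j \<beta> \<in> Z1 \<beta>" using sZ j(2) by blast
      then have "w j \<beta> \<in> root_space (A \<beta>) (Z1 \<beta>)" by (rule eigenvector_in_root_space[OF fin(4) _ eig(1)[OF jM]])
      then show "x \<in> H1 \<beta>" using wll j by (simp add: H1_def)
    qed
    have sub: "vec.subspace (Hll \<beta>)" "vec.subspace (Hhl \<beta>)" "vec.subspace (H0 \<beta>)" "vec.subspace (H1 \<beta>)"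
      using invariant_H by (auto simp: invariant_subspace_def)
    have "?W {1..?M} = ?W (J2 \<union> J3) \<union> ?W J1" unfolding J by blast
    \<comment> \<open>\<open>direct_sum_span\<close> is used twice: the eigenvectors spanning the
      whole space are sorted into \<open>Hll\<close> and \<open>Hhl\<close>, then those spanning
      \<open>Hll\<close> into \<open>H0\<close> and \<open>H1\<close>.\<close>
    then have 1: "vec.span (?W (J2 \<union> J3)) = Hll \<beta> \<and> vec.span (?W J1) = Hhl \<beta>"
      using elim(1) wll W1
      by (intro direct_sum_span[OF direct_sum_ll_hl[OF good] sub(1,2)]) auto
    have "?W (J2 \<union> J3) = ?W J2 \<union> ?W J3" by blast
    then have 2: "vec.span (?W J2) = H0 \<beta> \<and> vec.span (?W J3) = H1 \<beta>"
      using 1 W2 W3 by (intro direct_sum_span[OF direct_sum_0_1[OF good] sub(3,4)]) auto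
    \<comment> \<open>A convergent eigenvalue cannot have modulus tending to infinity, so the limit
      conditions select exactly the three index sets; membership in \<open>Hll\<close> for
      \<open>H1\<close> is \<open>wll\<close>.\<close>
    have E1: "{w j \<beta> | j. j \<in> {1..?M} \<and> filterlim (\<lambda>t. cmod (\<zeta> j t)) at_top at_top} = ?W J1"
      using high not_high unfolding J by (auto simp: J1_def)
    have E2: "{w j \<beta> | j. j \<in> {1..?M} \<and> (\<zeta> j \<longlongrightarrow> complex_of_real (\<rho> j)) at_top \<and> \<rho> j = 0} = ?W J2"
      using low not_low unfolding J by (auto simp: J2_def J3_def)
    have E3: "{w j \<beta> | j. j \<in> {1..?M} \<and> w j \<beta> \<in> Hll \<beta> \<and>
        (\<zeta> j \<longlongrightarrow> complex_of_real (\<rho> j)) at_top \<and> \<rho> j \<noteq> 0} = ?W J3"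
      using low not_low wll unfolding J by (auto simp: J2_def J3_def)
    show ?case using 1 2 E1 E2 E3 by simp
  qed
qed

end

section \<open>The system operator\<close>

definition cvec :: "complex ^ 'm \<Rightarrow> complex ^ 'm" where
  "cvec x = (\<chi> i. cnj (x $ i))"

lemma cvec_nth [simp]: "cvec x $ i = cnj (x $ i)"
  by (simp add: cvec_def)

lemma cvec_diff: "cvec (x - y) = cvec x - cvec y"
  by (simp add: vec_eq_iff)

lemma cvec_eq_0_iff [simp]: "cvec x = 0 \<longleftrightarrow> x = 0"
  by (simp add: vec_eq_iff)

lemma cvec_smult: "cvec (c *s x) = cnj c *s cvec x"
  by (simp add: vec_eq_iff)

lemma cvec_inner: "cvec x \<bullet> y = x \<bullet> cvec y"
  unfolding inner_vec_def by (simp add: inner_complex_def)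

lemma cvec_mult:
  assumes "\<And>i j. cnj (M $ i $ j) = s * M $ i $ j"
  shows "cvec (M *v x) = s *s (M *v cvec x)"
  by (simp add: vec_eq_iff matrix_vector_mult_def assms sum_distrib_left mult.assoc)

text \<open>\<open>\<Omega>\<close> is purely imaginary and \<open>B\<close> real, so conjugation of
  vectors commutes with the projection and anticommutes with \<open>\<Omega>\<close>. A conjugated
  eigenvector belongs to \<open>- cnj \<rho>\<close>, and \<open>\<rho>\<close> is real.\<close>

lemma spectrum_compression_symmetric:
  assumes \<Omega>: "\<And>i j. cnj (\<Omega> $ i $ j) = - \<Omega> $ i $ j" and B: "\<And>i j. cnj (B $ i $ j) = B $ i $ j"
    and "selfadj \<Omega>" and \<rho>: "\<rho> \<in> spectrum (compression \<Omega> B)"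
  shows "- \<rho> \<in> spectrum (compression \<Omega> B)"
proof -
  define P where "P = orth_proj (ker B)"
  have cB: "cvec (B *v x) = B *v cvec x" for x using cvec_mult[of B 1 x] B by simp
  have ck: "cvec x \<in> ker B" if "x \<in> ker B" for x
    using that cB[of x] by (simp add: ker_def) (metis cvec_eq_0_iff)
  have cP: "P *v cvec x = cvec (P *v x)" for x
    unfolding P_def
  proof (rule orth_proj_unique[OF subspace_ker ck[OF orth_proj_in[OF subspace_ker]]])
    fix y assume "y \<in> ker B"
    then have "cvec y \<bullet> (x - orth_proj (ker B) *v x) = 0" by (intro orth_proj_orthogonal subspace_ker ck)
    then show "y \<bullet> (cvec x - cvec (orth_proj (ker B) *v x)) = 0" by (simp add: cvec_inner cvec_diff)
  qed
  have c\<Omega>: "\<Omega> *v cvec x = - cvec (\<Omega> *v x)" for x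
    using cvec_mult[of \<Omega> "-1" x] \<Omega> by (simp add: vec_eq_iff)
  have C: "compression \<Omega> B *v x = P *v (\<Omega> *v (P *v x))" for x
    by (simp add: compression_def P_def matrix_vector_mul_assoc matrix_mul_assoc)
  have cC: "compression \<Omega> B *v cvec x = - cvec (compression \<Omega> B *v x)" for x
    unfolding C cP c\<Omega> matrix_vector_mult_uminus ..
  have "selfadj P" unfolding P_def by (rule selfadj_orth_proj[OF subspace_ker])
  then have "selfadj (compression \<Omega> B)"
    using \<open>selfadj \<Omega>\<close> by (simp add: selfadj_def C)
  then have "cnj \<rho> = \<rho>" using spectrum_real[OF _ \<rho>] by (simp add: complex_eq_iff)
  obtain x where x: "x \<noteq> 0" "compression \<Omega> B *v x = \<rho> *s x" using \<rho> by (auto simp: spectrum_iff)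
  have "compression \<Omega> B *v cvec x = (- \<rho>) *s cvec x"
    unfolding cC x(2) cvec_smult \<open>cnj \<rho> = \<rho>\<close> by simp
  then show ?thesis using x(1) unfolding spectrum_iff by (intro exI[of _ "cvec x"]) simp
qed

section \<open>Block vectors and real matrices acting on complex vectors\<close>

text \<open>By \<open>inj\<close> the image of \<open>e\<close> is totally real: it meets its
  multiple by \<open>\<i>\<close> only in 0, so a real basis stays independent over the complex
  numbers. This converts ranks of real matrices into complex dimensions.\<close>

lemma dim_complex_span:
  fixes e :: "'a::euclidean_space \<Rightarrow> complex ^ 'm"
  assumes e: "linear e" and inj: "\<And>x y. e x + \<i> *s e y = 0 \<Longrightarrow> x = 0 \<and> y = 0" and S: "subspace S"
  shows "vec.dim (vec.span (e ` S)) = dim S"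
proof -
  obtain E where E: "E \<subseteq> S" "independent E" "S \<subseteq> span E" "card E = dim S" using basis_exists[of S] by blast
  have fin: "finite E" using E(2) by (rule independent_imp_finite)
  have inj_e: "inj e"
    unfolding linear_injective_0[OF e] using inj[of _ 0] by (simp add: linear_0[OF e])
  then have injE: "inj_on e E" by (rule inj_on_subset) simp
  have sc: "e (r *\<^sub>R x) = complex_of_real r *s e x" for r x
    by (simp add: linear_scale[OF e] of_real_vector_smult)
  have "vec.independent (e ` E)"
  proof (subst vec.independent_explicit, intro conjI allI impI ballI)
    fix u v assume u: "(\<Sum>v\<in>e ` E. u v *s v) = 0" and v: "v \<in> e ` E"
    have sum_e: "e (\<Sum>b\<in>E. t b *\<^sub>R b) = (\<Sum>b\<in>E. complex_of_real (t b) *s e b)" for t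
      by (simp add: linear_sum[OF e] sc)
    have "e (\<Sum>b\<in>E. Re (u (e b)) *\<^sub>R b) + \<i> *s e (\<Sum>b\<in>E. Im (u (e b)) *\<^sub>R b)
        = (\<Sum>b\<in>E. (complex_of_real (Re (u (e b))) + \<i> * complex_of_real (Im (u (e b)))) *s e b)"
      unfolding sum_e vec.scale_sum_right
      by (simp add: sum.distrib[symmetric] vec.scale_scale vec.scale_left_distrib)
    also have "\<dots> = 0" using u by (simp add: complex_eq[symmetric] sum.reindex[OF injE])
    finally have "(\<Sum>b\<in>E. Re (u (e b)) *\<^sub>R b) = 0 \<and> (\<Sum>b\<in>E. Im (u (e b)) *\<^sub>R b) = 0" by (rule inj)
    then have "\<forall>b\<in>E. Re (u (e b)) = 0" "\<forall>b\<in>E. Im (u (e b)) = 0"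
      using independentD[OF E(2) fin order_refl, of "\<lambda>b. Re (u (e b))"]
        independentD[OF E(2) fin order_refl, of "\<lambda>b. Im (u (e b))"] by blast+
    then show "u v = 0" using v by (auto simp: complex_eq_iff)
  qed (use fin in auto)
  then have "vec.dim (vec.span (e ` E)) = card (e ` E)" by (rule vec.dim_span_eq_card_independent)
  also have "\<dots> = dim S" using E(4) by (simp add: card_image[OF injE])
  also have "vec.span (e ` E) = vec.span (e ` S)"
  proof
    show "vec.span (e ` E) \<subseteq> vec.span (e ` S)" using E(1) by (intro vec.span_mono) auto
    have "subspace {x. e x \<in> vec.span (e ` E)}"
      by (auto simp: subspace_def linear_0[OF e] linear_add[OF e] sc vec.span_zero vec.span_add vec.span_scale)
    then have "span E \<subseteq> {x. e x \<in> vec.span (e ` E)}"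
      by (intro span_minimal) (auto intro: vec.span_base)
    then have "e ` S \<subseteq> vec.span (e ` E)" using E(3) by blast
    then show "vec.span (e ` S) \<subseteq> vec.span (e ` E)" by (rule vec.span_minimal) simp
  qed
  finally show ?thesis .
qed

definition top_part :: "'a ^ ('n + 'n) \<Rightarrow> 'a ^ 'n" where "top_part x = (\<chi> i. x $ Inl i)"
definition bot_part :: "'a ^ ('n + 'n) \<Rightarrow> 'a ^ 'n" where "bot_part x = (\<chi> i. x $ Inr i)"
definition join_parts :: "'a ^ 'n \<Rightarrow> 'a ^ 'n \<Rightarrow> 'a ^ ('n + 'n)" where
  "join_parts u v = (\<chi> i. case i of Inl k \<Rightarrow> u $ k | Inr k \<Rightarrow> v $ k)"

lemma parts_join [simp]: "top_part (join_parts u v) = u" "bot_part (join_parts u v) = v"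
  by (simp_all add: top_part_def bot_part_def join_parts_def vec_eq_iff)

lemma join_parts_eq_iff: "x = y \<longleftrightarrow> top_part x = top_part y \<and> bot_part x = bot_part y"
  by (auto simp: top_part_def bot_part_def vec_eq_iff) (metis obj_sumE)

lemma parts_linear [simp]:
  "top_part (x + y) = top_part x + top_part y" "bot_part (x + y) = bot_part x + bot_part y"
  "top_part (x - y) = top_part x - top_part y" "bot_part (x - y) = bot_part x - bot_part y"
  for x y :: "complex ^ ('n::finite + 'n)"
  by (simp_all add: top_part_def bot_part_def vec_eq_iff)

lemma parts_smult [simp]: "top_part (c *s x) = c *s top_part x" "bot_part (c *s x) = c *s bot_part x"
  "top_part (r *\<^sub>R x) = r *\<^sub>R top_part x" "bot_part (r *\<^sub>R x) = r *\<^sub>R bot_part x"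
  for x :: "complex ^ ('n::finite + 'n)"
  by (simp_all add: top_part_def bot_part_def vec_eq_iff)

lemma parts_zero [simp]: "top_part 0 = (0 :: complex ^ 'n::finite)" "bot_part 0 = (0 :: complex ^ 'n::finite)"
  by (simp_all add: top_part_def bot_part_def vec_eq_iff)

lemma sum_UNIV_Plus: "(\<Sum>i\<in>(UNIV :: ('n::finite + 'n) set). f i) = (\<Sum>i\<in>UNIV. f (Inl i)) + (\<Sum>i\<in>UNIV. f (Inr i))"
  by (simp add: UNIV_Plus_UNIV[symmetric] sum.Plus del: UNIV_Plus_UNIV)

lemma block_parts:
  "top_part (block M11 M12 M21 M22 *v x) = M11 *v top_part x + M12 *v bot_part x"
  "bot_part (block M11 M12 M21 M22 *v x) = M21 *v top_part x + M22 *v bot_part x"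
  by (simp_all add: top_part_def bot_part_def block_def matrix_vector_mult_def vec_eq_iff sum_UNIV_Plus)

lemma inner_parts: "x \<bullet> y = top_part x \<bullet> top_part y + bot_part x \<bullet> bot_part y" for x y :: "complex ^ ('n::finite + 'n)"
  unfolding inner_vec_def by (simp add: sum_UNIV_Plus top_part_def bot_part_def)

definition vRe :: "complex ^ 'n \<Rightarrow> real ^ 'n" where "vRe u = (\<chi> i. Re (u $ i))"
definition vIm :: "complex ^ 'n \<Rightarrow> real ^ 'n" where "vIm u = (\<chi> i. Im (u $ i))"
definition of_real_vec :: "real ^ 'n \<Rightarrow> complex ^ 'n" where "of_real_vec x = (\<chi> i. complex_of_real (x $ i))"

lemma of_real_vec_eq_0_iff [simp]: "of_real_vec x = 0 \<longleftrightarrow> x = 0"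
  by (simp add: of_real_vec_def vec_eq_iff)

lemma of_real_vec_zero [simp]: "of_real_vec 0 = 0"
  by simp

lemma linear_of_real_vec: "linear of_real_vec"
  by (rule linearI) (auto simp: of_real_vec_def vec_eq_iff complex_eq_iff)

lemma vRe_vIm_eq: "u = of_real_vec (vRe u) + \<i> *s of_real_vec (vIm u)"
  by (simp add: of_real_vec_def vRe_def vIm_def vec_eq_iff complex_eq[symmetric])

lemma of_real_vec_combination_zero: "of_real_vec x + \<i> *s of_real_vec y = 0 \<Longrightarrow> x = 0 \<and> y = 0"
  by (auto simp: of_real_vec_def vec_eq_iff complex_eq_iff)

lemma complexify_of_real_vec: "complexify M *v of_real_vec x = of_real_vec (M *v x)"
  by (simp add: of_real_vec_def complexify_def matrix_vector_mult_def vec_eq_iff)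

lemma complexify_parts: "vRe (complexify M *v u) = M *v vRe u" "vIm (complexify M *v u) = M *v vIm u"
  by (simp_all add: vRe_def vIm_def complexify_def matrix_vector_mult_def vec_eq_iff)

lemma inner_vRe_vIm: "u \<bullet> v = vRe u \<bullet> vRe v + vIm u \<bullet> vIm v"
  unfolding inner_vec_def by (simp add: vRe_def vIm_def inner_complex_def sum.distrib)

lemma complexify_zero_iff:
  fixes M :: "real ^ 'n ^ 'm"
  shows "complexify M *v u = 0 \<longleftrightarrow> M *v vRe u = 0 \<and> M *v vIm u = 0"
proof -
  have "v = 0 \<longleftrightarrow> vRe v = 0 \<and> vIm v = 0" for v :: "complex ^ 'm"
    by (auto simp: vRe_def vIm_def vec_eq_iff complex_eq_iff)
  then show ?thesis by (simp add: complexify_parts)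
qed

lemma complexify_inner: "(complexify M *v u) \<bullet> v = u \<bullet> (complexify (transpose M) *v v)"
  by (simp only: inner_vRe_vIm complexify_parts real_matrix_inner)

lemma complexify_uminus: "complexify (- M) *v u = - (complexify M *v u)"
  by (simp add: complexify_def matrix_vector_mult_def vec_eq_iff sum_negf)

lemma pos_def_imp_pos_semidef: "pos_def M \<Longrightarrow> pos_semidef M"
  unfolding pos_def_def pos_semidef_def by (metis inner_zero_left less_eq_real_def)

text \<open>\<open>mat_sqrt \<alpha>\<close> is injective because its square is positive definite,
  so it has a two-sided inverse.\<close>

lemma
  assumes \<alpha>: "pos_def \<alpha>"
  shows inv_sqrt_symmetric: "transpose (matrix_inv (mat_sqrt \<alpha>)) = matrix_inv (mat_sqrt \<alpha>)"
    and inv_sqrt_inj: "matrix_inv (mat_sqrt \<alpha>) *v x = 0 \<Longrightarrow> x = 0"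
    and inv_sqrt_surj: "range ((*v) (matrix_inv (mat_sqrt \<alpha>))) = UNIV"
proof -
  define S K where "S = mat_sqrt \<alpha>" and "K = matrix_inv S"
  have S: "transpose S = S" "S ** S = \<alpha>"
    using pos_semidef_mat_sqrt mat_sqrt_square pos_def_imp_pos_semidef[OF \<alpha>] by (auto simp: S_def pos_semidef_def)
  have "x = 0" if "S *v x = 0" for x
  proof (rule ccontr)
    assume "x \<noteq> 0"
    then have "0 < x \<bullet> (\<alpha> *v x)" using \<alpha> by (simp add: pos_def_def)
    also have "\<alpha> *v x = S *v (S *v x)" by (simp add: S matrix_vector_mul_assoc)
    finally show False using that by simp
  qed
  then obtain S' where "S' ** S = mat 1" using matrix_left_invertible_ker[of S] by blast
  then have "\<exists>A'. S ** A' = mat 1 \<and> A' ** S = mat 1" by (metis invertible_left_inverse invertible_def)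
  \<comment> \<open>\<open>matrix_inv\<close> is defined by choice; only the existence of a
    two-sided inverse gives it the inverse property.\<close>
  from someI_ex[OF this] have K: "S ** K = mat 1" "K ** S = mat 1"
    by (simp_all add: K_def matrix_inv_def)
  have "transpose K = transpose K ** (S ** K)" by (simp add: K)
  also have "\<dots> = transpose (S ** K) ** K" by (simp add: matrix_transpose_mul S matrix_mul_assoc)
  also have "\<dots> = K" by (simp add: K transpose_mat)
  finally show "transpose (matrix_inv (mat_sqrt \<alpha>)) = matrix_inv (mat_sqrt \<alpha>)" by (simp add: K_def S_def)
  show "x = 0" if "matrix_inv (mat_sqrt \<alpha>) *v x = 0"
  proof -
    have "x = S *v (K *v x)" by (simp add: matrix_vector_mul_assoc K)
    then show ?thesis using that by (simp add: K_def S_def)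
  qed
  have "y = K *v (S *v y)" for y by (simp add: matrix_vector_mul_assoc K)
  then show "range ((*v) (matrix_inv (mat_sqrt \<alpha>))) = UNIV" unfolding K_def S_def by blast
qed

section \<open>The block operators of the lossy system\<close>

locale lossy_system =
  fixes \<alpha> \<eta> \<theta> R :: "real ^ 'n ^ 'n"
  assumes \<alpha>: "pos_def \<alpha>" and \<eta>: "pos_semidef \<eta>" and \<theta>: "transpose \<theta> = - \<theta>" and R: "pos_semidef R"
begin

abbreviation "K \<equiv> matrix_inv (mat_sqrt \<alpha>)"
abbreviation "\<Phi> \<equiv> mat_sqrt \<eta> ** K"
abbreviation "\<Omega> \<equiv> Omega_mat \<alpha> \<eta> \<theta>"
abbreviation "B \<equiv> B_mat \<alpha> R"

lemma Omega_parts: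
  "top_part (\<Omega> *v x) = (- 2 * \<i>) *s (complexify (K ** \<theta> ** K) *v top_part x)
     + (- \<i>) *s (complexify (transpose \<Phi>) *v bot_part x)"
  "bot_part (\<Omega> *v x) = \<i> *s (complexify \<Phi> *v top_part x)"
  by (simp_all add: Omega_mat_def Let_def block_parts cscale_mult)

lemma B_parts: "top_part (B *v x) = complexify (K ** R ** K) *v top_part x" "bot_part (B *v x) = 0"
  by (simp_all add: B_mat_def Let_def block_parts)

lemma ker_B_iff: "x \<in> ker B \<longleftrightarrow> complexify (K ** R ** K) *v top_part x = 0"
  unfolding ker_def mem_Collect_eq join_parts_eq_iff[of "B *v x"] B_parts by simp

text \<open>\<open>K ** \<theta> ** K\<close> is antisymmetric and the factor
  \<open>- 2 * \<i>\<close> makes it Hermitian; the off-diagonal blocks are adjoint to each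
  other.\<close>

lemma selfadj_Omega: "selfadj \<Omega>"
  unfolding selfadj_def
proof (intro allI)
  fix x y
  have "transpose (K ** \<theta> ** K) = - (K ** \<theta> ** K)"
    by (simp add: matrix_transpose_mul inv_sqrt_symmetric[OF \<alpha>] \<theta> matrix_eq
        matrix_uminus_vector_mult matrix_vector_mult_uminus flip: matrix_vector_mul_assoc)
  then have 1: "((- 2 * \<i>) *s (complexify (K ** \<theta> ** K) *v u)) \<bullet> v = u \<bullet> ((- 2 * \<i>) *s (complexify (K ** \<theta> ** K) *v v))" for u v
    by (simp add: cscale_component_inner complexify_inner complexify_uminus vector_scalar_commute[symmetric]
        matrix_vector_mult_uminus)
  have 2: "((- \<i>) *s (complexify (transpose \<Phi>) *v u)) \<bullet> v = u \<bullet> (\<i> *s (complexify \<Phi> *v v))" for u v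
    by (simp only: cscale_component_inner complexify_inner transpose_transpose vector_scalar_commute[symmetric]) simp
  have 3: "(\<i> *s (complexify \<Phi> *v u)) \<bullet> v = u \<bullet> ((- \<i>) *s (complexify (transpose \<Phi>) *v v))" for u v
    by (simp only: cscale_component_inner complexify_inner vector_scalar_commute[symmetric]) simp
  show "(\<Omega> *v x) \<bullet> y = x \<bullet> (\<Omega> *v y)"
    unfolding inner_parts[of "\<Omega> *v x"] inner_parts[of x "\<Omega> *v y"] Omega_parts inner_add_left inner_add_right 1 2 3 by simp
qed

lemma KRK_symmetric: "transpose (K ** R ** K) = K ** R ** K"
  using R by (simp add: matrix_transpose_mul inv_sqrt_symmetric[OF \<alpha>] pos_semidef_def matrix_mul_assoc)

lemma selfadj_B: "selfadj B"
  unfolding selfadj_def inner_parts B_parts complexify_inner KRK_symmetric by simp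

lemma B_nonneg: "0 \<le> x \<bullet> (B *v x)"
proof -
  have "0 \<le> v \<bullet> ((K ** R ** K) *v v)" for v
  proof -
    have "v \<bullet> ((K ** R ** K) *v v) = (K *v v) \<bullet> (R *v (K *v v))"
      by (simp only: real_matrix_inner[of K] inv_sqrt_symmetric[OF \<alpha>] matrix_vector_mul_assoc matrix_mul_assoc)
    then show ?thesis using R by (simp add: pos_semidef_def)
  qed
  then show ?thesis by (simp add: inner_parts B_parts inner_vRe_vIm[of "top_part x"] complexify_parts)
qed

lemma cnj_Omega: "cnj (\<Omega> $ i $ j) = - \<Omega> $ i $ j"
  by (cases i; cases j) (simp_all add: Omega_mat_def Let_def block_def cscale_def complexify_def)

lemma cnj_B: "cnj (B $ i $ j) = B $ i $ j"
  by (cases i; cases j) (simp_all add: B_mat_def Let_def block_def complexify_def)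

text \<open>The range of \<open>B\<close> is the complexification of the range of
  \<open>K ** R ** K\<close>, placed in the first summand; the invertible \<open>K\<close> on both
  sides does not change the rank.\<close>

lemma dim_range_B: "vec.dim (range ((*v) B)) = rank R"
proof -
  define e where "e x = (join_parts (of_real_vec x) 0 :: complex ^ ('n + 'n))" for x :: "real ^ 'n"
  define V where "V = range ((*v) (K ** R ** K))"
  have e: "linear e"
    by (rule linearI)
      (auto simp: e_def join_parts_eq_iff linear_add[OF linear_of_real_vec] linear_scale[OF linear_of_real_vec])
  have inj: "x = 0 \<and> y = 0" if "e x + \<i> *s e y = 0" for x y
    using of_real_vec_combination_zero[of x y] that by (simp add: e_def join_parts_eq_iff)
  have V: "subspace V" unfolding V_def by (rule linear_subspace_image[OF matrix_vector_mul_linear subspace_UNIV])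
  have eB: "e ((K ** R ** K) *v x) = B *v (e x)" for x
    by (simp add: e_def join_parts_eq_iff B_parts complexify_of_real_vec)
  have "vec.span (e ` V) = range ((*v) B)"
  proof
    have "vec.subspace (range ((*v) B))" by (rule vec.subspace_image) simp
    then show "vec.span (e ` V) \<subseteq> range ((*v) B)"
      by (intro vec.span_minimal) (auto simp: V_def eB)
    show "range ((*v) B) \<subseteq> vec.span (e ` V)"
    proof
      fix y assume "y \<in> range ((*v) B)"
      then obtain x where x: "y = B *v x" by blast
      define u where "u = top_part x"
      have "y = e ((K ** R ** K) *v vRe u) + \<i> *s e ((K ** R ** K) *v vIm u)"
        using vRe_vIm_eq[of "complexify (K ** R ** K) *v u"]
        by (simp add: x join_parts_eq_iff B_parts e_def u_def complexify_parts)
      then show "y \<in> vec.span (e ` V)"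
        by (simp add: V_def vec.span_add vec.span_scale vec.span_base)
    qed
  qed
  then have "vec.dim (range ((*v) B)) = dim V" using dim_complex_span[OF e inj V] by simp
  also have "V = (*v) K ` ((*v) R ` range ((*v) K))"
    by (auto simp: V_def image_image simp flip: matrix_vector_mul_assoc)
  also have "\<dots> = (*v) K ` range ((*v) R)" by (simp only: inv_sqrt_surj[OF \<alpha>])
  also have "dim ((*v) K ` range ((*v) R)) = dim (range ((*v) R))"
  proof (rule dim_image_eq)
    have "inj ((*v) K)" using inv_sqrt_inj[OF \<alpha>] linear_injective_0[of "(*v) K"] by auto
    then show "inj_on ((*v) K) (span (range ((*v) R)))" by (rule inj_on_subset) simp
  qed auto
  also have "\<dots> = rank R" by (simp add: rank_dim_range)
  finally show ?thesis .
qed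

text \<open>The second copy of the complex coordinate space. \<open>B\<close> does not act on it, so
  it lies in \<open>ker B\<close>.\<close>

abbreviation "L \<equiv> {x :: complex ^ ('n + 'n). top_part x = 0}"

lemma subspace_L: "vec.subspace L"
  by (rule vec.subspaceI) simp_all

lemma dim_L: "vec.dim L = CARD('n)"
proof -
  define e where "e x = (join_parts 0 (of_real_vec x) :: complex ^ ('n + 'n))" for x :: "real ^ 'n"
  have e: "linear e"
    by (rule linearI)
      (auto simp: e_def join_parts_eq_iff linear_add[OF linear_of_real_vec] linear_scale[OF linear_of_real_vec])
  have inj: "x = 0 \<and> y = 0" if "e x + \<i> *s e y = 0" for x y
    using of_real_vec_combination_zero[of x y] that by (simp add: e_def join_parts_eq_iff)
  have "vec.span (range e) = L"
  proof
    show "vec.span (range e) \<subseteq> L" by (rule vec.span_minimal[OF _ subspace_L]) (auto simp: e_def)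
    show "L \<subseteq> vec.span (range e)"
    proof
      fix x assume "x \<in> L"
      then have "x = e (vRe (bot_part x)) + \<i> *s e (vIm (bot_part x))"
        using vRe_vIm_eq[of "bot_part x"] by (simp add: e_def join_parts_eq_iff)
      then show "x \<in> vec.span (range e)" by (metis rangeI vec.span_add vec.span_base vec.span_scale)
    qed
  qed
  then show ?thesis using dim_complex_span[OF e inj subspace_UNIV] by simp
qed

lemma L_subset: "L \<subseteq> ker B" by (auto simp: ker_B_iff)

text \<open>\<open>ker B\<close> contains \<open>L\<close> and is therefore nonzero; the symmetry of
  the compressed spectrum comes from the imaginary entries of \<open>\<Omega>\<close> and the real
  entries of \<open>B\<close>.\<close>

lemma dissipative_Omega_B:
  assumes "0 < rank R"
  shows "dissipative \<Omega> B"
proof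
  show "B \<noteq> 0"
  proof
    assume "B = 0"
    then have "range ((*v) B) = {0}" by auto
    then show False using dim_range_B assms by simp
  qed
  have "0 < CARD('n)" by (rule zero_less_card_finite)
  then have "0 < vec.dim (ker B)" using dim_L vec.dim_subset[OF L_subset] by linarith
  moreover have "vec.dim {0 :: complex ^ ('n + 'n)} = 0" by simp
  ultimately show "ker B \<noteq> {0}" by (metis less_irrefl)
  show "- \<rho> \<in> spectrum (compression \<Omega> B)" if "\<rho> \<in> spectrum (compression \<Omega> B)" for \<rho>
    by (rule spectrum_compression_symmetric[OF cnj_Omega cnj_B selfadj_Omega that])
qed (fact selfadj_Omega selfadj_B B_nonneg)+

text \<open>For a real solution \<open>v\<close>, \<open>K v\<close> lies in both kernels, since
  \<open>\<eta> (K v)\<close> is \<open>mat_sqrt \<eta>\<close> applied to \<open>\<Phi> v\<close>.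
  Real and imaginary parts of \<open>u\<close> are treated separately.\<close>

lemma top_part_zero:
  assumes "ker R \<inter> ker \<eta> = {0}" "complexify (K ** R ** K) *v u = 0" "complexify \<Phi> *v u = 0"
  shows "u = 0"
proof -
  have "v = 0" if v: "(K ** R ** K) *v v = 0" "\<Phi> *v v = 0" for v
  proof -
    have "K *v (R *v (K *v v)) = 0" using v(1) by (simp add: matrix_vector_mul_assoc matrix_mul_assoc)
    then have "R *v (K *v v) = 0" by (rule inv_sqrt_inj[OF \<alpha>])
    moreover have "\<eta> *v (K *v v) = mat_sqrt \<eta> *v (\<Phi> *v v)"
      by (simp add: matrix_vector_mul_assoc matrix_mul_assoc mat_sqrt_square[OF \<eta>])
    ultimately have "K *v v \<in> ker R \<inter> ker \<eta>" using v(2) by (simp add: ker_def)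
    then have "K *v v = 0" using assms(1) by blast
    then show "v = 0" by (rule inv_sqrt_inj[OF \<alpha>])
  qed
  then have "vRe u = 0" "vIm u = 0" using assms(2,3) unfolding complexify_zero_iff by blast+
  then show ?thesis using vRe_vIm_eq[of u] by simp
qed

text \<open>Split \<open>ker B\<close> into \<open>K1\<close> and \<open>L\<close>. The kernel of
  the compression inside \<open>ker B\<close> turns out to be the orthogonal complement in
  \<open>L\<close> of the image \<open>Y\<close> of \<open>K1\<close> under \<open>\<Phi>\<close>.
  That map is injective on \<open>K1\<close>, so \<open>Y\<close> has dimension
  \<open>CARD('n) - rank R\<close> and the kernel has dimension \<open>rank R\<close>; subtract this
  from the dimension \<open>2 * CARD('n) - rank R\<close> of \<open>ker B\<close>.\<close>

lemma dim_range_compression: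
  assumes rank: "0 < rank R" and ker0: "ker R \<inter> ker \<eta> = {0}"
  shows "vec.dim (range ((*v) (compression \<Omega> B))) = 2 * (CARD('n) - rank R)"
proof -
  interpret D: dissipative \<Omega> B by (rule dissipative_Omega_B[OF rank])
  define K1 where "K1 = {x \<in> ker B. \<forall>y\<in>L. y \<bullet> x = 0}"
  have K1_eq: "K1 = {x \<in> ker B. bot_part x = 0}"
  proof -
    have "(\<forall>y\<in>L. y \<bullet> x = 0) \<longleftrightarrow> bot_part x = 0" for x :: "complex ^ ('n + 'n)"
    proof
      assume "\<forall>y\<in>L. y \<bullet> x = 0"
      then have "join_parts 0 (bot_part x) \<bullet> x = 0" by simp
      then show "bot_part x = 0" by (simp add: inner_parts)
    qed (auto simp: inner_parts)
    then show ?thesis by (auto simp: K1_def)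
  qed
  have sK1: "vec.subspace K1"
    unfolding K1_eq using subspace_ker[of B]
    by (auto intro!: vec.subspaceI simp: vec.subspace_0 vec.subspace_add vec.subspace_scale)
  have dimK1: "vec.dim (ker B) = CARD('n) + vec.dim K1"
    using dim_orthogonal_within[OF subspace_L subspace_ker L_subset] by (simp add: dim_L K1_def)
  \<comment> \<open>The part of \<open>\<Omega>\<close> that leads from the first summand to the
    second.\<close>
  define D where "D = block 0 0 (cscale \<i> (complexify \<Phi>)) 0"
  have D: "top_part (D *v x) = 0" "bot_part (D *v x) = bot_part (\<Omega> *v x)" for x
    by (simp_all add: D_def block_parts Omega_parts cscale_mult)
  define Y where "Y = (*v) D ` K1"
  have "inj_on ((*v) D) K1"
  proof (rule inj_onI)
    fix x y assume xy: "x \<in> K1" "y \<in> K1" "D *v x = D *v y"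
    then have z: "x - y \<in> K1" "D *v (x - y) = 0"
      by (auto simp: vec.subspace_diff[OF sK1] matrix_vector_mult_diff_distrib)
    have "bot_part (\<Omega> *v (x - y)) = 0" using z(2) D(2)[of "x - y"] by simp
    then have "complexify \<Phi> *v top_part (x - y) = 0" unfolding Omega_parts by simp
    moreover have "complexify (K ** R ** K) *v top_part (x - y) = 0" using z(1) by (simp add: K1_eq ker_B_iff del: parts_linear)
    ultimately have "top_part (x - y) = 0" by (rule top_part_zero[OF ker0, rotated])
    moreover have "bot_part (x - y) = 0" using z(1) unfolding K1_eq by blast
    ultimately show "x = y" by (simp add: join_parts_eq_iff[of x y])
  qed
  then have dimY: "vec.dim Y = vec.dim K1"
    unfolding Y_def using sK1 by (intro vec.dim_image_eq) (auto simp: vec.span_eq_iff[THEN iffD2])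
  have sY: "vec.subspace Y" unfolding Y_def by (rule vec.subspace_image[OF sK1])
  have YL: "Y \<subseteq> L" by (auto simp: Y_def D)
  have DOmega: "(D *v x) \<bullet> u = x \<bullet> (\<Omega> *v u)" if "top_part u = 0" for x u
    using that selfadjD[OF selfadj_Omega, of x u] by (simp add: inner_parts[of _ u] D)
  have kerC: "ker B \<inter> ker (compression \<Omega> B) = {u \<in> L. \<forall>y\<in>Y. y \<bullet> u = 0}"
  proof (intro set_eqI iffI)
    fix u assume u: "u \<in> ker B \<inter> ker (compression \<Omega> B)"
    have "D.P *v (\<Omega> *v u) = 0" using u D.C_apply[of u] D.P_id[of u] by (simp add: ker_def)
    then have orth: "y \<bullet> (\<Omega> *v u) = 0" if "y \<in> ker B" for y
      using orth_proj_inner[OF subspace_ker that, of "\<Omega> *v u"] by simp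
    \<comment> \<open>Testing with a vector of \<open>L\<close> shows that \<open>\<Phi>\<close>
      kills the top part of \<open>u\<close>, which therefore vanishes; testing with
      \<open>K1\<close> then gives orthogonality to \<open>Y\<close>.\<close>
    have "join_parts 0 (bot_part (\<Omega> *v u)) \<in> ker B" using L_subset by auto
    from orth[OF this] have "bot_part (\<Omega> *v u) = 0" by (simp add: inner_parts)
    then have "complexify \<Phi> *v top_part u = 0" unfolding Omega_parts by simp
    then have "top_part u = 0" using u by (intro top_part_zero[OF ker0, of "top_part u"]) (auto simp: ker_B_iff)
    moreover from this have "y \<bullet> u = 0" if "y \<in> Y" for y
      using that orth DOmega by (auto simp: Y_def K1_def)
    ultimately show "u \<in> {u \<in> L. \<forall>y\<in>Y. y \<bullet> u = 0}" by blast
  next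
    fix u assume u: "u \<in> {u \<in> L. \<forall>y\<in>Y. y \<bullet> u = 0}"
    then have uk: "u \<in> ker B" and top: "top_part u = 0" using L_subset by auto
    have orth: "y \<bullet> (\<Omega> *v u) = 0" if y: "y \<in> ker B" for y
    proof -
      \<comment> \<open>The bottom part of \<open>\<Omega> u\<close> is zero, so only the top part
        of \<open>y\<close> matters, and alone it still belongs to \<open>K1\<close>.\<close>
      define y' where "y' = join_parts (top_part y) 0"
      have "y' \<in> K1" using y by (simp add: K1_eq y'_def ker_B_iff)
      then have "y' \<bullet> (\<Omega> *v u) = 0" using u DOmega[OF top, of y'] by (auto simp: Y_def)
      moreover have "bot_part (\<Omega> *v u) = 0" by (simp add: Omega_parts top)
      ultimately show ?thesis by (simp add: inner_parts[of _ "\<Omega> *v u"] y'_def)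
    qed
    have "(D.P *v (\<Omega> *v u)) \<bullet> (D.P *v (\<Omega> *v u)) = 0"
      using orth[OF D.P_in] orth_proj_inner[OF subspace_ker D.P_in] by simp
    then have "compression \<Omega> B *v u = 0" by (simp add: D.C_apply D.P_id[OF uk])
    then show "u \<in> ker B \<inter> ker (compression \<Omega> B)" using uk by (simp add: ker_def)
  qed
  have "CARD('n) = vec.dim K1 + vec.dim (ker B \<inter> ker (compression \<Omega> B))"
    using dim_orthogonal_within[OF sY subspace_L YL] by (simp add: dimY kerC dim_L)
  moreover have "vec.dim (ker B) + rank R = 2 * CARD('n)"
    using D.dim_ker_range by (simp add: dim_range_B)
  ultimately show ?thesis using D.dim_ker_C dimK1 by linarith
qed

end

text \<open>The four families are chosen before \<open>\<beta>\<close>, so that the same subspaces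
  serve from (a) to (e); the uniqueness clauses determine them for large \<open>\<beta>\<close>.
  Claims about \<open>r\<close> carry the guard \<open>C \<noteq> 0\<close>, without which
  \<open>rho_min\<close> is the minimum of an empty set. The dimension of \<open>H0\<close> is given
  through a sum, which stays clear of a further truncated subtraction.\<close>

theorem theorem38:
  fixes \<alpha> \<eta> \<theta> R :: "real ^ 'n ^ 'n"
    and \<Omega> B C :: "complex ^ ('n + 'n) ^ ('n + 'n)"
    and A :: "real \<Rightarrow> complex ^ ('n + 'n) ^ ('n + 'n)"
    and N NR :: nat
    and \<omega> b r :: real
    and c :: "real \<Rightarrow> real"
  assumes "pos_def \<alpha>" and "pos_semidef \<eta>" and "transpose \<theta> = - \<theta>" and "pos_semidef R"
    and "N = CARD('n)" and "NR = rank R" and "0 < NR" and "NR < N"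
    and "\<Omega> = Omega_mat \<alpha> \<eta> \<theta>" and "B = B_mat \<alpha> R" and "A = A_mat \<Omega> B"
    and "C = compression \<Omega> B"
    and "\<omega> = omega_max \<Omega>" and "b = b_min B" and "r = rho_min \<Omega> B" and "c = c_bound \<Omega> B"
  shows "\<exists>Hhl Hll H0 H1 :: real \<Rightarrow> (complex ^ ('n + 'n)) set.
    (\<forall>\<^sub>F \<beta> in at_top.
       \<comment> \<open>(a)\<close>
       (spectrum (A \<beta>) = sigma0 \<Omega> B \<beta> \<union> sigma1 NR \<Omega> B \<beta> \<and>
        sigma0 \<Omega> B \<beta> \<inter> sigma1 NR \<Omega> B \<beta> = {} \<and>
        unique_spectral_splitting (A \<beta>) UNIV (sigma0 \<Omega> B \<beta>) (sigma1 NR \<Omega> B \<beta>) (Hll \<beta>) (Hhl \<beta>) \<and>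
        vec.dim (Hhl \<beta>) = NR \<and> vec.dim (Hll \<beta>) = 2 * N - NR) \<and>
       \<comment> \<open>(b)\<close>
       (spectrum_on (A \<beta>) (Hll \<beta>) = {\<zeta> \<in> spectrum (A \<beta>). 0 \<le> - Im \<zeta> \<and> - Im \<zeta> \<le> \<omega>} \<and>
        spectrum_on (A \<beta>) (Hhl \<beta>) = {\<zeta> \<in> spectrum (A \<beta>). - Im \<zeta> \<ge> \<beta> * b - \<omega>} \<and>
        \<beta> * b - \<omega> > \<omega> \<and>
        Max (quality ` spectrum_on (A \<beta>) (Hhl \<beta>)) \<le> ereal (1 / 2 * (\<omega> / (\<beta> * b - \<omega>))) \<and>
        1 / 2 * (\<omega> / (\<beta> * b - \<omega>)) < 1 / 2) \<and>
       \<comment> \<open>(c)\<close>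
       (\<beta> > 2 * \<omega> / b \<and>
        (C \<noteq> 0 \<longrightarrow> c \<beta> < r / 2 \<and> r / 2 \<le> \<omega> / 2) \<and>
        Max ((\<lambda>\<zeta>. Min ((\<lambda>\<rho>. cmod (\<zeta> - \<rho>)) ` spectrum C)) ` spectrum_on (A \<beta>) (Hll \<beta>)) \<le> c \<beta> \<and>
        (\<forall>\<zeta> \<in> spectrum_on (A \<beta>) (Hll \<beta>).
           Min ((\<lambda>\<rho>. cmod (complex_of_real (Re \<zeta>) - \<rho>)) ` spectrum C) \<in> {0..c \<beta>} \<and>
           - Im \<zeta> \<in> {0..c \<beta>}) \<and>
        unique_spectral_splitting (A \<beta>) (Hll \<beta>)
          (spectrum (A \<beta>) \<inter> cball 0 (c \<beta>))
          (spectrum (A \<beta>) \<inter> (\<Union>\<rho> \<in> spectrum C - {0}. cball \<rho> (c \<beta>)))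
          (H0 \<beta>) (H1 \<beta>) \<and>
        (C \<noteq> 0 \<longrightarrow>
           spectrum_on (A \<beta>) (H1 \<beta>) = spectrum (A \<beta>) \<inter> {\<zeta>. r / 2 < cmod \<zeta> \<and> cmod \<zeta> \<le> \<omega>} \<and>
           spectrum_on (A \<beta>) (H0 \<beta>) = spectrum (A \<beta>) \<inter> {\<zeta>. cmod \<zeta> < r / 2}) \<and>
        vec.dim (H1 \<beta>) = vec.dim (range (\<lambda>x. C *v x)) \<and>
        vec.dim (H0 \<beta>) + vec.dim (H1 \<beta>) = 2 * N - NR \<and>
        (ker R \<inter> ker \<eta> = {0} \<longrightarrow> vec.dim (H1 \<beta>) = 2 * (N - NR))) \<and>
       \<comment> \<open>(d)\<close>
       (spectrum_on (A \<beta>) (H0 \<beta>) =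
          {\<zeta> \<in> spectrum (A \<beta>). 0 \<le> - Im \<zeta> \<and> - Im \<zeta> \<le> c \<beta> \<and> \<bar>Re \<zeta>\<bar> \<le> c \<beta>} \<and>
        (C \<noteq> 0 \<longrightarrow>
           spectrum_on (A \<beta>) (H1 \<beta>) =
             {\<zeta> \<in> spectrum (A \<beta>). 0 \<le> - Im \<zeta> \<and> - Im \<zeta> \<le> c \<beta> \<and> \<bar>Re \<zeta>\<bar> \<ge> r - c \<beta>} \<and>
           r - c \<beta> > max (c \<beta>) (r / 2) \<and> r / 2 \<le> \<omega> / 2 \<and>
           Min (quality ` spectrum_on (A \<beta>) (H1 \<beta>)) \<ge> ereal (1 / 2 * ((r - c \<beta>) / c \<beta>)) \<and>
           1 / 2 * ((r - c \<beta>) / c \<beta>) > 1 / 4 * (r / c \<beta>) \<and>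
           1 / 4 * (r / c \<beta>) \<ge> 1 / 2) \<and>
        (\<forall>\<zeta> \<in> spectrum_on (A \<beta>) (H1 \<beta>). Re \<zeta> \<noteq> 0))) \<and>
    \<comment> \<open>(d), behaviour of \<open>c\<close>\<close>
    antimono_on {2 * \<omega> / b<..} c \<and>
    (C \<noteq> 0 \<longrightarrow> monotone_on {2 * \<omega> / b<..} (<) (>) c) \<and>
    (c \<longlongrightarrow> 0) at_top \<and>
    \<comment> \<open>(e)\<close>
    (\<forall>w0 w \<zeta> \<rho> d. eigenpair_expansion NR \<Omega> B w0 w \<zeta> \<rho> d \<longrightarrow>
       (\<forall>\<^sub>F \<beta> in at_top.
          Hhl \<beta> = vec.span {w j \<beta> | j. j \<in> {1..2 * N} \<and>
            filterlim (\<lambda>t. cmod (\<zeta> j t)) at_top at_top} \<and>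
          H0 \<beta> = vec.span {w j \<beta> | j. j \<in> {1..2 * N} \<and>
            ((\<lambda>t. \<zeta> j t) \<longlongrightarrow> complex_of_real (\<rho> j)) at_top \<and> \<rho> j = 0} \<and>
          H1 \<beta> = vec.span {w j \<beta> | j. j \<in> {1..2 * N} \<and> w j \<beta> \<in> Hll \<beta> \<and>
            ((\<lambda>t. \<zeta> j t) \<longlongrightarrow> complex_of_real (\<rho> j)) at_top \<and> \<rho> j \<noteq> 0}))"
proof -
  have rank: "0 < rank R" using assms by simp
  have card: "CARD('n + 'n) = 2 * N" using assms by simp
  interpret S: lossy_system \<alpha> \<eta> \<theta> R by (rule lossy_system.intro) fact+
  interpret D: dissipative \<Omega> B
    unfolding assms(9,10) by (rule S.dissipative_Omega_B[OF rank])
  have NR: "vec.dim (range ((*v) B)) = NR"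
    unfolding assms(10) using S.dim_range_B assms(6) by simp
  have ker: "vec.dim (ker B) = 2 * N - NR"
    using D.dim_ker_range unfolding card NR by linarith
  have rank_C: "vec.dim (range ((*v) (compression \<Omega> B))) = 2 * (N - NR)" if "ker R \<inter> ker \<eta> = {0}"
    using S.dim_range_compression[OF rank that] assms by simp
  note a = D.low_high_splitting[unfolded NR ker] and c = D.low_loss_splitting[unfolded ker]
  have dim: "ker R \<inter> ker \<eta> = {0} \<longrightarrow> vec.dim (D.H1 \<beta>) = 2 * (N - NR)" if "D.good \<beta>" for \<beta>
    using rank_C D.dim_1[OF that] by simp
  show ?thesis
    unfolding assms(11-16)
  proof (rule exI[of _ D.Hhl], rule exI[of _ D.Hll], rule exI[of _ D.H0], rule exI[of _ D.H1], intro conjI)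
    show "antimono_on {2 * omega_max \<Omega> / b_min B<..} (c_bound \<Omega> B)" by (rule D.c_antimono)
    show "compression \<Omega> B \<noteq> 0 \<longrightarrow> monotone_on {2 * omega_max \<Omega> / b_min B<..} (<) (>) (c_bound \<Omega> B)"
      using D.c_strict by blast
    show "(c_bound \<Omega> B \<longlongrightarrow> 0) at_top" by (rule D.c_tendsto)
    show "\<forall>w0 w \<zeta> \<rho> d. eigenpair_expansion NR \<Omega> B w0 w \<zeta> \<rho> d \<longrightarrow>
       (\<forall>\<^sub>F \<beta> in at_top.
          D.Hhl \<beta> = vec.span {w j \<beta> | j. j \<in> {1..2 * N} \<and>
            filterlim (\<lambda>t. cmod (\<zeta> j t)) at_top at_top} \<and>
          D.H0 \<beta> = vec.span {w j \<beta> | j. j \<in> {1..2 * N} \<and>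
            ((\<lambda>t. \<zeta> j t) \<longlongrightarrow> complex_of_real (\<rho> j)) at_top \<and> \<rho> j = 0} \<and>
          D.H1 \<beta> = vec.span {w j \<beta> | j. j \<in> {1..2 * N} \<and> w j \<beta> \<in> D.Hll \<beta> \<and>
            ((\<lambda>t. \<zeta> j t) \<longlongrightarrow> complex_of_real (\<rho> j)) at_top \<and> \<rho> j \<noteq> 0})"
      using D.eigenpair_spans unfolding NR card by blast
  qed (rule eventually_mono[OF D.eventually_good], frule a, frule D.low_high_loss, frule c, frule D.low_loss_quality, frule dim,
      elim conjE, (intro conjI; assumption))
qed

end
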